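(* Let $K_1$ and $K_2$ be 2-bridge knots. Then $K_1$ and $K_2$ are incomparable and $\{K_1,K_2\}$ has an upper bound with respect to the Ohtsuki-Riley-Sakuma partial order if and only if there are vectors $\mathbf{a},\mathbf{b}\in\mathcal{S}_{even}$ with $K_1=\Phi(\hat{\mathbf{a}})$ and $K_2=\Phi(\hat{\mathbf{b}})$ such that $$\mathbf{a}=(\overbrace{\mathbf{w},\mathbf{w},\dots,\mathbf{w}}^{p},\mathbf{e})\quad\text{and}\quad \mathbf{b}=(\overbrace{\mathbf{w},\mathbf{w},\dots,\mathbf{w}}^{q},\mathbf{e}),$$ where $p,q$ are nonnegative integers, $\mathbf{e}$ is some (possibly empty) vector in $\mathcal{S}_{even}$, $\mathbf{w}=(\mathbf{e},\mathbf{m},\mathbf{e}^{-1},\mathbf{n})$, $m$ and $n$ are even integers, and neither of $2q+1$ and $2p+1$ divides the other.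
   Context: 2-bridge knots: for coprime integers $p,q$ with $q$ odd, $K_{p/q}$ is the corresponding 2-bridge knot. Mirror images are not distinguished: $K_{p/q}$ and $K_{p'/q'}$ are regarded as equal (equivalent) iff $q'=q$ and $p'\equiv p^{\pm1}$ or $p'\equiv -p^{\pm1} \pmod q$. Continued fractions: $r+[a_1,\dots,a_n]=r+\cfrac{1}{a_1+\cfrac{1}{a_2+\cdots+\cfrac{1}{a_n}}}$. Expanded even vectors: $\mathcal{S}$ is the set of integer vectors $(a_1,\dots,a_n)$ such that each $a_i\in\{-2,0,2\}$; $a_1\neq0$ and $a_n\neq 0$; and if $a_i=0$ then $a_{i-1}=a_{i+1}=\pm2$. $\mathcal{S}_{even}$ is the set of those of even length; the empty vector is also admitted (it represents the unknot, $0+[\,]=0/1$). $\mathbf{b}^{-1}$ denotes $\mathbf{b}$ read backwards and $(\mathbf{a},\mathbf{b})$ denotes concatenation. Vectors $\mathbf{a},\mathbf{b}\in\mathcal{S}$ are equivalent if $\mathbf{a}=\pm\mathbf{b}$ or $\mathbf{a}=\pm\mathbf{b}^{-1}$; the class of $\mathbf{a}$ is $\hat{\mathbf{a}}$, and $\hat{\mathcal S}_{even}$ is the set of classes of vectors of even length. $\Phi(\hat{\mathbf{a}})=K_{p/q}$ where $p/q=0+[\mathbf{a}]$; on $\hat{\mathcal S}_{even}$ this is a well-defined bijection onto the equivalence classes of 2-bridge knots. For an even integer $m$, the boldface $\mathbf{m}$ denotes the vector $(0)$ if $m=0$, and otherwise the vector $\pm(2,0,2,0,\dots,0,2)$ whose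 entries sum to $m$. In particular $\mathbf{2c_i}$ is the vector of this type with sum $2c_i$. Parsing: for $\mathbf{a},\mathbf{c}\in\mathcal{S}$, $\mathbf{c}$ parses with respect to $\mathbf{a}$ if $\mathbf{c}=(\epsilon_1\mathbf{a},\mathbf{2c_1},\epsilon_2\mathbf{a}^{-1},\mathbf{2c_2},\epsilon_3\mathbf{a},\mathbf{2c_3},\dots,\epsilon_n\mathbf{a}^{(-1)^{n-1}})$ for some $n\geq1$, where $\epsilon_1=1$, $\epsilon_i\in\{-1,1\}$, each $c_i$ is an integer, and $\epsilon_i=\epsilon_{i+1}$ whenever $c_i=0$. $\hat{\mathbf{c}}$ parses with respect to $\hat{\mathbf{a}}$ if some representative of $\hat{\mathbf{c}}$ parses with respect to some representative of $\hat{\mathbf{a}}$. Ohtsuki-Riley-Sakuma partial order: for 2-bridge knots $K_1=\Phi(\hat{\mathbf{c}})$, $K_2=\Phi(\hat{\mathbf{a}})$ with $\hat{\mathbf c},\hat{\mathbf a}\in\hat{\mathcal S}_{even}$, $K_1\ge K_2$ means $\hat{\mathbf{c}}$ parses with respect to $\hat{\mathbf{a}}$. $K_1,K_2$ are incomparable if neither $K_1\ge K_2$ nor $K_2\ge K_1$. A 2-bridge knot $J$ is an upper bound of a set of 2-bridge knots if $J\ge K$ for every $K$ in the set. *)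

theory Defs
  imports "HOL-Number_Theory.Cong" HOL.Rat
begin

text \<open>
  A 2-bridge knot \<open>K\<^bsub>p/q\<^esub>\<close> is represented by its fraction, up to the classification of
  2-bridge knots with mirror images not distinguished. The denominator of a fraction is normalised
  to be positive. The conditions \<open>p' \<equiv> p\<^sup>-\<^sup>1\<close> and \<open>p' \<equiv> - p\<^sup>-\<^sup>1\<close> modulo \<open>q\<close> are written multiplicatively.
\<close>

definition bridge_fraction :: "int \<times> int \<Rightarrow> bool" where
  "bridge_fraction = (\<lambda>(p, q). q > 0 \<and> odd q \<and> coprime p q)"

definition bridge_eq :: "int \<times> int \<Rightarrow> int \<times> int \<Rightarrow> bool" where
  "bridge_eq = (\<lambda>(p, q) (p', q'). bridge_fraction (p, q) \<and> bridge_fraction (p', q') \<and> q' = q \<and>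
     ([p' = p] (mod q) \<or> [p' = - p] (mod q) \<or> [p' * p = 1] (mod q) \<or> [p' * p = - 1] (mod q)))"

lemma bridge_eq_trans:
  assumes "bridge_eq x y" "bridge_eq y z"
  shows "bridge_eq x z"
proof -
  obtain p q where x: "x = (p, q)" by force
  from assms(1) obtain p' where y: "y = (p', q)"
    by (cases y) (auto simp: x bridge_eq_def)
  from assms(2) obtain p'' where z: "z = (p'', q)"
    by (cases z) (auto simp: y bridge_eq_def)
  have fr: "bridge_fraction (p, q)" "bridge_fraction (p', q)" "bridge_fraction (p'', q)"
    using assms by (auto simp: x y z bridge_eq_def)
  then have cop: "coprime q p'"
    by (auto simp: bridge_fraction_def coprime_commute)
  have A: "q dvd p' - p \<or> q dvd p' + p \<or> q dvd p' * p - 1 \<or> q dvd p' * p + 1"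
    using assms(1) by (auto simp: x y bridge_eq_def cong_iff_dvd_diff)
  have B: "q dvd p'' - p' \<or> q dvd p'' + p' \<or> q dvd p'' * p' - 1 \<or> q dvd p'' * p' + 1"
    using assms(2) by (auto simp: y z bridge_eq_def cong_iff_dvd_diff)
  have cancel: "q dvd u" if "q dvd p' * u" for u
    using that cop by (simp add: coprime_dvd_mult_right_iff)
  have lin: "q dvd w" if "q dvd u" "q dvd v" "w = s * u + t * v" for u v w s t
    using that by simp
  have "q dvd p'' - p \<or> q dvd p'' + p \<or> q dvd p'' * p - 1 \<or> q dvd p'' * p + 1"
    using A B
  proof (elim disjE)
    assume "q dvd p' - p" "q dvd p'' - p'"
    from lin[OF this, of "p'' - p" 1 1] show ?thesis by simp
  next
    assume "q dvd p' - p" "q dvd p'' + p'"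
    from lin[OF this, of "p'' + p" "-1" 1] show ?thesis by simp
  next
    assume "q dvd p' - p" "q dvd p'' * p' - 1"
    from lin[OF this, of "p'' * p - 1" "-p''" 1] show ?thesis by (simp add: algebra_simps)
  next
    assume "q dvd p' - p" "q dvd p'' * p' + 1"
    from lin[OF this, of "p'' * p + 1" "-p''" 1] show ?thesis by (simp add: algebra_simps)
  next
    assume "q dvd p' + p" "q dvd p'' - p'"
    from lin[OF this, of "p'' + p" 1 1] show ?thesis by simp
  next
    assume "q dvd p' + p" "q dvd p'' + p'"
    from lin[OF this, of "p'' - p" "-1" 1] show ?thesis by simp
  next
    assume "q dvd p' + p" "q dvd p'' * p' - 1"
    from lin[OF this, of "p'' * p + 1" "p''" "-1"] show ?thesis by (simp add: algebra_simps)
  next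
    assume "q dvd p' + p" "q dvd p'' * p' + 1"
    from lin[OF this, of "p'' * p - 1" "p''" "-1"] show ?thesis by (simp add: algebra_simps)
  next
    assume "q dvd p' * p - 1" "q dvd p'' - p'"
    from lin[OF this, of "p'' * p - 1" 1 p] show ?thesis by (simp add: algebra_simps)
  next
    assume "q dvd p' * p - 1" "q dvd p'' + p'"
    from lin[OF this, of "p'' * p + 1" "-1" p] show ?thesis by (simp add: algebra_simps)
  next
    assume "q dvd p' * p - 1" "q dvd p'' * p' - 1"
    from cancel[of "p'' - p", OF lin[OF this, of _ "-1" 1]] show ?thesis
      by (simp add: algebra_simps)
  next
    assume "q dvd p' * p - 1" "q dvd p'' * p' + 1"
    from cancel[of "p'' + p", OF lin[OF this, of _ 1 1]] show ?thesis
      by (simp add: algebra_simps)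
  next
    assume "q dvd p' * p + 1" "q dvd p'' - p'"
    from lin[OF this, of "p'' * p + 1" 1 p] show ?thesis by (simp add: algebra_simps)
  next
    assume "q dvd p' * p + 1" "q dvd p'' + p'"
    from lin[OF this, of "p'' * p - 1" "-1" p] show ?thesis by (simp add: algebra_simps)
  next
    assume "q dvd p' * p + 1" "q dvd p'' * p' - 1"
    from cancel[of "p'' + p", OF lin[OF this, of _ 1 1]] show ?thesis
      by (simp add: algebra_simps)
  next
    assume "q dvd p' * p + 1" "q dvd p'' * p' + 1"
    from cancel[of "p'' - p", OF lin[OF this, of _ "-1" 1]] show ?thesis
      by (simp add: algebra_simps)
  qed
  then show ?thesis
    using fr by (auto simp: x z bridge_eq_def cong_iff_dvd_diff)
qed

quotient_type two_bridge_knot = "int \<times> int" / partial: bridge_eq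
proof (rule part_equivpI)
  show "\<exists>x. bridge_eq x x"
    by (rule exI[of _ "(0, 1)"]) (simp add: bridge_eq_def bridge_fraction_def)
  have "bridge_eq y x" if "bridge_eq x y" for x y
    using that by (cases x; cases y) (auto simp: bridge_eq_def cong_iff_dvd_diff mult.commute
        dvd_diff_commute add.commute)
  then show "symp bridge_eq" by (auto intro: sympI)
  show "transp bridge_eq" by (rule transpI) (rule bridge_eq_trans)
qed

definition bridge_knot :: "int \<Rightarrow> int \<Rightarrow> two_bridge_knot" where
  "bridge_knot p q = abs_two_bridge_knot (p, q)"

lemma bridge_knot_eq_iff:
  assumes "bridge_fraction (p, q)" "bridge_fraction (p', q')"
  shows "bridge_knot p q = bridge_knot p' q' \<longleftrightarrow> bridge_eq (p, q) (p', q')"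
proof -
  have "bridge_eq (p, q) (p, q)" "bridge_eq (p', q') (p', q')"
    using assms by (auto simp: bridge_eq_def)
  with Quotient3_two_bridge_knot show ?thesis
    unfolding bridge_knot_def by (metis Quotient3_rel)
qed

text \<open>
  \<open>cfrac r [a\<^sub>1, \<dots>, a\<^sub>n]\<close> is \<open>r + [a\<^sub>1, \<dots>, a\<^sub>n]\<close>. On the vectors considered below no
  denominator vanishes, so the convention \<open>x / 0 = 0\<close> plays no role.
\<close>

fun cfrac :: "int \<Rightarrow> int list \<Rightarrow> rat" where
  "cfrac r [] = of_int r"
| "cfrac r (a # as) = of_int r + 1 / cfrac a as"

definition S :: "int list set" where
  "S = {a. set a \<subseteq> {-2, 0, 2} \<and> (a \<noteq> [] \<longrightarrow> hd a \<noteq> 0 \<and> last a \<noteq> 0) \<and>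
     (\<forall>i. 0 < i \<and> Suc i < length a \<and> a ! i = 0 \<longrightarrow>
        a ! (i - 1) = a ! Suc i \<and> a ! Suc i \<in> {-2, 2})}"

definition S_even :: "int list set" where
  "S_even = {a \<in> S. even (length a)}"

definition scale :: "int \<Rightarrow> int list \<Rightarrow> int list" where
  "scale \<epsilon> a = map ((*) \<epsilon>) a"

definition vec_equiv :: "(int list \<times> int list) set" where
  "vec_equiv = {(a, b). a \<in> S \<and> b \<in> S \<and> (\<exists>\<epsilon>\<in>{-1, 1}. a = scale \<epsilon> b \<or> a = scale \<epsilon> (rev b))}"

definition vec_class :: "int list \<Rightarrow> int list set" where
  "vec_class a = vec_equiv `` {a}"

definition S_even_classes :: "int list set set" where
  "S_even_classes = S_even // vec_equiv"

text \<open>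
  The value \<open>K\<^bsub>p/q\<^esub>\<close> does not depend on the representative of a class of even-length vectors, so
  the image below is a singleton. The function \<open>quotient_of\<close> returns the reduced fraction with
  positive denominator.
\<close>

definition Phi :: "int list set \<Rightarrow> two_bridge_knot" where
  "Phi A = the_elem ((\<lambda>a. case quotient_of (cfrac 0 a) of (p, q) \<Rightarrow> bridge_knot p q) ` A)"

text \<open>The boldface vector of an even integer.\<close>

definition bold :: "int \<Rightarrow> int list" where
  "bold m = (if m = 0 then [0]
     else 2 * sgn m # concat (replicate (nat (\<bar>m\<bar> div 2) - 1) [0, 2 * sgn m]))"

lemma sum_list_bold:
  assumes "even m"
  shows "sum_list (bold m) = m"
proof (cases "m = 0")
  case False
  have "sum_list (concat (replicate k [0, x])) = int k * x" for k x
    by (induction k) (auto simp: algebra_simps)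
  moreover have "\<bar>m\<bar> div 2 \<ge> 1" "2 * (\<bar>m\<bar> div 2) = \<bar>m\<bar>"
    using assms False by auto
  ultimately show ?thesis
    using False by (simp add: bold_def of_nat_diff algebra_simps) (simp add: sgn_if split: if_splits)
qed (simp add: bold_def)

text \<open>The \<open>i\<close>-th block \<open>\<epsilon>\<^sub>i a\<close> or \<open>\<epsilon>\<^sub>i a\<^sup>-\<^sup>1\<close> of a parsing, with indices starting from 1.\<close>

definition parse_block :: "int list \<Rightarrow> (nat \<Rightarrow> int) \<Rightarrow> nat \<Rightarrow> int list" where
  "parse_block a \<epsilon> i = scale (\<epsilon> i) (if odd i then a else rev a)"

definition parses :: "int list \<Rightarrow> int list \<Rightarrow> bool" where
  "parses c a \<longleftrightarrow> a \<in> S \<and> c \<in> S \<and>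
     (\<exists>(n::nat) \<epsilon> k. n \<ge> 1 \<and> \<epsilon> 1 = 1 \<and> (\<forall>i\<in>{1..n}. \<epsilon> i \<in> {-1, 1}) \<and>
        (\<forall>i\<in>{1..<n}. k i = 0 \<longrightarrow> \<epsilon> i = \<epsilon> (i + 1)) \<and>
        c = parse_block a \<epsilon> 1 @
            concat (map (\<lambda>i. bold (2 * k i) @ parse_block a \<epsilon> (i + 1)) [1..<n]))"

definition class_parses :: "int list set \<Rightarrow> int list set \<Rightarrow> bool" where
  "class_parses C A \<longleftrightarrow> (\<exists>c\<in>C. \<exists>a\<in>A. parses c a)"

definition ors_ge :: "two_bridge_knot \<Rightarrow> two_bridge_knot \<Rightarrow> bool" where
  "ors_ge K\<^sub>1 K\<^sub>2 \<longleftrightarrow>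
     (\<exists>C\<in>S_even_classes. \<exists>A\<in>S_even_classes. K\<^sub>1 = Phi C \<and> K\<^sub>2 = Phi A \<and> class_parses C A)"

definition incomparable :: "two_bridge_knot \<Rightarrow> two_bridge_knot \<Rightarrow> bool" where
  "incomparable K\<^sub>1 K\<^sub>2 \<longleftrightarrow> \<not> ors_ge K\<^sub>1 K\<^sub>2 \<and> \<not> ors_ge K\<^sub>2 K\<^sub>1"

definition upper_bound :: "two_bridge_knot \<Rightarrow> two_bridge_knot set \<Rightarrow> bool" where
  "upper_bound J X \<longleftrightarrow> (\<forall>K\<in>X. ors_ge J K)"

end

theory Submission imports Defs begin

text \<open>
  A vector is coded by a word over three letters: \<open>Alpha\<close> and \<open>Beta\<close> for nonzero entries in even
  and odd positions, \<open>Gamma\<close> for zero entries and for one kind of sign junction. Then \<open>c\<close> parses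
  with respect to \<open>a\<close> exactly if the word of \<open>c\<close> leads from the left to the right end of a path
  graph whose edges carry the letters of the word of \<open>a\<close>.

  A shortest common upper bound \<open>v\<close> of \<open>a\<close> and \<open>b\<close>, with \<open>b\<close> the longer one, never repeats a pair of
  states. It starts with \<open>b\<close>, a gap, \<open>b\<close> reversed, a gap, and \<open>b\<close>, and crossing the gaps marks two
  points inside \<open>a\<close>. So three walks in the graph of \<open>a\<close> read \<open>b\<close>, always in distinct states. As
  only the two end states have more than two edges, the next letter is forced at each step: \<open>b\<close> is a
  prefix of the periodic word \<open>a m a\<^sup>-\<^sup>1 n a m \<dots>\<close>. This word also has period \<open>|b| - |a|\<close>, all of
  \<open>v\<close> is a prefix of it, and its length shows that the greatest common divisor of the two periods is
  contained an odd number of times in the first one. By the mirror symmetries a period has the form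
  \<open>e m e\<^sup>-\<^sup>1 n\<close>.

  Conversely, a walk in the graph of \<open>w\<^sup>p e\<close> along \<open>w\<^sup>q e\<close> bounces regularly between the ends and
  stops at the right end only if \<open>2p + 1\<close> divides \<open>2q + 1\<close>.
\<close>

section \<open>Words and Schreier graphs\<close>

text \<open>From both states of \<open>a\<close> at the ends of a gap of \<open>b\<close>, the
  reversed \<open>b\<close> can be read. Following the two readings to the ends of \<open>a\<close>
  yields factorizations \<open>a = x m y = p n x\<close> with palindromes \<open>y\<close> and
  \<open>p\<close> (\<open>border_pair\<close>). If \<open>x\<close> is nonempty, a gap at the right
  end of \<open>b\<close> also makes \<open>n\<close> a palindrome, and one at the left end makes
  \<open>m\<close> one. The two gaps may give different factorizations, so it has to be shown that
  \<open>m\<close> and \<open>n\<close> do not depend on the factorization. The border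
  \<open>x\<close> then gives the bouncing word of \<open>a\<close> the extra period
  \<open>|p n|\<close>, and the palindromes give it a reflection; a translate and a reflected copy
  of the walk along it are the second and third walk. Odd multiplicity is what a power needs: for
  \<open>a = w^P e\<close> one round \<open>a m a^-1 n\<close> equals \<open>w^(2P+1)\<close>. It is
  forced because \<open>v\<close> stops at the right ends of both graphs at once. Two degenerate
  cases, an empty border and a period too short to hold \<open>m\<close> and \<open>n\<close> side
  by side, are the reason why the letter before the first \<open>Beta\<close> of \<open>a\<close>
  has to be \<open>Alpha\<close>.\<close>

datatype colour = Alpha | Beta | Gamma

fun swap :: "colour \<Rightarrow> colour" where
  "swap Alpha = Beta"
| "swap Beta = Alpha"
| "swap Gamma = Gamma"

lemma swap_swap [simp]: "swap (swap c) = c"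
  by (cases c) auto

lemma swap_eq_iff [simp]: "swap c = swap d \<longleftrightarrow> c = d"
  by (metis swap_swap)

lemma swap_eq_Alpha [simp]: "swap c = Alpha \<longleftrightarrow> c = Beta"
  and swap_eq_Beta [simp]: "swap c = Beta \<longleftrightarrow> c = Alpha"
  by (cases c; simp)+

lemma inj_swap: "inj_on swap X"
  by (rule inj_onI) simp

text \<open>Reversing a vector of even length exchanges even and odd positions, hence
  \<open>Alpha\<close> and \<open>Beta\<close>; this is the effect on its word
  (\<open>code_rev_even\<close>).\<close>

definition dual :: "colour list \<Rightarrow> colour list" where
  "dual w = map swap (rev w)"

lemma dual_dual [simp]: "dual (dual w) = w"
  by (simp add: dual_def rev_map comp_def)

lemma dual_Nil [simp]: "dual [] = []"
  by (simp add: dual_def)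

lemma dual_eq_Nil_iff [simp]: "dual w = [] \<longleftrightarrow> w = []"
  by (simp add: dual_def)

lemma dual_append [simp]: "dual (u @ w) = dual w @ dual u"
  by (simp add: dual_def)

lemma length_dual [simp]: "length (dual w) = length w"
  by (simp add: dual_def)

lemma dual_rev: "dual (rev w) = rev (dual w)"
  by (simp add: dual_def rev_map)

lemma dual_eq_iff [simp]: "dual u = dual w \<longleftrightarrow> u = w"
  by (metis dual_dual)

lemma set_dual: "set (dual w) = swap ` set w"
  by (simp add: dual_def)

lemma Alpha_in_dual [simp]: "Alpha \<in> set (dual w) \<longleftrightarrow> Beta \<in> set w"
  unfolding set_dual by (metis image_iff swap.simps(2) swap_eq_Alpha)

lemma Beta_in_dual [simp]: "Beta \<in> set (dual w) \<longleftrightarrow> Alpha \<in> set w"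
  using Alpha_in_dual[of "dual w"] by simp

text \<open>The words of nonempty expanded vectors of even length (\<open>code_valid\<close>,
  \<open>decode\<close>). In their graphs only \<open>Alpha\<close> leaves the left end and only
  \<open>Beta\<close> the right end.\<close>

definition valid :: "colour list \<Rightarrow> bool" where
  "valid u \<longleftrightarrow> u \<noteq> [] \<and> distinct_adj u \<and> hd u = Alpha \<and> last u = Beta"

lemma valid_dual [simp]: "valid (dual u) \<longleftrightarrow> valid u"
  by (auto simp: valid_def dual_def hd_rev last_rev hd_map last_map distinct_adj_map_iff inj_swap)

lemma validD:
  assumes "valid u"
  shows "u \<noteq> []" "distinct_adj u" "hd u = Alpha" "last u = Beta"
    "u ! 0 = Alpha" "u ! (length u - 1) = Beta" "0 < length u"
  using assms by (auto simp: valid_def hd_conv_nth last_conv_nth)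

text \<open>The Schreier graph of an action of three involutions, one for each colour, on \<open>{0..length u}\<close>.\<close>

definition edge :: "colour list \<Rightarrow> nat \<Rightarrow> colour \<Rightarrow> nat \<Rightarrow> bool" where
  "edge u s c t \<longleftrightarrow> (t = Suc s \<and> s < length u \<and> u ! s = c) \<or> (s = Suc t \<and> t < length u \<and> u ! t = c) \<or>
     (s = t \<and> (s = 0 \<and> c \<noteq> Alpha \<or> s = length u \<and> c \<noteq> Beta))"

fun path :: "colour list \<Rightarrow> nat \<Rightarrow> colour list \<Rightarrow> nat \<Rightarrow> bool" where
  "path u s [] t \<longleftrightarrow> s = t"
| "path u s (c # w) t \<longleftrightarrow> (\<exists>r. edge u s c r \<and> path u r w t)"

lemma edge_sym: "edge u s c t \<longleftrightarrow> edge u t c s"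
  by (auto simp: edge_def)

lemma path_append: "path u s (w @ w') t \<longleftrightarrow> (\<exists>r. path u s w r \<and> path u r w' t)"
  by (induction w arbitrary: s) auto

lemma path_rev: "path u s (rev w) t \<longleftrightarrow> path u t w s"
proof (induction w arbitrary: s t)
  case (Cons c w)
  then show ?case by (auto simp: path_append edge_sym)
qed auto

lemma edge_le: "edge u s c t \<Longrightarrow> s \<le> length u \<and> t \<le> length u"
  by (auto simp: edge_def)

lemma path_le: "path u s w t \<Longrightarrow> s \<le> length u \<Longrightarrow> t \<le> length u"
  by (induction w arbitrary: s) (auto dest: edge_le)

text \<open>The two edges at an inner state carry adjacent letters of \<open>u\<close>, which
  differ. At an end state the edge into the interior has exactly the colour that the loops
  omit.\<close>

lemma edge_det:
  assumes "valid u" "edge u s c t" "edge u s c t'"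
  shows "t = t'"
proof -
  note v = validD[OF assms(1)]
  have "u ! i \<noteq> u ! Suc i" if "Suc i < length u" for i
    using distinct_adj_nth[OF v(2) that] .
  moreover have "u ! i = Beta" if "Suc i = length u" for i
    using v(6) that[symmetric] by simp
  ultimately show ?thesis
    using assms(2,3) v(5,6,7) unfolding edge_def by (auto simp: less_Suc_eq)
qed

lemma path_det: "valid u \<Longrightarrow> path u s w t \<Longrightarrow> path u s w t' \<Longrightarrow> t = t'"
proof (induction w arbitrary: s)
  case (Cons c w)
  then show ?case using edge_det by (metis path.simps(2))
qed auto

lemma edge_inner:
  assumes "0 < s" "s < length u" "edge u s c\<^sub>0 t\<^sub>0" "edge u s c t" "edge u s c' t'" "c \<noteq> c\<^sub>0" "c' \<noteq> c\<^sub>0"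
  shows "c = c'"
  using assms unfolding edge_def by auto

lemma edge_dual:
  assumes "edge u s c t"
  shows "edge (dual u) (length u - s) (swap c) (length u - t)"
proof -
  have nth: "dual u ! i = swap (u ! (length u - Suc i))" if "i < length u" for i
    using that by (simp add: dual_def rev_nth)
  from assms consider "t = Suc s" "s < length u" "u ! s = c" | "s = Suc t" "t < length u" "u ! t = c"
    | "s = t" "s = 0" "c \<noteq> Alpha" | "s = t" "s = length u" "c \<noteq> Beta"
    by (auto simp: edge_def)
  then show ?thesis
    by cases (auto simp: edge_def nth Suc_diff_Suc)
qed

lemma path_dual: "path u s w t \<Longrightarrow> path (dual u) (length u - s) (map swap w) (length u - t)"
proof (induction w arbitrary: s)
  case (Cons c w)
  then show ?case using edge_dual by fastforce
qed auto

lemma path_dual_rev: "path u 0 w (length u) \<Longrightarrow> path (dual u) 0 (dual w) (length (dual u))"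
  using path_dual[of u 0 w "length u"] path_rev[of "dual u" 0 "map swap w" "length u"]
  by (simp add: dual_def rev_map)

text \<open>Turning back at an inner state would repeat the letter just read. A word without
  adjacent repetitions that sets out upwards therefore keeps climbing until it reaches the
  end.\<close>

lemma path_up_short:
  assumes "valid u" "distinct_adj w" "path u s w t" "length w \<le> length u - s" "w \<noteq> [] \<Longrightarrow> hd w = u ! s"
    "s \<le> length u"
  shows "w = take (length w) (drop s u) \<and> t = s + length w"
  using assms(2-)
proof (induction w arbitrary: s)
  case (Cons c w)
  have s: "s < length u" using Cons.prems(3) by auto
  from Cons.prems(2) obtain r where r: "edge u s c r" "path u r w t" by auto
  have "c = u ! s" using Cons.prems(4) by simp
  then have "edge u s c (Suc s)" using s by (simp add: edge_def)
  then have rs: "r = Suc s" using edge_det[OF assms(1)] r(1) by blast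
  have "hd w = u ! Suc s" if ne: "w \<noteq> []"
  proof -
    obtain d w' where w: "w = d # w'" using ne by (cases w) auto
    have "Suc s < length u" using Cons.prems(3) w by auto
    moreover have "d \<noteq> c" using Cons.prems(1) w by auto
    moreover obtain r' where "edge u (Suc s) d r'" using r(2) rs w by auto
    ultimately show ?thesis using \<open>c = u ! s\<close> w by (auto simp: edge_def)
  qed
  with Cons.IH[of "Suc s"] Cons.prems r rs s have "w = take (length w) (drop (Suc s) u) \<and> t = Suc s + length w"
    by (auto simp: distinct_adj_Cons)
  then show ?case using \<open>c = u ! s\<close> s by (auto simp: Cons_nth_drop_Suc[symmetric])
qed auto

lemma path_up:
  assumes "valid u" "distinct_adj w" "path u s w t" "length u - s \<le> length w" "hd w = u ! s" "s < length u"
  shows "\<exists>w'. w = drop s u @ w' \<and> path u (length u) w' t"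
proof -
  let ?n = "length u - s"
  have "path u s (take ?n w @ drop ?n w) t" using assms(3) by simp
  then obtain r where r: "path u s (take ?n w) r" "path u r (drop ?n w) t"
    using path_append by blast
  have "hd (take ?n w) = hd w" using assms(6) by (cases w) (auto simp: take_Cons split: nat.splits)
  moreover have "distinct_adj (take ?n w)"
    using assms(2) by (metis append_take_drop_id distinct_adj_appendD1)
  ultimately have "take ?n w = drop s u" "r = length u"
    using path_up_short[OF assms(1) _ r(1)] assms(4,5,6) by (auto simp: min_def)
  then show ?thesis using r(2) by (metis append_take_drop_id)
qed

lemma drop_dual: "s \<le> length u \<Longrightarrow> drop (length u - s) (dual u) = dual (take s u)"
  by (simp add: dual_def drop_map drop_rev)

text \<open>Duality turns the descent from \<open>s\<close> into an ascent from
  \<open>length u - s\<close>.\<close>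

lemma path_down:
  assumes "valid u" "distinct_adj w" "path u s w t" "s \<le> length w" "hd w = u ! (s - 1)" "0 < s" "s \<le> length u"
  shows "\<exists>w'. w = rev (take s u) @ w' \<and> path u 0 w' t"
proof -
  have w: "w \<noteq> []" using assms(4,6) by auto
  have "hd (map swap w) = dual u ! (length u - s)"
    using assms(5,6,7) w by (simp add: hd_map dual_def rev_nth)
  moreover have "valid (dual u)" "distinct_adj (map swap w)" "length (dual u) - (length u - s) \<le> length (map swap w)"
    "length u - s < length (dual u)"
    using assms by (auto simp: distinct_adj_map_iff inj_swap)
  ultimately obtain w' where w': "map swap w = drop (length u - s) (dual u) @ w'"
    "path (dual u) (length u) w' (length u - t)"
    using path_up[OF _ _ path_dual[OF assms(3)]] by (metis length_dual)
  have "w = map swap (map swap w)" by (simp add: comp_def)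
  also have "\<dots> = rev (take s u) @ map swap w'"
    unfolding w'(1) using assms(7) by (simp add: drop_dual) (simp add: dual_def comp_def)
  finally have "w = rev (take s u) @ map swap w'" .
  moreover have "path u 0 (map swap w') t"
    using path_dual[OF w'(2)] path_le[OF assms(3,7)] by simp
  ultimately show ?thesis by blast
qed

lemma path_down_short:
  assumes "valid u" "distinct_adj w" "path u s w t" "length w \<le> s" "w \<noteq> [] \<Longrightarrow> hd w = u ! (s - 1)" "s \<le> length u"
  shows "w = take (length w) (rev (take s u)) \<and> t = s - length w"
proof -
  have "w \<noteq> [] \<Longrightarrow> hd (map swap w) = dual u ! (length u - s)"
    using assms(4-6) by (cases w) (auto simp: dual_def rev_nth)
  then have *: "map swap w = take (length w) (drop (length u - s) (dual u))" "length u - t = length u - s + length w"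
    using path_up_short[of "dual u" "map swap w" "length u - s" "length u - t"] path_dual[OF assms(3)] assms
    by (auto simp: distinct_adj_map_iff inj_swap)
  have "w = map swap (map swap w)" by (simp add: comp_def)
  also have "\<dots> = take (length w) (rev (take s u))"
    unfolding *(1) using assms(6) by (simp add: drop_dual) (simp add: dual_def comp_def take_map)
  finally have "w = take (length w) (rev (take s u))" .
  with * path_le[OF assms(3,6)] assms(4,6) show ?thesis by auto
qed

lemma path_start_loops:
  assumes "valid u" "path u 0 (h @ w) t" "Alpha \<notin> set h"
  shows "path u 0 w t"
  using assms(2,3)
proof (induction h)
  case (Cons c h)
  then obtain r where r: "edge u 0 c r" "path u r (h @ w) t" by auto
  have "edge u 0 c 0" using Cons.prems by (auto simp: edge_def)
  then show ?case using Cons r edge_det[OF assms(1)] by fastforce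
qed auto

lemma path_end_loops:
  assumes "valid u" "path u (length u) (h @ w) t" "Beta \<notin> set h"
  shows "path u (length u) w t"
  using assms(2,3)
proof (induction h)
  case (Cons c h)
  then obtain r where r: "edge u (length u) c r" "path u r (h @ w) t" by auto
  have "edge u (length u) c (length u)" using Cons.prems by (auto simp: edge_def)
  then show ?case using Cons r edge_det[OF assms(1)] by fastforce
qed auto

section \<open>Combinatorics of words: runs, borders and palindromes\<close>

lemma append_eq_append_cases:
  assumes "u @ r = u' @ r'"
  shows "(\<exists>w. u = u' @ w \<and> w @ r = r') \<or> (\<exists>w. u @ w = u' \<and> r = w @ r')"
  using iffD1[OF append_eq_append_conv2 assms] by blast

text \<open>Cutting a word at the first occurrence of \<open>c\<close> is canonical. Runs and gaps
  are identified in this way throughout.\<close>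

lemma run_unique:
  "g @ y = g' @ y' \<Longrightarrow> c \<notin> set g \<Longrightarrow> c \<notin> set g' \<Longrightarrow> y \<noteq> [] \<Longrightarrow> y' \<noteq> [] \<Longrightarrow> hd y = c \<Longrightarrow> hd y' = c \<Longrightarrow>
    g = g' \<and> y = y'"
proof (induction g arbitrary: g')
  case Nil
  then show ?case by (cases g') auto
next
  case (Cons d g)
  then show ?case by (cases g') auto
qed

lemma run_unique_right:
  "x @ g = x' @ g' \<Longrightarrow> c \<notin> set g \<Longrightarrow> c \<notin> set g' \<Longrightarrow> x \<noteq> [] \<Longrightarrow> x' \<noteq> [] \<Longrightarrow> last x = c \<Longrightarrow> last x' = c \<Longrightarrow>
    g = g' \<and> x = x'"
  using run_unique[of "rev g" "rev x" "rev g'" "rev x'" c]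
  by (metis hd_rev rev_append rev_is_Nil_conv rev_rev_ident set_rev)

lemma prefix_past_run:
  assumes "z @ z' = g @ y" "z \<noteq> []" "last z = c" "c \<notin> set g"
  shows "\<exists>t. z = g @ t \<and> t \<noteq> [] \<and> y = t @ z' \<and> last t = c"
proof -
  have "last z \<notin> set g" using assms by simp
  have "z @ w \<noteq> g" for w
    using \<open>last z \<notin> set g\<close> last_in_set[OF assms(2)] by auto
  then obtain t where "z = g @ t" "y = t @ z'"
    using append_eq_append_cases[OF assms(1)] by auto
  moreover have "t \<noteq> []" using calculation \<open>last z \<notin> set g\<close> assms(2) by auto
  ultimately show ?thesis using assms(3) by auto
qed

lemma append_eq_prefixE:
  assumes "u @ r = u' @ r'" "length u \<le> length u'"
  shows "\<exists>w. u' = u @ w \<and> r = w @ r'"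
proof -
  from append_eq_append_cases[OF assms(1)] show ?thesis using assms(2) by fastforce
qed

text \<open>The part of a \<open>border_pair\<close> with nonempty border that concerns the run
  \<open>g\<close>. It is delimited by \<open>Beta\<close> on both sides, so that
  \<open>run_unique\<close> can compare two such runs.\<close>

definition rborder :: "colour list \<Rightarrow> colour list \<Rightarrow> colour list \<Rightarrow> colour list \<Rightarrow> bool" where
  "rborder a x g y \<longleftrightarrow> a = x @ g @ y \<and> (\<exists>z. a = z @ x) \<and> x \<noteq> [] \<and> last x = Beta \<and>
     y = rev y \<and> y \<noteq> [] \<and> hd y = Beta \<and> Beta \<notin> set g \<and> g \<noteq> []"

lemma suffix_cases:
  assumes "z @ x = z' @ y"
  obtains (le) w where "y = w @ x" "z = z' @ w" | (ge) w where "x = w @ y" "z' = z @ w" "w \<noteq> []"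
proof -
  from append_eq_append_cases[OF assms] show thesis using le ge by (metis append_Nil append_Nil2)
qed

text \<open>Let \<open>x\<^sub>1\<close> be the shorter border. Reflecting the palindromes and
  comparing suffixes of \<open>a\<close> either superimposes the two runs, or shows that both
  factorizations restrict to the shorter word \<open>x\<^sub>2\<close>, where induction
  applies.\<close>

lemma rborder_run_unique_aux:
  assumes "rborder a x\<^sub>1 g\<^sub>1 y\<^sub>1" "rborder a x\<^sub>2 g\<^sub>2 y\<^sub>2" "length x\<^sub>1 \<le> length x\<^sub>2"
  shows "g\<^sub>1 = g\<^sub>2 \<or> g\<^sub>1 = rev g\<^sub>2"
  using assms
proof (induction "length a" arbitrary: a x\<^sub>1 g\<^sub>1 y\<^sub>1 x\<^sub>2 g\<^sub>2 y\<^sub>2 rule: less_induct)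
  case less
  obtain z\<^sub>1 where a1: "a = x\<^sub>1 @ g\<^sub>1 @ y\<^sub>1" "a = z\<^sub>1 @ x\<^sub>1" "x\<^sub>1 \<noteq> []" "last x\<^sub>1 = Beta" "rev y\<^sub>1 = y\<^sub>1" "y\<^sub>1 \<noteq> []"
    "hd y\<^sub>1 = Beta" "Beta \<notin> set g\<^sub>1" "g\<^sub>1 \<noteq> []" using less.prems(1) unfolding rborder_def by auto
  obtain z\<^sub>2 where a2: "a = x\<^sub>2 @ g\<^sub>2 @ y\<^sub>2" "a = z\<^sub>2 @ x\<^sub>2" "x\<^sub>2 \<noteq> []" "last x\<^sub>2 = Beta" "rev y\<^sub>2 = y\<^sub>2" "y\<^sub>2 \<noteq> []"
    "hd y\<^sub>2 = Beta" "Beta \<notin> set g\<^sub>2" "g\<^sub>2 \<noteq> []" using less.prems(2) unfolding rborder_def by auto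
  have ly2: "last y\<^sub>2 = Beta" using a2 by (metis last_rev)
  obtain w where w: "x\<^sub>2 = x\<^sub>1 @ w" "g\<^sub>1 @ y\<^sub>1 = w @ g\<^sub>2 @ y\<^sub>2"
    using append_eq_prefixE[of x\<^sub>1 "g\<^sub>1 @ y\<^sub>1" x\<^sub>2 "g\<^sub>2 @ y\<^sub>2"] a1(1) a2(1) less.prems(3) by metis
  show ?case
  proof (cases "w = []")
    case True
    then show ?thesis using w run_unique[of g\<^sub>1 y\<^sub>1 g\<^sub>2 y\<^sub>2 Beta] a1 a2 by auto
  next
    case False
    have "last w = Beta" using a2(4) w(1) False by simp
    then obtain t where t: "w = g\<^sub>1 @ t" "t \<noteq> []" "y\<^sub>1 = t @ g\<^sub>2 @ y\<^sub>2" "last t = Beta"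
      using prefix_past_run[OF w(2)[symmetric] False _ a1(8)] by blast
    have x2: "x\<^sub>2 = x\<^sub>1 @ g\<^sub>1 @ t" using w t by simp
    \<comment> \<open>The palindrome \<open>y\<^sub>1\<close> read in both directions; the cases
      compare the lengths of \<open>t\<close> and \<open>y\<^sub>2\<close>.\<close>
    have pal: "t @ g\<^sub>2 @ y\<^sub>2 = y\<^sub>2 @ rev g\<^sub>2 @ rev t"
      using arg_cong[OF t(3), of rev] a1(5) t(3) a2(5) by simp
    consider (lt) z where "y\<^sub>2 = t @ z" "z \<noteq> []" "g\<^sub>2 @ y\<^sub>2 = z @ rev g\<^sub>2 @ rev t" | (eq) "t = y\<^sub>2"
      | (gt) z where "t = y\<^sub>2 @ z" "z \<noteq> []" "rev g\<^sub>2 @ rev t = z @ g\<^sub>2 @ y\<^sub>2"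
    proof -
      from pal have "(\<exists>z. t = y\<^sub>2 @ z \<and> z @ g\<^sub>2 @ y\<^sub>2 = rev g\<^sub>2 @ rev t) \<or> (\<exists>z. t @ z = y\<^sub>2 \<and> g\<^sub>2 @ y\<^sub>2 = z @ rev g\<^sub>2 @ rev t)"
        by (rule append_eq_append_cases)
      then show thesis using lt eq gt by (metis append_Nil2)
    qed
    then show ?thesis
    proof cases
      case lt
      have "last z = Beta" using ly2 lt by simp
      then obtain z' where z': "z = g\<^sub>2 @ z'" "z' \<noteq> []" "y\<^sub>2 = z' @ rev g\<^sub>2 @ rev t"
        using prefix_past_run[OF lt(3)[symmetric] lt(2) _ a2(8)] by metis
      have y2: "y\<^sub>2 = t @ g\<^sub>2 @ z'" using lt z' by simp
      have hz': "hd z' = Beta" using z' a2(7) by (metis hd_append2)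
      \<comment> \<open>Both \<open>x\<^sub>2 = x\<^sub>1 g\<^sub>1 t\<close> and
        \<open>y\<^sub>2\<close> are suffixes of \<open>a\<close>, so \<open>y\<^sub>2\<close> ends
        in \<open>t\<close> with \<open>g\<^sub>1\<close> before it. After reversal,
        \<open>rev g\<^sub>1\<close> meets the \<open>g\<^sub>2\<close> that follows the initial
        \<open>t\<close>.\<close>
      have "z\<^sub>2 @ x\<^sub>2 = (x\<^sub>2 @ g\<^sub>2) @ y\<^sub>2" using a2 by simp
      then obtain q where q: "rev y\<^sub>2 = rev t @ rev g\<^sub>1 @ q" "q \<noteq> []" "hd q = Beta"
      proof (cases rule: suffix_cases)
        case (le v)
        then have "rev y\<^sub>2 = rev t @ rev g\<^sub>1 @ rev x\<^sub>1 @ rev v" using x2 by simp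
        with that[of "rev x\<^sub>1 @ rev v"] show ?thesis using a1(3,4) by (simp add: hd_append hd_rev)
      next
        case (ge v)
        then have *: "v @ y\<^sub>2 = x\<^sub>1 @ g\<^sub>1 @ t" using x2 by simp
        have "v @ y\<^sub>2 = (x\<^sub>1 @ g\<^sub>1) @ t" using * by simp
        then obtain s where s: "s @ t = y\<^sub>2" and expanded: "v @ s = x\<^sub>1 @ g\<^sub>1" and sne: "s \<noteq> []"
        proof (cases rule: suffix_cases)
          case (le w)
          have "length t = length w + length y\<^sub>2" using arg_cong[OF le(1), of length] by (simp only: length_append)
          moreover have "length y\<^sub>2 = length t + length z" using arg_cong[OF lt(1), of length] by (simp only: length_append)
          ultimately show ?thesis using lt(2) by simp
        next
          case (ge w)
          then show ?thesis using that by auto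
        qed
        have "hd s = Beta" using s sne a2(7) by auto
        then have "rev s @ rev v = rev g\<^sub>1 @ rev x\<^sub>1" "last (rev s) = Beta" "rev s \<noteq> []"
          using expanded[THEN arg_cong, of rev] sne by (auto simp: last_rev)
        then obtain q where "rev s = rev g\<^sub>1 @ q" "q \<noteq> []" "rev x\<^sub>1 = q @ rev v"
          using prefix_past_run[of "rev s" "rev v" "rev g\<^sub>1" "rev x\<^sub>1" Beta] a1(8) by auto
        moreover have "hd q = Beta" using calculation a1(3,4) by (metis hd_append2 hd_rev)
        moreover have "rev y\<^sub>2 = rev t @ rev s" using s by (metis rev_append)
        ultimately show ?thesis using that[of q] by simp
      qed
      then have "t @ g\<^sub>2 @ z' = rev t @ rev g\<^sub>1 @ q" using y2 a2(5) by simp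
      then have "g\<^sub>2 @ z' = rev g\<^sub>1 @ q" by simp
      then have "g\<^sub>2 = rev g\<^sub>1" using run_unique[of g\<^sub>2 z' "rev g\<^sub>1" q Beta] hz' z' q a1(8) a2(8) by auto
      then show ?thesis by simp
    next
      case eq
      have "z\<^sub>2 @ x\<^sub>2 = x\<^sub>2 @ g\<^sub>2 @ y\<^sub>2" using a2(1,2) by metis
      then have "((z\<^sub>2 @ x\<^sub>1) @ g\<^sub>1) @ y\<^sub>2 = ((x\<^sub>1 @ g\<^sub>1 @ y\<^sub>2) @ g\<^sub>2) @ y\<^sub>2"
        unfolding x2 eq by simp
      then have "(z\<^sub>2 @ x\<^sub>1) @ g\<^sub>1 = (x\<^sub>1 @ g\<^sub>1 @ y\<^sub>2) @ g\<^sub>2" by (simp only: append_same_eq)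
      then have "g\<^sub>1 = g\<^sub>2 \<and> z\<^sub>2 @ x\<^sub>1 = x\<^sub>1 @ g\<^sub>1 @ y\<^sub>2"
        by (rule run_unique_right[OF _ a1(8) a2(8)]) (use a1(3,4) a2(6) ly2 in simp_all)
      then show ?thesis by simp
    next
      case gt
      have lz: "last z = Beta" using t(4) gt by simp
      obtain t\<^sub>2 where t2: "z = rev g\<^sub>2 @ t\<^sub>2" "t\<^sub>2 \<noteq> []" "rev t = t\<^sub>2 @ g\<^sub>2 @ y\<^sub>2" "last t\<^sub>2 = Beta"
        using prefix_past_run[OF gt(3)[symmetric] gt(2) lz] a2(8) by auto
      have tt: "t = y\<^sub>2 @ rev g\<^sub>2 @ t\<^sub>2" using gt t2 by simp
      have "a = (x\<^sub>1 @ g\<^sub>1 @ y\<^sub>2 @ rev g\<^sub>2) @ t\<^sub>2 @ g\<^sub>2 @ y\<^sub>2" using a1(1) t(3) tt by simp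
      moreover have "a = (z\<^sub>2 @ x\<^sub>1 @ g\<^sub>1) @ t" using a2(2) x2 by simp
      moreover have "length t = length (t\<^sub>2 @ g\<^sub>2 @ y\<^sub>2)" using tt by simp
      ultimately have trev: "t = t\<^sub>2 @ g\<^sub>2 @ y\<^sub>2" by (metis append_eq_append_conv)
      then have "rev t = t" using t2(3) by simp
      have ht: "hd t = Beta" using tt a2 by simp
      have "\<exists>z. x\<^sub>2 = z @ x\<^sub>1"
      proof -
        have "z\<^sub>1 @ x\<^sub>1 = z\<^sub>2 @ x\<^sub>2" using a1 a2 by simp
        then show ?thesis
        proof (cases rule: suffix_cases)
          case (ge w)
          then show ?thesis using less.prems(3) by auto
        qed auto
      qed
      \<comment> \<open>Now \<open>t\<close> is a palindrome and \<open>x\<^sub>1\<close> is a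
        border of \<open>x\<^sub>2\<close>, so both factorizations descend to
        \<open>x\<^sub>2\<close>.\<close>
      then have b1: "rborder x\<^sub>2 x\<^sub>1 g\<^sub>1 t"
        unfolding rborder_def using x2 a1 t(2) ht \<open>rev t = t\<close> by auto
      let ?x3 = "x\<^sub>1 @ g\<^sub>1 @ t\<^sub>2"
      have x23: "x\<^sub>2 = ?x3 @ g\<^sub>2 @ y\<^sub>2" using x2 trev by simp
      have "z\<^sub>2 @ ?x3 @ g\<^sub>2 @ y\<^sub>2 = x\<^sub>2 @ g\<^sub>2 @ y\<^sub>2" using a2(1,2) x23 by simp
      then have "x\<^sub>2 = z\<^sub>2 @ ?x3" by simp
      then have b2: "rborder x\<^sub>2 ?x3 g\<^sub>2 y\<^sub>2"
        unfolding rborder_def using x23 a2 t2 a1 by auto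
      have "length x\<^sub>2 < length a" using a2 by simp
      from less.hyps[OF this b1 b2] show ?thesis by simp
    qed
  qed
qed

lemma rborder_run_unique:
  assumes "rborder a x\<^sub>1 g\<^sub>1 y\<^sub>1" "rborder a x\<^sub>2 g\<^sub>2 y\<^sub>2"
  shows "g\<^sub>1 = g\<^sub>2 \<or> g\<^sub>1 = rev g\<^sub>2"
proof (cases "length x\<^sub>1 \<le> length x\<^sub>2")
  case False
  then show ?thesis using rborder_run_unique_aux[OF assms(2,1)] by auto
qed (use rborder_run_unique_aux[OF assms] in auto)

lemma third_colour:
  fixes c :: colour
  shows "d \<noteq> c \<Longrightarrow> e \<noteq> c \<Longrightarrow> f \<noteq> c \<Longrightarrow> d \<noteq> e \<Longrightarrow> d \<noteq> f \<Longrightarrow> e = f"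
  by (cases c; cases d; cases e; cases f; simp)

text \<open>Avoiding one of three colours leaves two, which must alternate.\<close>

lemma alternating_unique:
  fixes u w :: "colour list"
  assumes "length u = length w" "distinct_adj u" "distinct_adj w" "c \<notin> set u" "c \<notin> set w"
    "u \<noteq> [] \<Longrightarrow> hd u = hd w"
  shows "u = w"
  using assms
proof (induction u w rule: list_induct2)
  case (Cons d u e w)
  have "hd u = hd w" if "u \<noteq> []"
  proof -
    have w: "w \<noteq> []" using that Cons.hyps by auto
    have *: "d \<noteq> c" "hd u \<noteq> c" "hd w \<noteq> c" "d \<noteq> hd u" "d \<noteq> hd w"
      using Cons.prems that w by (auto simp: distinct_adj_Cons)
    show ?thesis by (rule third_colour[OF *])
  qed
  then show ?case using Cons by (auto simp: distinct_adj_Cons)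
qed auto

lemma alternating_palindrome:
  fixes w :: "colour list"
  assumes "distinct_adj w" "c \<notin> set w" "w \<noteq> [] \<Longrightarrow> hd w = last w"
  shows "rev w = w"
  by (rule alternating_unique[where c = c]) (use assms in \<open>auto simp: hd_rev\<close>)

text \<open>This is the case of an empty border. The palindromes \<open>y\<close> and
  \<open>p\<close> allow factors \<open>m n\<close> to be peeled off the end of \<open>a\<close>, by
  a descent on the length as in Euclid's algorithm. The condition \<open>last m = Alpha\<close>
  makes \<open>m\<close> a palindrome and keeps \<open>n\<close>, which avoids \<open>Alpha\<close>,
  from overlapping it.\<close>

lemma torus:
  assumes "distinct_adj a" "a = m @ y" "a = p @ n" "rev y = y" "rev p = p" "y \<noteq> []" "hd y = Beta" "p \<noteq> []"
    "Beta \<notin> set m" "Alpha \<notin> set n" "m \<noteq> []" "n \<noteq> []" "hd m = Alpha" "last m = Alpha"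
  shows "\<exists>k. a = concat (replicate (Suc k) (m @ n)) \<and> rev n = n \<and> hd n = Beta"
  using assms
proof (induction "length a" arbitrary: a y p rule: less_induct)
  case less
  note a1 = less.prems
  have pm: "rev m = m" using alternating_palindrome[of m Beta] a1 by auto
  have lp: "last p = Alpha" using a1 by (metis hd_append2 last_rev)
  have la: "last y = Beta" using a1 by (metis last_rev)
  have nB: "Gamma \<in> set n" if "hd n \<noteq> Beta"
    using that a1 by (metis colour.exhaust list.set_sel(1))
  show ?case
  proof (cases "length p \<le> length m")
    case True
    then obtain w where w: "m = p @ w" "n = w @ y"
      using append_eq_prefixE[of p n m y] a1 by auto
    have "w = []"
    proof (rule ccontr)
      assume "w \<noteq> []"
      then have "last w = Alpha" using w a1 by simp
      then show False using w a1 \<open>w \<noteq> []\<close> by (metis UnCI last_in_set set_append)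
    qed
    then have "n = y" "p = m" using w by auto
    then have "a = concat (replicate (Suc 0) (m @ n)) \<and> rev n = n \<and> hd n = Beta" using a1 by simp
    then show ?thesis by blast
  next
    case False
    then obtain p' where p': "p = m @ p'" "y = p' @ n"
      using append_eq_prefixE[of m y p n] a1 by auto
    have p'ne: "p' \<noteq> []" using False p' by auto
    have hp': "hd p' = Beta" using p' a1(7) p'ne by simp
    have "m @ p' = rev p' @ m" using p' a1 pm by (metis rev_append)
    moreover have "length m < length p'"
    proof (rule ccontr)
      assume "\<not> ?thesis"
      then obtain w where "m = rev p' @ w"
        using append_eq_prefixE[of "rev p'" m m p'] calculation by auto
      then show False using hp' p'ne a1(9) by (metis UnCI list.set_sel(1) set_append set_rev)
    qed
    ultimately obtain q where q: "rev p' = m @ q" "p' = q @ m"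
      using append_eq_prefixE[of m p' "rev p'" m] by (metis length_rev less_imp_le)
    have qne: "q \<noteq> []" using q \<open>length m < length p'\<close> by auto
    have hq: "hd q = Beta" using hp' q qne by simp
    have pq: "rev q = q" using q pm by (metis append_eq_append_conv length_rev rev_append rev_rev_ident)
    have y: "y = q @ m @ n" using p' q by simp
    have y': "y = rev n @ m @ q" using y a1(4) pm pq by (metis append_assoc rev_append)
    have "\<not> length q < length n"
    proof
      assume l: "length q < length n"
      then obtain w where w: "rev n = q @ w" "m @ n = w @ m @ q"
        using append_eq_prefixE[of q "m @ n" "rev n" "m @ q"] y y' by auto
      then have "w \<noteq> []" using l by (metis append_Nil2 length_rev less_irrefl)
      then have "hd w = Alpha" using w(2) a1 by (metis hd_append2)
      then show False using w(1) \<open>w \<noteq> []\<close> a1(10) by (metis UnCI list.set_sel(1) set_append set_rev)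
    qed
    then obtain q' where q': "q = rev n @ q'" "m @ q = q' @ m @ n"
      using append_eq_prefixE[of "rev n" "m @ q" q "m @ n"] y y' by auto
    show ?thesis
    proof (cases "q' = []")
      case True
      then have "q = n" using q' by simp
      then have "a = concat (replicate (Suc (Suc 0)) (m @ n)) \<and> rev n = n \<and> hd n = Beta"
        using a1 y hq pq by auto
      then show ?thesis by blast
    next
      case False
      define q'' where "q'' = rev q'"
      have qq: "q = q'' @ n" using q' pq q''_def by (metis rev_append rev_rev_ident)
      \<comment> \<open>The shorter word \<open>m q\<close> inherits the hypotheses, with
        palindromic prefix \<open>m q''\<close> and palindromic suffix \<open>q\<close>.\<close>
      have "m @ q'' = q' @ m" using q'(2) qq by simp
      then have h1: "rev (m @ q'') = m @ q''" using pm q''_def by simp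
      have h2: "m @ q = (m @ q'') @ n" using qq by simp
      have h3: "length (m @ q) < length a" using a1(2) y a1(11) by simp
      have h4: "distinct_adj (m @ q)"
        using a1(1,2) y by (metis append_assoc distinct_adj_appendD1)
      have "m @ q'' \<noteq> []" using a1(11) by simp
      from less.hyps[OF h3 h4 refl h2 pq h1 qne hq this a1(9-14)] obtain k where "m @ q = concat (replicate (Suc k) (m @ n))" "rev n = n" "hd n = Beta"
        by blast
      moreover have "a = (m @ q) @ (m @ n)" using a1(2) y by simp
      moreover have "concat (replicate (Suc k) (m @ n)) @ (m @ n) = concat (replicate (Suc (Suc k)) (m @ n))"
        by (metis append_Nil2 concat.simps concat_append replicate_Suc replicate_append_same)
      ultimately show ?thesis by metis
    qed
  qed
qed

text \<open>
  This is what two walks in the graph of \<open>a\<close> leave behind that start at the two ends of the segment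
  \<open>m\<close> and read a common word longer than \<open>a\<close>.
\<close>

definition border_pair :: "colour list \<Rightarrow> colour list \<Rightarrow> colour list \<Rightarrow> colour list \<Rightarrow> colour list \<Rightarrow> colour list \<Rightarrow> bool" where
  "border_pair a x m y n p \<longleftrightarrow> a = x @ m @ y \<and> a = p @ n @ x \<and> rev y = y \<and> rev p = p \<and> y \<noteq> [] \<and> hd y = Beta \<and>
     p \<noteq> [] \<and> Beta \<notin> set m \<and> Alpha \<notin> set n \<and> m \<noteq> [] \<and> n \<noteq> [] \<and> (x \<noteq> [] \<longrightarrow> last x = Beta)"

lemma border_pair_last:
  assumes "valid a" "border_pair a x m y n p"
  shows "hd p = Alpha" "last p = Alpha" "last y = Beta" "x \<noteq> [] \<Longrightarrow> hd x = Alpha"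
proof -
  have *: "a = x @ m @ y" "a = p @ n @ x" "rev y = y" "rev p = p" "p \<noteq> []" "hd y = Beta"
    using assms(2) unfolding border_pair_def by auto
  show 1: "hd p = Alpha" using *(2,5) validD(3)[OF assms(1)] by simp
  show "last p = Alpha" using 1 *(4) by (metis last_rev)
  show "last y = Beta" using *(3,6) by (metis last_rev)
  show "hd x = Alpha" if "x \<noteq> []" using that *(1) validD(3)[OF assms(1)] by simp
qed

text \<open>Duality exchanges the two ends, so every fact about \<open>m\<close> and
  \<open>y\<close> has a counterpart for \<open>n\<close> and \<open>p\<close>.\<close>

lemma border_pair_dual:
  assumes "valid a" "border_pair a x m y n p"
  shows "border_pair (dual a) (dual x) (dual n) (dual p) (dual m) (dual y)"
proof -
  note l = border_pair_last[OF assms]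
  have b: "a = x @ m @ y" "a = p @ n @ x" "rev y = y" "rev p = p" "y \<noteq> []" "p \<noteq> []" "Beta \<notin> set m" "Alpha \<notin> set n"
    "m \<noteq> []" "n \<noteq> []"
    using assms(2) unfolding border_pair_def by auto
  have "hd (dual p) = swap (last p)" using b(6) by (simp only: dual_def hd_map hd_rev rev_is_Nil_conv simp_thms)
  then have "hd (dual p) = Beta" using l(2) by simp
  moreover have "x \<noteq> [] \<Longrightarrow> last (dual x) = Beta" using l(4) by (simp add: dual_def last_map last_rev)
  moreover have "dual a = dual x @ dual n @ dual p" using b(2) by simp
  moreover have "dual a = dual y @ dual m @ dual x" using b(1) by simp
  moreover have "rev (dual p) = dual p" "rev (dual y) = dual y" using b(3,4) by (simp_all flip: dual_rev)
  ultimately show ?thesis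
    using b(5-) by (simp add: border_pair_def)
qed

text \<open>A suffix of a power of \<open>m n\<close> that begins like \<open>m n\<close> begins at
  a factor boundary: it starts with \<open>Alpha\<close>, hence inside some \<open>m\<close>, and
  the position of its first \<open>Beta\<close> shows that the whole \<open>m\<close> is
  there.\<close>

lemma torus_border:
  assumes "z @ x = concat (replicate k (m @ n))" "x @ r = m @ n @ v" "x \<noteq> []" "last x = Beta" "hd x = Alpha"
    "Beta \<notin> set m" "Alpha \<notin> set n" "hd n = Beta" "m \<noteq> []" "n \<noteq> []"
  shows "\<exists>j. x = concat (replicate j (m @ n))"
  using assms
proof (induction k arbitrary: z)
  case (Suc k)
  have "z @ x = (m @ n) @ concat (replicate k (m @ n))" using Suc.prems(1) by simp
  then show ?case
  proof (cases rule: suffix_cases)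
    case (le w)
    then show ?thesis using Suc.IH[of w] Suc.prems by simp
  next
    case (ge w)
    have hw: "hd w = Alpha" using ge Suc.prems(5) by simp
    have "n \<noteq> u @ w" for u using hw ge(3) Suc.prems(7) by (metis UnCI list.set_sel(1) set_append)
    then obtain w1 where w1: "z @ w1 = m" "w = w1 @ n"
      using append_eq_append_cases[OF ge(2)] by metis
    have "w1 \<noteq> []" using w1 hw Suc.prems by auto
    have "w1 @ (n @ concat (replicate k (m @ n)) @ r) = m @ (n @ v)"
      using Suc.prems(2) ge(1) w1(2) by simp
    moreover have "Beta \<notin> set w1" using w1(1) Suc.prems(6) by auto
    ultimately have "w1 = m"
      using run_unique[of w1 "n @ concat (replicate k (m @ n)) @ r" m "n @ v" Beta] Suc.prems by auto
    then have "x = concat (replicate (Suc k) (m @ n))" using ge(1) w1(2) by simp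
    then show ?thesis by blast
  qed
qed simp

lemma concat_replicate_add:
  "concat (replicate (i + j) w) = concat (replicate i w) @ concat (replicate j w)"
  by (simp add: replicate_add)

text \<open>An empty border makes \<open>a\<close> a power of \<open>m n\<close>. Every other border
  is then a power too, and the runs next to it are again \<open>m\<close> and
  \<open>n\<close>.\<close>

lemma torus_border_pair:
  assumes "valid a" "border_pair a [] m y n p" "last m = Alpha" "border_pair a x' m' y' n' p'"
  shows "m' = m \<and> n' = n \<and> rev m = m \<and> rev n = n \<and> hd n = Beta"
proof -
  have b: "a = m @ y" "a = p @ n" "rev y = y" "rev p = p" "y \<noteq> []" "hd y = Beta" "p \<noteq> []"
    "Beta \<notin> set m" "Alpha \<notin> set n" "m \<noteq> []" "n \<noteq> []"
    using assms(2) unfolding border_pair_def by auto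
  have b': "a = x' @ m' @ y'" "a = p' @ n' @ x'" "y' \<noteq> []" "hd y' = Beta" "p' \<noteq> []"
    "Beta \<notin> set m'" "Alpha \<notin> set n'" "m' \<noteq> []" "n' \<noteq> []" "x' \<noteq> [] \<Longrightarrow> last x' = Beta"
    using assms(4) unfolding border_pair_def by auto
  note v = validD[OF assms(1)]
  have hm: "hd m = Alpha" using b v(3) by (metis hd_append2)
  obtain k where k: "a = concat (replicate (Suc k) (m @ n))" "rev n = n" "hd n = Beta"
    using torus[OF v(2) b hm assms(3)] by blast
  have pm: "rev m = m" using alternating_palindrome[of m Beta] b v(2) hm assms(3) by auto
  have ln: "last n = Beta" using k b by (metis last_rev)
  have "m' = m \<and> n' = n"
  proof (cases "x' = []")
    case True
    then have "m' @ y' = m @ y" "p' @ n' = p @ n" using b b' by auto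
    then show ?thesis
      using run_unique[of m' y' m y Beta] run_unique_right[of p' n' p n Alpha] b b' border_pair_last[OF assms(1,2)] border_pair_last[OF assms(1,4)]
      by auto
  next
    case False
    have "(p' @ n') @ x' = concat (replicate (Suc k) (m @ n))" using b' k by simp
    moreover have "x' @ m' @ y' = m @ n @ concat (replicate k (m @ n))" using b' k by simp
    ultimately obtain j where j: "x' = concat (replicate j (m @ n))"
      using torus_border[of "p' @ n'" x' "Suc k" m n] False b' border_pair_last(4)[OF assms(1,4) False] b k(3) by metis
    have "length x' < length a" using b' by (metis False add_gr_0 length_append length_greater_0_conv less_add_same_cancel1)
    then have "j * length (m @ n) < Suc k * length (m @ n)"
      unfolding j k(1) by (simp add: length_concat sum_list_replicate)
    then have "j < Suc k" using mult_less_cancel2 by blast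
    then obtain i where i: "Suc k = j + Suc i" by (metis add_Suc_right less_iff_Suc_add)
    have "concat (replicate (j + Suc i) (m @ n)) = x' @ m @ n @ concat (replicate i (m @ n))"
      unfolding concat_replicate_add by (simp add: j)
    then have "x' @ m' @ y' = x' @ m @ n @ concat (replicate i (m @ n))"
      using b'(1) k(1) i by metis
    then have "m' @ y' = m @ (n @ concat (replicate i (m @ n)))" by simp
    then have 1: "m' = m" using run_unique[of m' y' m _ Beta] b b' k by auto
    have "Suc k = i + Suc j" using i by simp
    moreover have "concat (replicate (Suc i + j) (m @ n)) = (concat (replicate i (m @ n)) @ m @ n) @ x'"
      unfolding concat_replicate_add j(1)[symmetric] by (simp add: concat_replicate_trivial flip: replicate_append_same)
    ultimately have "(p' @ n') @ x' = (concat (replicate i (m @ n)) @ m @ n) @ x'"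
      using b'(2) k(1) by (metis add_Suc_right add_Suc append_assoc)
    then have "p' @ n' = (concat (replicate i (m @ n)) @ m) @ n" by simp
    then have "n' = n" using run_unique_right[of p' n' _ n Alpha] b b' border_pair_last(2)[OF assms(1,4)] assms(3) by auto
    with 1 show ?thesis by simp
  qed
  then show ?thesis using pm k by auto
qed

text \<open>Each factorization knows only one palindrome, the first one \<open>n\<^sub>1\<close> and
  the second one \<open>m\<^sub>2\<close>. Uniqueness of the run up to reversal, in \<open>a\<close>
  and in its dual, lets each supply what the other lacks. If one border is empty,
  \<open>torus\<close> gives everything at once.\<close>

lemma border_pair_run_unique:
  assumes "valid a" "last (takeWhile (\<lambda>c. c \<noteq> Beta) a) = Alpha" "border_pair a x\<^sub>1 m\<^sub>1 y\<^sub>1 n\<^sub>1 p\<^sub>1" "border_pair a x\<^sub>2 m\<^sub>2 y\<^sub>2 n\<^sub>2 p\<^sub>2"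
    "x\<^sub>1 \<noteq> [] \<Longrightarrow> rev n\<^sub>1 = n\<^sub>1" "x\<^sub>2 \<noteq> [] \<Longrightarrow> rev m\<^sub>2 = m\<^sub>2"
  shows "m\<^sub>1 = m\<^sub>2 \<and> n\<^sub>1 = n\<^sub>2 \<and> rev m\<^sub>1 = m\<^sub>1 \<and> rev n\<^sub>1 = n\<^sub>1"
proof -
  have lm: "last m = Alpha" if "border_pair a [] m y n p" for m y n p
  proof -
    have "takeWhile (\<lambda>c. c \<noteq> Beta) a = m"
      using that unfolding border_pair_def by (cases y) (auto simp: takeWhile_append2 takeWhile_tail)
    then show ?thesis using assms(2) by simp
  qed
  consider "x\<^sub>1 = []" | "x\<^sub>2 = []" | "x\<^sub>1 \<noteq> []" "x\<^sub>2 \<noteq> []" by blast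
  then show ?thesis
  proof cases
    case 1
    then show ?thesis using torus_border_pair[OF assms(1) _ lm assms(4)] assms(3) by metis
  next
    case 2
    then show ?thesis using torus_border_pair[OF assms(1) _ lm assms(3)] assms(4) by metis
  next
    case 3
    have r: "rborder a x m y" if "border_pair a x m y n p" "x \<noteq> []" for a x m y n p
      using that unfolding border_pair_def rborder_def by (metis append_assoc)
    have "m\<^sub>1 = m\<^sub>2 \<or> m\<^sub>1 = rev m\<^sub>2" by (rule rborder_run_unique[OF r[OF assms(3) 3(1)] r[OF assms(4) 3(2)]])
    moreover have "dual n\<^sub>1 = dual n\<^sub>2 \<or> dual n\<^sub>1 = rev (dual n\<^sub>2)"
      by (rule rborder_run_unique[OF r[OF border_pair_dual[OF assms(1,3)]] r[OF border_pair_dual[OF assms(1,4)]]]) (use 3 in auto)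
    ultimately show ?thesis using assms(5,6) 3 by (auto simp flip: dual_rev)
  qed
qed

section \<open>What a gap of the longer word marks inside the shorter word\<close>

lemma nth_last_append: "u \<noteq> [] \<Longrightarrow> (u @ w) ! (length u - 1) = last u"
  by (simp add: nth_append last_conv_nth)

lemma nth_hd_append: "w \<noteq> [] \<Longrightarrow> (u @ w) ! length u = hd w"
  by (simp add: nth_append hd_conv_nth)

text \<open>The upper reader of the reversed \<open>b\<close> climbs through \<open>y\<close>; as
  the reversed \<open>b\<close> also starts with the reversed \<open>y\<close>, this is a
  palindrome. The lower reader descends through \<open>x\<close>, loops at 0, and then climbs. What
  it reads while climbing is the reversal of a prefix of \<open>a\<close> as well as that prefix
  itself, namely the palindrome \<open>p\<close>.\<close>

lemma mark:
  assumes a: "valid a" and b: "distinct_adj b" "hd b = Alpha" "b = b\<^sub>0 @ a" "b\<^sub>0 \<noteq> []"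
    and split: "a = x @ g @ y" "Beta \<notin> set g" "g \<noteq> []" "y \<noteq> []"
    and paths: "path a (length x) (rev b) z\<^sub>1" "path a (length (x @ g)) (rev b) z\<^sub>2"
  shows "\<exists>p n. border_pair a x g y n p \<and> (x \<noteq> [] \<longrightarrow> rev n = n)"
proof -
  note v = validD[OF a]
  have rb: "rev b = rev a @ rev b\<^sub>0" using b by simp
  have db: "distinct_adj (rev b)" using b(1) by (simp only: distinct_adj_rev)
  have hb: "hd (rev b) = Beta" using rb v by (simp add: hd_rev)
  have rbc: "rev b = Beta # tl (rev b)" using hb rb v(1) by (metis Nil_is_append_conv hd_Cons_tl rev_is_Nil_conv)
  have lb: "length a < length b" using b by simp
  have lgne: "last g \<noteq> Beta" "hd g \<noteq> Beta"
    using split(2) last_in_set[OF split(3)] list.set_sel(1)[OF split(3)] by auto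
  have xg: "length (x @ g) < length a" "0 < length (x @ g)" using split by auto
  have "\<exists>t. edge a (length (x @ g)) Beta t" using paths(2) rbc by (metis path.simps(2))
  moreover have "a ! (length (x @ g) - 1) = last g"
    using nth_last_append[of "x @ g" y] split(1,3) by simp
  moreover have y0: "a ! length (x @ g) = hd y"
    using nth_hd_append[of y "x @ g"] split(1,4) by simp
  ultimately have hy: "hd y = Beta" using xg lgne by (auto simp: edge_def)
  have "length a - length (x @ g) \<le> length (rev b)" "hd (rev b) = a ! length (x @ g)"
    using lb hb hy y0 by simp_all
  then obtain R where R: "rev b = drop (length (x @ g)) a @ R" "path a (length a) R z\<^sub>2"
    using path_up[OF a db paths(2) _ _ xg(1)] by blast
  have dy: "drop (length (x @ g)) a = y" using split by simp
  have "rev y @ rev g @ rev x @ rev b\<^sub>0 = y @ R" using R rb dy split(1) by simp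
  then have py: "rev y = y" and R': "R = rev g @ rev x @ rev b\<^sub>0" by auto
  have lx: "last x = Beta" if "x \<noteq> []"
  proof -
    have "\<exists>t. edge a (length x) Beta t" using paths(1) rbc by (metis path.simps(2))
    moreover have "a ! length x = hd g" "a ! (length x - 1) = last x"
      using nth_hd_append[of "g @ y" x] nth_last_append[of x "g @ y"] split(1,3) that by simp_all
    moreover have "0 < length x" "length x < length a" using that xg by auto
    ultimately show ?thesis using lgne by (auto simp: edge_def)
  qed
  have "\<exists>L. rev b = rev x @ L \<and> path a 0 L z\<^sub>1"
  proof (cases "x = []")
    case False
    have "a ! (length x - 1) = Beta" using lx[OF False] nth_last_append[OF False, of "g @ y"] split(1) by simp
    then have "hd (rev b) = a ! (length x - 1)" using hb by simp
    moreover have "length x \<le> length (rev b)" "0 < length x" "length x \<le> length a" using lb xg False by simp_all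
    ultimately have "\<exists>w'. rev b = rev (take (length x) a) @ w' \<and> path a 0 w' z\<^sub>1"
      using path_down[OF a db paths(1)] by blast
    then show ?thesis using split(1) by simp
  qed (use paths in auto)
  then obtain L where L: "rev b = rev x @ L" "path a 0 L z\<^sub>1" by blast
  have "rev a @ rev b\<^sub>0 = rev x @ L" using L rb by simp
  then obtain \<rho> where rho: "rev a = rev x @ \<rho>" "L = \<rho> @ rev b\<^sub>0"
    using append_eq_prefixE[of "rev x" L "rev a" "rev b\<^sub>0"] xg by auto
  have rne: "\<rho> \<noteq> []" using rho(1) xg by (metis append_Nil2 length_rev less_irrefl rev_rev_ident length_append add_lessD1)
  have lrho: "last \<rho> = Alpha" using rho(1) rne v(1,3) by (metis last_appendR last_rev)
  \<comment> \<open>\<open>h\<close> is what the lower reader reads on the loops at 0;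
    \<open>n\<close> will be its reversal.\<close>
  define h where "h = takeWhile (\<lambda>c. c \<noteq> Alpha) \<rho>"
  define \<rho>' where "\<rho>' = dropWhile (\<lambda>c. c \<noteq> Alpha) \<rho>"
  have hr: "\<rho> = h @ \<rho>'" by (simp add: h_def \<rho>'_def)
  have hA: "Alpha \<notin> set h" by (auto simp: h_def dest: set_takeWhileD)
  have r'ne: "\<rho>' \<noteq> []" using lrho last_in_set[OF rne] by (auto simp: \<rho>'_def)
  then have hr': "hd \<rho>' = Alpha" unfolding \<rho>'_def using hd_dropWhile by blast
  have hne: "h \<noteq> []"
  proof
    assume "h = []"
    then have ra': "rev a = rev x @ \<rho>'" using rho hr by simp
    show False
    proof (cases "x = []")
      case True
      then show False using ra' v(1,4) hr' by (metis append_Nil colour.distinct(1) hd_rev rev.simps(1))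
    next
      case False
      have "last (rev x) = Alpha" using v(3) split(1) False by (simp add: last_rev)
      moreover have "distinct_adj (rev x @ \<rho>')"
        using v(2) ra' by (metis distinct_adj_rev)
      ultimately show False using hr' r'ne False by (simp add: distinct_adj_append_iff)
    qed
  qed
  have p1: "path a 0 (\<rho>' @ rev b\<^sub>0) z\<^sub>1"
    using path_start_loops[OF a _ hA, of "\<rho>' @ rev b\<^sub>0"] L(2) rho(2) hr by simp
  have d1: "distinct_adj (\<rho>' @ rev b\<^sub>0)"
    using db L(1) rho(2) hr by (metis append_assoc distinct_adj_appendD2)
  have "length a = length x + (length h + length \<rho>')" using arg_cong[OF rho(1), of length] hr by simp
  then have len: "length \<rho>' < length a" using hne by simp
  obtain s where s: "path a 0 \<rho>' s" "path a s (rev b\<^sub>0) z\<^sub>1" using p1 path_append by blast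
  have "\<rho>' = take (length \<rho>') (drop 0 a) \<and> s = 0 + length \<rho>'"
    using path_up_short[OF a _ s(1)] d1 len hr' v by auto
  then have rt: "\<rho>' = take (length \<rho>') a" "s = length \<rho>'" by auto
  define p where "p = rev \<rho>'"
  define n where "n = rev h"
  have "a = rev (rev x @ h @ \<rho>')" using rho hr by (metis rev_rev_ident)
  then have apx: "a = p @ n @ x" by (simp add: p_def n_def)
  then have "take (length \<rho>') a = p" by (simp add: p_def)
  then have pp: "\<rho>' = p" using rt by simp
  then have "rev p = p" by (simp add: p_def)
  \<comment> \<open>Both readers go on to the reversed \<open>b\<^sub>0\<close>. The lower one,
    climbing after \<open>p\<close>, finds \<open>n\<close> there. The upper one has looped at the
    right end and descended through \<open>x\<close>, and finds \<open>h\<close>. It is the final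
    \<open>Beta\<close> of a nonempty \<open>x\<close> that turns the upper reader around.\<close>
  moreover have "rev n = n" if x: "x \<noteq> []"
  proof -
    have drp: "drop (length \<rho>') a = n @ x" using apx pp by simp
    have nl: "\<not> length b\<^sub>0 \<le> length n \<and> (\<exists>w. rev b\<^sub>0 = n @ w)"
    proof -
      have hdn: "hd (rev b\<^sub>0) = a ! s"
      proof -
        obtain c w where cw: "rev b\<^sub>0 = c # w" using b(4) by (metis neq_Nil_conv rev_is_Nil_conv)
        then obtain t where t: "edge a s c t" using s(2) by auto
        have "c \<noteq> last \<rho>'" using d1 cw r'ne by (auto simp: distinct_adj_append_iff)
        moreover have "last \<rho>' = a ! (s - 1)" using rt r'ne len by (metis One_nat_def diff_less last_conv_nth length_greater_0_conv less_one nth_take zero_less_one)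
        ultimately show ?thesis using t cw rt len r'ne by (auto simp: edge_def)
      qed
      have *: "rev b\<^sub>0 = take (length b\<^sub>0) (n @ x)" if "length b\<^sub>0 \<le> length a - s"
        using path_up_short[OF a _ s(2)] that hdn d1 rt len drp by auto
      have 1: "\<not> length b\<^sub>0 \<le> length n"
      proof
        assume l: "length b\<^sub>0 \<le> length n"
        then have "length b\<^sub>0 \<le> length a - s" using apx rt pp by simp
        then have "rev b\<^sub>0 = take (length b\<^sub>0) n" using * l by simp
        then have "set (rev b\<^sub>0) \<subseteq> set n" by (metis set_take_subset)
        moreover have "hd b\<^sub>0 = Alpha" using b by simp
        ultimately show False using b(4) hA by (auto simp: n_def dest: list.set_sel(1))
      qed
      have "\<exists>w. rev b\<^sub>0 = n @ w"
      proof (cases "length b\<^sub>0 \<le> length a - s")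
        case True
        then show ?thesis using * 1 by (metis append_take_drop_id nat_le_linear take_append take_all append.assoc)
      next
        case False
        then have "length a - s \<le> length (rev b\<^sub>0)" "s < length a" using rt len by simp_all
        moreover have "distinct_adj (rev b\<^sub>0)" using d1 by (rule distinct_adj_appendD2)
        ultimately obtain w' where "rev b\<^sub>0 = drop s a @ w'"
          using path_up[OF a _ s(2) _ hdn] by blast
        then show ?thesis using drp rt by auto
      qed
      with 1 show ?thesis by blast
    qed
    have p2: "path a (length a) (rev x @ rev b\<^sub>0) z\<^sub>2"
      using path_end_loops[OF a, of "rev g" "rev x @ rev b\<^sub>0" z\<^sub>2] R(2) R' split(2) by simp
    have d2: "distinct_adj (rev x @ rev b\<^sub>0)"
      using db R(1) R' by (metis append_assoc distinct_adj_appendD2)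
    have "hd (rev x @ rev b\<^sub>0) = a ! (length a - 1)" using lx[OF x] x v by (simp add: hd_rev)
    then have **: "\<exists>w'. rev x @ rev b\<^sub>0 = rev a @ w'" if "length a \<le> length (rev x @ rev b\<^sub>0)"
      using path_down[OF a d2 p2 that _ v(7) le_refl] by auto
    have ra: "rev a = rev x @ h @ p" using rho hr pp by simp
    have "\<exists>w. rev b\<^sub>0 = h @ w"
    proof (cases "length a \<le> length (rev x @ rev b\<^sub>0)")
      case True
      then show ?thesis using **[OF True] ra by auto
    next
      case False
      have "rev x @ rev b\<^sub>0 = take (length (rev x @ rev b\<^sub>0)) (rev (take (length a) a))"
        using path_down_short[OF a d2 p2] False \<open>hd (rev x @ rev b\<^sub>0) = a ! (length a - 1)\<close> by simp
      then have "rev b\<^sub>0 = take (length b\<^sub>0) (h @ p)" using ra by simp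
      moreover have "length h \<le> length b\<^sub>0" using nl by (simp add: n_def)
      ultimately show ?thesis by (metis append_take_drop_id take_append take_all append.assoc)
    qed
    then obtain w w' where "n @ w = h @ w'" using nl by metis
    then have "n = h" by (simp add: n_def)
    then show ?thesis by (simp add: n_def)
  qed
  ultimately have "border_pair a x g y n p \<and> (x \<noteq> [] \<longrightarrow> rev n = n)"
    unfolding border_pair_def using split apx py hy lx r'ne hA hne by (auto simp: p_def n_def)
  then show ?thesis by blast
qed

section \<open>Periodic words\<close>

definition period :: "(int \<Rightarrow> colour) \<Rightarrow> int \<Rightarrow> bool" where
  "period f d \<longleftrightarrow> (\<forall>i. f (i + d) = f i)"

definition mirror :: "(int \<Rightarrow> colour) \<Rightarrow> int \<Rightarrow> bool" where
  "mirror f s \<longleftrightarrow> (\<forall>i. f (s - i) = f i)"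

definition seg :: "(int \<Rightarrow> colour) \<Rightarrow> int \<Rightarrow> colour list \<Rightarrow> bool" where
  "seg f i w \<longleftrightarrow> (\<forall>j<length w. f (i + int j) = w ! j)"

lemma period_mult: "period f d \<Longrightarrow> period f (k * d)"
proof (induction k rule: int_induct[where k = 0])
  case base
  then show ?case by (simp add: period_def)
next
  case (step1 k)
  show ?case unfolding period_def
  proof
    fix i
    have "f (i + (k + 1) * d) = f ((i + d) + k * d)" by (simp add: algebra_simps)
    also have "\<dots> = f (i + d)" using step1 unfolding period_def by blast
    also have "\<dots> = f i" using step1 unfolding period_def by blast
    finally show "f (i + (k + 1) * d) = f i" .
  qed
next
  case (step2 k)
  show ?case unfolding period_def
  proof
    fix i
    have "f i = f (i - d + d)" by simp
    also have "\<dots> = f (i - d)" using step2 unfolding period_def by blast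
    also have "\<dots> = f (i - d + k * d)" using step2 unfolding period_def by metis
    finally show "f (i + (k - 1) * d) = f i" by (simp add: algebra_simps)
  qed
qed

lemma period_add: "period f c \<Longrightarrow> period f d \<Longrightarrow> period f (c + d)"
  unfolding period_def by (metis add.assoc)

lemma period_minus: "period f d \<Longrightarrow> period f (- d)"
  using period_mult[of f d "-1"] by simp

lemma periodD: "period f d \<Longrightarrow> f (i + d) = f i"
  unfolding period_def by blast

lemma period_mod: "period f d \<Longrightarrow> f (i mod d) = f i"
  using periodD[OF period_mult[of f d "i div d"], of "i mod d"] by (simp add: mult.commute)

lemma period_gcd:
  assumes "period f c" "period f d"
  shows "period f (gcd c d)"
proof -
  obtain s t where "s * c + t * d = gcd c d" using bezout_int by blast
  then show ?thesis using period_add[OF period_mult[OF assms(1)] period_mult[OF assms(2)]] by metis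
qed

lemma mirrorD: "mirror f s \<Longrightarrow> f (s - i) = f i"
  unfolding mirror_def by blast

lemma mirror_period: "mirror f s \<Longrightarrow> period f d \<Longrightarrow> mirror f (s + d)"
  unfolding mirror_def period_def by (metis diff_add_eq)

lemma seg_append: "seg f i (u @ w) \<longleftrightarrow> seg f i u \<and> seg f (i + int (length u)) w"
proof
  assume *: "seg f i (u @ w)"
  have "f (i + int (length u) + int j) = w ! j" if "j < length w" for j
    using * that unfolding seg_def
    by (metis add.assoc length_append nat_add_left_cancel_less nth_append_length_plus of_nat_add)
  moreover have "f (i + int j) = u ! j" if "j < length u" for j
    using * that unfolding seg_def by (metis length_append nth_append trans_less_add1)
  ultimately show "seg f i u \<and> seg f (i + int (length u)) w" unfolding seg_def by blast
next
  assume *: "seg f i u \<and> seg f (i + int (length u)) w"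
  show "seg f i (u @ w)" unfolding seg_def
  proof (intro allI impI)
    fix j assume j: "j < length (u @ w)"
    show "f (i + int j) = (u @ w) ! j"
    proof (cases "j < length u")
      case True
      then show ?thesis using * by (simp add: seg_def nth_append)
    next
      case False
      then have "f (i + int (length u) + int (j - length u)) = w ! (j - length u)"
        using * j unfolding seg_def by (metis add_diff_inverse_nat length_append nat_add_left_cancel_less)
      moreover have "i + int (length u) + int (j - length u) = i + int j" using False by simp
      ultimately have "f (i + int j) = w ! (j - length u)" by metis
      then show ?thesis using False by (simp add: nth_append)
    qed
  qed
qed

lemma seg_Nil [simp]: "seg f i []"
  by (simp add: seg_def)

lemma segD: "seg f i w \<Longrightarrow> j < length w \<Longrightarrow> f (i + int j) = w ! j"
  by (simp add: seg_def)

lemma seg_period: "period f d \<Longrightarrow> seg f (i + d) w \<longleftrightarrow> seg f i w"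
  unfolding seg_def period_def by (metis (no_types, lifting) add.assoc add.commute)

lemma seg_mirror:
  assumes "mirror f s" "seg f i w"
  shows "seg f (s - i - int (length w) + 1) (rev w)"
  unfolding seg_def
proof (intro allI impI)
  fix j assume j: "j < length (rev w)"
  have "f (s - i - int (length w) + 1 + int j) = f (i + int (length w - Suc j))"
    using mirrorD[OF assms(1), of "i + int (length w - Suc j)"] j by (simp add: of_nat_diff algebra_simps)
  also have "\<dots> = w ! (length w - Suc j)" by (rule segD[OF assms(2)]) (use j in simp)
  finally show "f (s - i - int (length w) + 1 + int j) = rev w ! j" using j by (simp add: rev_nth)
qed

lemma seg_unique: "seg f i u \<Longrightarrow> seg f i w \<Longrightarrow> length u = length w \<Longrightarrow> u = w"
  by (rule nth_equalityI) (auto simp: seg_def)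

text \<open>The window covers a full period and so determines the whole word.\<close>

lemma period_from_window:
  assumes "period f d" "0 < d" "d \<le> int (length w)" "seg f i w" "seg f (i + e) w"
  shows "period f e"
  unfolding period_def
proof
  fix j
  let ?t = "nat ((j - i) mod d)"
  have t: "int ?t = (j - i) mod d" "?t < length w" using assms(2,3)
    by (simp_all add: nat_less_iff) (use assms in \<open>meson pos_mod_bound order.strict_trans2\<close>)
  have p: "period f (((j - i) div d) * d)" using assms(1) by (rule period_mult)
  have j: "j = i + int ?t + ((j - i) div d) * d" unfolding t(1)
    by (simp add: mult.commute)
  have "f (j + e) = f ((i + e + int ?t) + ((j - i) div d) * d)"
    using arg_cong[OF j, of "\<lambda>x. f (x + e)"] by (simp add: algebra_simps)
  also have "\<dots> = f (i + e + int ?t)" using p by (rule periodD)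
  also have "\<dots> = f (i + int ?t)" using segD[OF assms(4) t(2)] segD[OF assms(5) t(2)] by simp
  also have "\<dots> = f (i + int ?t + ((j - i) div d) * d)" using periodD[OF p] by simp
  also have "\<dots> = f j" using j by simp
  finally show "f (j + e) = f j" .
qed

lemma fun_eq_from_window:
  assumes "period f d" "period g d" "0 < d" "d \<le> int (length w)" "seg f i w" "seg g i w"
  shows "f = g"
proof
  fix j
  let ?t = "nat ((j - i) mod d)"
  have t: "int ?t = (j - i) mod d" "?t < length w" using assms(3,4)
    by (simp_all add: nat_less_iff) (use assms in \<open>meson pos_mod_bound order.strict_trans2\<close>)
  have j: "i + int ?t + ((j - i) div d) * d = j" unfolding t(1) by (simp add: mult.commute)
  have "f j = f (i + int ?t)" using periodD[OF period_mult[OF assms(1), of "(j - i) div d"], of "i + int ?t"] j by simp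
  moreover have "g j = g (i + int ?t)" using periodD[OF period_mult[OF assms(2), of "(j - i) div d"], of "i + int ?t"] j by simp
  ultimately show "f j = g j" using segD[OF assms(5) t(2)] segD[OF assms(6) t(2)] by simp
qed

text \<open>The biinfinite word read by a path bouncing between the two ends of \<open>a\<close>, with constant gaps.\<close>

definition bounce :: "colour list \<Rightarrow> colour list \<Rightarrow> colour list \<Rightarrow> int \<Rightarrow> colour" where
  "bounce a m n i = (let w = a @ m @ rev a @ n in w ! nat (i mod int (length w)))"

definition bounce_period :: "colour list \<Rightarrow> colour list \<Rightarrow> colour list \<Rightarrow> int" where
  "bounce_period a m n = 2 * int (length a) + int (length m) + int (length n)"

lemma bounce_period_pos: "a \<noteq> [] \<Longrightarrow> 0 < bounce_period a m n"
  by (cases a) (simp_all add: bounce_period_def)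

lemma bounce_period_eq: "int (length (a @ m @ rev a @ n)) = bounce_period a m n"
  by (simp add: bounce_period_def)

lemma period_bounce: "period (bounce a m n) (bounce_period a m n)"
  unfolding period_def bounce_def Let_def bounce_period_eq by simp

lemma seg_bounce: "seg (bounce a m n) 0 (a @ m @ rev a @ n)"
  unfolding seg_def bounce_def Let_def by auto

text \<open>The centre of reflection is that of the \<open>n\<close> just before position 0, which
  occupies the positions from \<open>- length n\<close> to \<open>- 1\<close>.\<close>

lemma mirror_bounce:
  assumes "rev m = m" "rev n = n" "a \<noteq> []"
  shows "mirror (bounce a m n) (- int (length n) - 1)"
proof -
  let ?f = "bounce a m n" and ?p = "bounce_period a m n" and ?w = "a @ m @ rev a @ n"
  let ?g = "\<lambda>i. ?f (- int (length n) - 1 - i)"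
  have pg: "period ?g ?p"
    unfolding period_def
  proof
    fix i
    show "?g (i + ?p) = ?g i"
      using periodD[OF period_minus[OF period_bounce[of a m n]], of "- int (length n) - 1 - i"]
      by (simp add: algebra_simps)
  qed
  have "seg ?f (- int (length n) + ?p) n" using seg_bounce[of a m n]
    by (simp add: seg_append bounce_period_def algebra_simps)
  then have "seg ?f (- int (length n)) n" by (simp only: seg_period[OF period_bounce])
  then have f: "seg ?f (- int (length n)) (n @ a @ m @ rev a)"
    using seg_bounce[of a m n] by (simp add: seg_append)
  have "seg ?g (- int (length n)) (n @ a @ m @ rev a)"
    unfolding seg_def
  proof (intro allI impI)
    fix j assume j: "j < length (n @ a @ m @ rev a)"
    have r: "n @ a @ m @ rev a = rev ?w" using assms by simp
    have "?g (- int (length n) + int j) = ?f (- 1 - int j)" by simp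
    also have "\<dots> = ?f (- 1 - int j + ?p)" using periodD[OF period_bounce] by metis
    also have "- 1 - int j + ?p = 0 + int (length ?w - Suc j)"
      using j by (simp add: bounce_period_def of_nat_diff)
    also have "?f \<dots> = ?w ! (length ?w - Suc j)"
      by (rule segD[OF seg_bounce]) (use j in simp)
    also have "\<dots> = rev ?w ! j" by (rule rev_nth[symmetric]) (use j in simp)
    finally show "?g (- int (length n) + int j) = (n @ a @ m @ rev a) ! j" unfolding r .
  qed
  with f have "?f = ?g"
    by (intro fun_eq_from_window[OF period_bounce pg bounce_period_pos[OF assms(3)]])
      (auto simp: bounce_period_def)
  then show ?thesis unfolding mirror_def by metis
qed

lemma seg_bounce_twice: "seg (bounce a m n) 0 ((a @ m @ rev a @ n) @ (a @ m @ rev a @ n))"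
  unfolding seg_append[of _ _ "a @ m @ rev a @ n"] bounce_period_eq seg_period[OF period_bounce]
  using seg_bounce by blast

text \<open>The reversed \<open>a\<close> is both \<open>y m x^-1\<close> and
  \<open>x^-1 n p\<close>. Substituting the two forms shows that the word \<open>u\<close>, which is
  at least as long as one round, occurs at 0 and again after \<open>p n\<close>.\<close>

lemma period_bounce_border:
  assumes "border_pair a x m y n p" "rev m = m" "rev n = n"
  shows "period (bounce a m n) (int (length (p @ n)))"
proof -
  have a: "a = x @ m @ y" "a = p @ n @ x" "rev y = y" "rev p = p" "p \<noteq> []"
    using assms(1) by (auto simp: border_pair_def)
  have r1: "rev a = y @ m @ rev x" using a(1,3) assms(2) by (metis append_assoc rev_append)
  have r2: "rev a = rev x @ n @ p" using a(2,4) assms(3) by (metis append_assoc rev_append)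
  let ?w = "a @ m @ rev a @ n"
  define u where "u = x @ m @ y @ m @ rev a @ n @ x"
  have "?w @ ?w = u @ (m @ y @ m @ rev a @ n)"
  proof -
    have "?w @ ?w = (x @ m @ y) @ m @ rev a @ n @ (x @ m @ y) @ m @ rev a @ n"
      using a(1) by (metis append_assoc)
    then show ?thesis by (simp add: u_def)
  qed
  then have 1: "seg (bounce a m n) 0 u" using seg_bounce_twice[of a m n] seg_append by metis
  have "?w @ ?w = (p @ n @ x) @ m @ (y @ m @ rev x) @ n @ (p @ n @ x) @ m @ rev a @ n"
    using a(2) r1 by (metis append_assoc)
  also have "\<dots> = (p @ n) @ (x @ m @ y @ m @ (rev x @ n @ p) @ n @ x) @ m @ rev a @ n" by simp
  also have "\<dots> = (p @ n) @ u @ (m @ rev a @ n)" unfolding r2[symmetric] by (simp add: u_def)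
  finally have 2: "seg (bounce a m n) (0 + int (length (p @ n))) u"
    using seg_bounce_twice[of a m n] by (metis seg_append)
  have "a \<noteq> []" using a by auto
  moreover have "bounce_period a m n \<le> int (length u)"
    using arg_cong[OF a(1), of length] by (simp add: u_def bounce_period_def)
  ultimately show ?thesis
    using period_from_window[OF period_bounce bounce_period_pos _ 1 2] by simp
qed

text \<open>The position in the graph of \<open>a\<close> of the walk that reads the bouncing word
  and is at state 0 at time 0; it rests at the ends during \<open>m\<close> and
  \<open>n\<close>.\<close>

definition bounce_state :: "colour list \<Rightarrow> colour list \<Rightarrow> colour list \<Rightarrow> int \<Rightarrow> nat" where
  "bounce_state a m n i = (let k = nat (i mod bounce_period a m n) in
     if k \<le> length a then k else if k \<le> length (a @ m) then length a
     else if k \<le> length (a @ m @ a) then length (a @ m @ a) - k else 0)"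

lemma bounce_state_step:
  assumes "a \<noteq> []" "Beta \<notin> set m" "Alpha \<notin> set n"
  shows "edge a (bounce_state a m n i) (bounce a m n i) (bounce_state a m n (i + 1))"
proof -
  let ?p = "bounce_period a m n" and ?w = "a @ m @ rev a @ n"
  define k where "k = nat (i mod ?p)"
  have pp: "0 < ?p" using bounce_period_pos[OF assms(1)] .
  have la: "0 < length a" using assms(1) by simp
  have kp: "int k < ?p" "int k = i mod ?p" using pp by (simp_all add: k_def)
  have kl: "k < length ?w" using kp(1) unfolding bounce_period_eq[symmetric] by simp
  have l: "bounce a m n i = ?w ! k" by (simp only: bounce_def Let_def bounce_period_eq k_def)
  have s: "bounce_state a m n i = (if k \<le> length a then k else if k \<le> length (a @ m) then length a
     else if k \<le> length (a @ m @ a) then length (a @ m @ a) - k else 0)"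
    by (simp add: bounce_state_def k_def Let_def)
  have m: "(i + 1) mod ?p = (int k + 1) mod ?p" unfolding kp(2) by (simp add: mod_add_left_eq)
  have s': "bounce_state a m n (i + 1) = (if Suc k = length ?w then 0 else if Suc k \<le> length a then Suc k
     else if Suc k \<le> length (a @ m) then length a
     else if Suc k \<le> length (a @ m @ a) then length (a @ m @ a) - Suc k else 0)"
  proof (cases "Suc k = length ?w")
    case True
    then have "int k + 1 = ?p" unfolding bounce_period_eq[symmetric] by linarith
    then show ?thesis using True m by (simp add: bounce_state_def)
  next
    case False
    then have "int k + 1 < ?p" using kl unfolding bounce_period_eq[symmetric] by linarith
    then have "nat ((i + 1) mod ?p) = Suc k" using m by simp
    then show ?thesis using False by (simp add: bounce_state_def Let_def)
  qed
  consider "k < length a" | "length a \<le> k" "k < length (a @ m)"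
    | "length (a @ m) \<le> k" "k < length (a @ m @ a)" | "length (a @ m @ a) \<le> k" by linarith
  then show ?thesis
  proof cases
    case 1
    then have "?w ! k = a ! k" by (simp add: nth_append)
    then show ?thesis using 1 l s s' assms(1) by (auto simp: edge_def)
  next
    case 2
    then have "k - length a < length m" by auto
    with 2 have "?w ! k = m ! (k - length a)" by (simp add: nth_append)
    then have "?w ! k \<noteq> Beta" using 2 assms(2) by (metis add_diff_inverse_nat length_append nat_add_left_cancel_less not_le nth_mem)
    moreover have "bounce_state a m n i = length a" "bounce_state a m n (i + 1) = length a"
      using 2 s s' la by auto
    ultimately show ?thesis using l by (simp add: edge_def)
  next
    case 3
    then have "\<not> k < length a" "\<not> k - length a < length m" "k - length a - length m < length a" by auto
    then have "?w ! k = rev a ! (k - length (a @ m))" by (simp add: nth_append diff_diff_eq)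
    also have "\<dots> = a ! (length (a @ m @ a) - Suc k)" using 3 by (simp add: rev_nth) (metis add_diff_cancel_left diff_diff_eq add.assoc add.commute add_Suc_right)
    finally have w: "?w ! k = a ! (length (a @ m @ a) - Suc k)" .
    have "bounce_state a m n i = length (a @ m @ a) - k"
      using 3 s by auto
    moreover have "bounce_state a m n (i + 1) = length (a @ m @ a) - Suc k"
      using 3 s' by auto
    ultimately show ?thesis using l w 3 by (auto simp: edge_def)
  next
    case 4
    then have "\<not> k < length a" "\<not> k - length a < length m" "\<not> k - length a - length m < length a" by auto
    then have "?w ! k = n ! (k - length (a @ m @ a))" by (simp add: nth_append add.assoc)
    moreover have "k - length (a @ m @ a) < length n" using kl 4 by simp
    ultimately have "?w ! k \<noteq> Alpha" using assms(3) by (metis nth_mem)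
    moreover have "bounce_state a m n i = 0" using 4 s assms(1) by auto
    moreover have "bounce_state a m n (i + 1) = 0" using 4 s' by auto
    ultimately show ?thesis using l by (simp add: edge_def)
  qed
qed

lemma bounce_state_start: "0 \<le> i \<Longrightarrow> i \<le> int (length a) \<Longrightarrow> a \<noteq> [] \<Longrightarrow> bounce_state a m n i = nat i"
  by (cases a) (auto simp: bounce_state_def bounce_period_def Let_def)

lemma bounce_adjacent:
  assumes "valid a" "Beta \<notin> set m" "Alpha \<notin> set n" "distinct_adj m" "distinct_adj n"  "m \<noteq> []" "n \<noteq> []"
  shows "bounce a m n i \<noteq> bounce a m n (i + 1)"
proof -
  let ?w = "a @ m @ rev a @ n" and ?p = "bounce_period a m n"
  note v = validD[OF assms(1)]
  have h: "hd m \<noteq> Beta" "last m \<noteq> Beta" "hd n \<noteq> Alpha" "last n \<noteq> Alpha"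
    using assms by (metis list.set_sel(1) last_in_set)+
  have d: "distinct_adj (?w @ ?w)"
    using assms v h by (auto simp: distinct_adj_append_iff hd_rev last_rev)
  define k where "k = nat (i mod ?p)"
  have kp: "int k < ?p" "int k = i mod ?p" using bounce_period_pos[OF v(1), of m n] by (simp_all add: k_def)
  have kl: "k < length ?w" using kp(1) unfolding bounce_period_eq[symmetric] by simp
  have i: "i = int k + (i div ?p) * ?p" using kp(2) by simp
  have q: "period (bounce a m n) ((i div ?p) * ?p)" by (rule period_mult[OF period_bounce])
  have "bounce a m n i = bounce a m n (int k)" using periodD[OF q, of "int k"] i by simp
  also have "\<dots> = (?w @ ?w) ! k" using segD[OF seg_bounce_twice, of k a m n] kl by simp
  finally have 1: "bounce a m n i = (?w @ ?w) ! k" .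
  have "bounce a m n (i + 1) = bounce a m n (int (Suc k))" using periodD[OF q, of "int (Suc k)"] i by (simp add: algebra_simps)
  also have "\<dots> = (?w @ ?w) ! Suc k" using segD[OF seg_bounce_twice, of "Suc k" a m n] kl by simp
  finally show ?thesis using 1 distinct_adj_nth[OF d, of k] kl by simp
qed

text \<open>
  Three paths that read the same word \<open>b\<close> and are in pairwise different states force the next
  letter, because at least one of them is in a state with only two edges.
\<close>

lemma three_walkers:
  fixes f :: "int \<Rightarrow> colour" and \<gamma> :: "nat \<Rightarrow> nat \<Rightarrow> nat"
  assumes a: "valid a" and b: "distinct_adj b" "b \<noteq> []" "b ! 0 = f 0"
    and f: "\<And>i. f i \<noteq> f (i + 1)"
    and walk: "\<And>j. j < 3 \<Longrightarrow> \<exists>z. path a (\<gamma> j 0) b z"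
    and guide: "\<And>j d. j < 3 \<Longrightarrow> edge a (\<gamma> j d) (f (int d)) (\<gamma> j (Suc d))"
    and distinct: "\<And>i j d r. i < 3 \<Longrightarrow> j < 3 \<Longrightarrow> i \<noteq> j \<Longrightarrow> 0 < d \<Longrightarrow> d < length b \<Longrightarrow>
      path a (\<gamma> i 0) (take d b) r \<Longrightarrow> \<not> path a (\<gamma> j 0) (take d b) r"
  shows "seg f 0 b"
proof -
  have "\<forall>i<d. b ! i = f (int i)" if "d \<le> length b" for d
    using that
  proof (induction d)
    case (Suc d)
    then have IH: "\<forall>i<d. b ! i = f (int i)" by simp
    have "b ! d = f (int d)"
    proof (cases "d = 0")
      case False
      \<comment> \<open>Up to time \<open>d\<close> the words \<open>b\<close> and \<open>f\<close>
        agree, so the readers of \<open>b\<close> are where the guides are.\<close>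
      have reach: "path a (\<gamma> j 0) (take d b) (\<gamma> j d)" if j: "j < 3" for j
      proof -
        have "path a (\<gamma> j 0) (take e b) (\<gamma> j e)" if "e \<le> d" for e
          using that
        proof (induction e)
          case (Suc e)
          then have "path a (\<gamma> j 0) (take e b @ [b ! e]) (\<gamma> j (Suc e))"
            using guide[OF j, of e] IH unfolding path_append by auto
          then show ?case using Suc.prems \<open>Suc d \<le> length b\<close> by (simp add: take_Suc_conv_app_nth)
        qed simp
        then show ?thesis by simp
      qed
      have ne: "\<gamma> i d \<noteq> \<gamma> j d" if "i < 3" "j < 3" "i \<noteq> j" for i j
        using distinct[OF that, of d] reach that False Suc.prems by (metis Suc_le_lessD bot_nat_0.not_eq_extremum)
      have le: "\<gamma> j d \<le> length a" if "j < 3" for j using guide[OF that, of d] edge_le by blast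
      \<comment> \<open>There are only two end states for three distinct positions.\<close>
      obtain j where j: "j < 3" "0 < \<gamma> j d" "\<gamma> j d < length a"
      proof -
        have "\<exists>j<3. \<gamma> j d \<noteq> 0 \<and> \<gamma> j d \<noteq> length a"
        proof (rule ccontr)
          assume "\<not> ?thesis"
          then have "\<gamma> 0 d \<in> {0, length a}" "\<gamma> 1 d \<in> {0, length a}" "\<gamma> 2 d \<in> {0, length a}" by auto
          then show False using ne[of 0 1] ne[of 0 2] ne[of 1 2] by auto
        qed
        then show thesis using that le by (metis bot_nat_0.not_eq_extremum le_neq_implies_less)
      qed
      obtain z where "path a (\<gamma> j 0) b z" using walk[OF j(1)] by blast
      then obtain r where r: "path a (\<gamma> j 0) (take d b) r" "path a r (drop d b) z"
        by (metis append_take_drop_id path_append)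
      have "r = \<gamma> j d" using path_det[OF a r(1) reach[OF j(1)]] .
      moreover have "drop d b = b ! d # drop (Suc d) b" using Suc.prems by (simp add: Cons_nth_drop_Suc)
      ultimately obtain t where t: "edge a (\<gamma> j d) (b ! d) t" using r(2) by auto
      obtain e where e: "d = Suc e" using False by (cases d) auto
      have prev: "edge a (\<gamma> j d) (f (int e)) (\<gamma> j e)" using guide[OF j(1), of e] edge_sym e by blast
      have "b ! e \<noteq> b ! d" using distinct_adj_nth[OF b(1), of e] Suc.prems e by simp
      then have "b ! d \<noteq> f (int e)" using IH e by simp
      moreover have "f (int d) \<noteq> f (int e)" using f[of "int e"] e by (metis of_nat_Suc add.commute)
      ultimately show ?thesis by (rule edge_inner[OF j(2,3) prev t guide[OF j(1)]])
    qed (use b in simp)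
    with IH show ?case by (simp add: less_Suc_eq)
  qed simp
  from this[of "length b"] show ?thesis by (simp add: seg_def)
qed

section \<open>Shortest common upper bounds\<close>

lemma not_distinct_adj_split: "\<not> distinct_adj w \<Longrightarrow> \<exists>u c z. w = u @ [c, c] @ z"
proof (induction w)
  case (Cons c w)
  show ?case
  proof (cases "distinct_adj w")
    case True
    then have "w \<noteq> []" "hd w = c" using Cons.prems by (auto simp: distinct_adj_Cons)
    then have "c # w = [] @ [c, c] @ tl w" by (cases w) auto
    then show ?thesis by blast
  next
    case False
    then obtain u d z where "w = u @ [d, d] @ z" using Cons.IH by blast
    then have "c # w = (c # u) @ [d, d] @ z" by simp
    then show ?thesis by blast
  qed
qed simp

lemma up_complete:
  assumes "valid u" "distinct_adj w" "path u 0 w t" "hd w = Alpha" "w \<noteq> []" "t = 0 \<or> t = length u"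
  shows "\<exists>w'. w = u @ w' \<and> path u (length u) w' t"
proof (cases "length u \<le> length w")
  case True
  then show ?thesis using path_up[OF assms(1-3)] assms validD[OF assms(1)] by simp
next
  case False
  then have "t = 0 + length w"
    using path_up_short[OF assms(1-3)] assms validD[OF assms(1)] by auto
  then show ?thesis using False assms(5,6) by simp
qed

lemma down_complete:
  assumes "valid u" "distinct_adj w" "path u (length u) w t" "hd w = Beta" "w \<noteq> []" "t = 0 \<or> t = length u"
  shows "\<exists>w'. w = rev u @ w' \<and> path u 0 w' t"
proof (cases "length u \<le> length w")
  case True
  then show ?thesis using path_down[OF assms(1-3)] assms validD[OF assms(1)] by simp
next
  case False
  then have "t = length u - length w"
    using path_down_short[OF assms(1-3)] assms validD[OF assms(1)] by auto
  then show ?thesis using False assms(5,6) by (cases w) auto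
qed

lemma path_take: "k \<le> length u \<Longrightarrow> path u 0 (take k u) k"
proof (induction k)
  case (Suc k)
  then have "take (Suc k) u = take k u @ [u ! k]" by (simp add: take_Suc_conv_app_nth)
  moreover have "edge u k (u ! k) (Suc k)" using Suc.prems by (simp add: edge_def)
  ultimately show ?case using Suc by (auto simp: path_append)
qed simp

definition simple_walk :: "colour list \<Rightarrow> nat \<Rightarrow> colour list \<Rightarrow> bool" where
  "simple_walk u s g \<longleftrightarrow>
    (\<forall>h\<^sub>1 h\<^sub>2 h\<^sub>3 r. g = h\<^sub>1 @ h\<^sub>2 @ h\<^sub>3 \<longrightarrow> path u s h\<^sub>1 r \<longrightarrow> path u r h\<^sub>2 r \<longrightarrow> h\<^sub>2 = [])"

lemma simple_walkD:
  "simple_walk u s g \<Longrightarrow> g = h\<^sub>1 @ h\<^sub>2 @ h\<^sub>3 \<Longrightarrow> path u s h\<^sub>1 r \<Longrightarrow> path u r h\<^sub>2 r \<Longrightarrow> h\<^sub>2 = []"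
  unfolding simple_walk_def by blast

lemma simple_walk_Cons: "simple_walk u s (c # g) \<Longrightarrow> edge u s c r \<Longrightarrow> simple_walk u r g"
  unfolding simple_walk_def by (metis append_Cons path.simps(2))

text \<open>In a path graph a walk that never revisits a state can neither loop nor turn, so it
  spells a factor of \<open>u\<close> or its reversal.\<close>

lemma simple_walk_monotone:
  assumes "path u s g t" "simple_walk u s g" "g \<noteq> []"
  shows "(\<exists>x y. u = x @ g @ y \<and> s = length x \<and> t = length (x @ g)) \<or>
    (\<exists>x y. u = x @ rev g @ y \<and> t = length x \<and> s = length (x @ g))"
  using assms
proof (induction g arbitrary: s)
  case (Cons c g)
  from Cons.prems(1) obtain r where r: "edge u s c r" "path u r g t" by auto
  have rs: "r \<noteq> s"
    using simple_walkD[OF Cons.prems(2), of "[]" "[c]" g s] r(1) by auto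
  have no_back: False if "g = d # g'" "edge u r d s" for d g'
    using simple_walkD[OF Cons.prems(2), of "[]" "[c, d]" g' s] r(1) that by auto
  show ?case
  proof (cases g)
    case Nil
    then have t: "t = r" using r(2) by simp
    from r(1) rs consider "r = Suc s" "s < length u" "u ! s = c" | "s = Suc r" "r < length u" "u ! r = c"
      by (auto simp: edge_def)
    then show ?thesis
    proof cases
      case 1
      then have "u = take s u @ [c] @ drop (Suc s) u" using id_take_nth_drop[of s u] by simp
      then show ?thesis using 1 Nil t by (intro disjI1 exI[of _ "take s u"] exI[of _ "drop (Suc s) u"]) simp
    next
      case 2
      then have "u = take r u @ [c] @ drop (Suc r) u" using id_take_nth_drop[of r u] by simp
      then show ?thesis using 2 Nil t by (intro disjI2 exI[of _ "take r u"] exI[of _ "drop (Suc r) u"]) simp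
    qed
  next
    case (Cons d g')
    from Cons.IH[OF r(2) simple_walk_Cons[OF Cons.prems(2) r(1)]] Cons
    consider (up) x y where "u = x @ g @ y" "r = length x" "t = length (x @ g)"
      | (down) x y where "u = x @ rev g @ y" "t = length x" "r = length (x @ g)" by auto
    then show ?thesis
    proof cases
      case up
      have "edge u r d (Suc r)" using up Cons by (simp add: edge_def nth_append)
      then have "s \<noteq> Suc r" using no_back[OF Cons] by auto
      then have s: "r = Suc s" "s < length u" "u ! s = c" using r(1) rs by (auto simp: edge_def)
      then have x: "x = take s u @ [c]"
        using up by (metis append_eq_conv_conj take_Suc_conv_app_nth)
      have "u = take s u @ (c # g) @ y" using up(1) x by (metis append.assoc append_Cons append_Nil)
      moreover have "s = length (take s u)" using s by simp
      moreover have "t = length (take s u @ c # g)" using up(3) x by simp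
      ultimately show ?thesis by blast
    next
      case down
      then have l: "r = Suc (length (x @ rev g'))" "u ! (length (x @ rev g')) = d" "length (x @ rev g') < length u"
        using Cons by (simp_all add: nth_append)
      have "edge u r d (r - 1)" using l by (simp add: edge_def)
      then have "s \<noteq> r - 1" using no_back[OF Cons] by auto
      then have s: "s = Suc r" "r < length u" "u ! r = c" using r(1) rs by (auto simp: edge_def)
      then have y: "y = c # drop (Suc r) u"
        using down by (metis Cons_nth_drop_Suc append.assoc append_eq_conv_conj length_append length_rev)
      have "u = x @ rev (c # g) @ drop (Suc r) u" using down(1) y by simp
      moreover have "s = length (x @ c # g)" using s down by simp
      ultimately show ?thesis using down(2) by blast
    qed
  qed
qed simp

section \<open>Common bounds that never repeat a pair of states\<close>

text \<open>Minimality of a common bound enters only through \<open>simple\<close>: a stretch that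
  returns to the same pair of states could be cut out.\<close>

locale common_bound =
  fixes a b v :: "colour list"
  assumes va: "valid a" and vb: "valid b"
    and pa: "path a 0 v (length a)" and pb: "path b 0 v (length b)"
    and simple: "v = v\<^sub>1 @ v\<^sub>2 @ v\<^sub>3 \<Longrightarrow> path a 0 v\<^sub>1 s \<Longrightarrow> path a s v\<^sub>2 s \<Longrightarrow>
      path b 0 v\<^sub>1 t \<Longrightarrow> path b t v\<^sub>2 t \<Longrightarrow> v\<^sub>2 = []"
begin

lemma commute: "common_bound b a v"
  using va vb pa pb simple by unfold_locales blast+

lemma dual: "common_bound (dual a) (dual b) (dual v)"
proof
  fix w\<^sub>1 w\<^sub>2 w\<^sub>3 s t
  assume *: "dual v = w\<^sub>1 @ w\<^sub>2 @ w\<^sub>3" "path (dual a) 0 w\<^sub>1 s" "path (dual a) s w\<^sub>2 s"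
    "path (dual b) 0 w\<^sub>1 t" "path (dual b) t w\<^sub>2 t"
  have v: "v = dual w\<^sub>3 @ dual w\<^sub>2 @ dual w\<^sub>1" using *(1) by (metis append.assoc dual_append dual_dual)
  have rest: "path u 0 (dual w\<^sub>3) (length u - r) \<and> path u (length u - r) (dual w\<^sub>2) (length u - r)"
    if u: "valid u" "path u 0 v (length u)" "path (dual u) 0 w\<^sub>1 r" "path (dual u) r w\<^sub>2 r" for u r
  proof -
    have "path (dual u) 0 (w\<^sub>1 @ w\<^sub>2 @ w\<^sub>3) (length (dual u))"
      using path_dual_rev[OF u(2)] *(1) by simp
    then have "path (dual u) r w\<^sub>3 (length (dual u))"
      using path_det[OF _ u(3)] path_det[OF _ u(4)] u(1) unfolding path_append by (metis valid_dual)
    then have "path u (length u - r) (map swap w\<^sub>3) 0" using path_dual by force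
    moreover have "path u (length u - r) (map swap w\<^sub>2) (length u - r)" using path_dual[OF u(4)] by simp
    ultimately show ?thesis using path_rev by (metis dual_def rev_map)
  qed
  have "dual w\<^sub>2 = []"
    using simple[OF v] rest[OF va pa *(2,3)] rest[OF vb pb *(4,5)] by blast
  then show "w\<^sub>2 = []" by simp
qed (use va vb path_dual_rev[OF pa] path_dual_rev[OF pb] in simp_all)

text \<open>Otherwise the stretch between the two prefixes would return to its pair of states. The
  pair thus serves as a clock along \<open>v\<close>.\<close>

lemma same_time:
  assumes "v = u\<^sub>1 @ u\<^sub>2" "v = u\<^sub>1' @ u\<^sub>2'" "path a 0 u\<^sub>1 s" "path a 0 u\<^sub>1' s" "path b 0 u\<^sub>1 t" "path b 0 u\<^sub>1' t"
  shows "u\<^sub>1 = u\<^sub>1'"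
proof -
  have "w = []" if "v = (u @ w) @ r" "path a 0 u s" "path a 0 (u @ w) s" "path b 0 u t" "path b 0 (u @ w) t" for u w r
    using simple[of u w r s t] that path_det[OF va] path_det[OF vb] unfolding path_append by (metis append.assoc)
  then show ?thesis
    using append_eq_append_cases[of u\<^sub>1 u\<^sub>2 u\<^sub>1' u\<^sub>2'] assms by (metis append.right_neutral)
qed

lemma v_nonempty: "v \<noteq> []"
  using pa validD(7)[OF va] by auto

text \<open>Edges are undirected, so reading the same letter twice returns to the same pair of
  states.\<close>

lemma adj: "distinct_adj v"
proof (rule ccontr)
  assume "\<not> distinct_adj v"
  then obtain u c z where v: "v = u @ [c, c] @ z" using not_distinct_adj_split by blast
  obtain s where s: "path a 0 u s" "path a s ([c, c] @ z) (length a)" using pa v path_append by metis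
  obtain t where t: "path b 0 u t" "path b t ([c, c] @ z) (length b)" using pb v path_append by metis
  have "path a s [c, c] s" using s(2) edge_sym by auto
  moreover have "path b t [c, c] t" using t(2) edge_sym by auto
  ultimately show False using simple[OF v s(1) _ t(1)] by simp
qed

lemma hd_v: "hd v = Alpha"
proof (rule ccontr)
  assume "hd v \<noteq> Alpha"
  then have "path a 0 [hd v] 0" "path b 0 [hd v] 0" by (auto simp: edge_def)
  moreover have "v = [] @ [hd v] @ tl v" using v_nonempty by simp
  ultimately show False using simple[of "[]" "[hd v]" "tl v" 0 0] by simp
qed

lemma last_v: "last v = Beta"
proof -
  have "hd (dual v) = Alpha" using common_bound.hd_v[OF dual] .
  then show ?thesis using v_nonempty by (simp add: dual_def hd_map hd_rev)
qed

lemma start_only: "v = v\<^sub>1 @ v\<^sub>2 \<Longrightarrow> path a 0 v\<^sub>1 0 \<Longrightarrow> path b 0 v\<^sub>1 0 \<Longrightarrow> v\<^sub>1 = []"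
  using simple[of "[]" v\<^sub>1 v\<^sub>2 0 0] by simp

lemma end_only: "v = v\<^sub>1 @ v\<^sub>2 \<Longrightarrow> path a 0 v\<^sub>1 (length a) \<Longrightarrow> path b 0 v\<^sub>1 (length b) \<Longrightarrow> v\<^sub>2 = []"
  using same_time[of v\<^sub>1 v\<^sub>2 v "[]"] pa pb by force

lemma prefix_a: "\<exists>w. v = a @ w \<and> path a (length a) w (length a)"
  using up_complete[OF va adj pa hd_v v_nonempty] by blast

lemma prefix_b: "\<exists>w. v = b @ w \<and> path b (length b) w (length b)"
  using common_bound.prefix_a[OF commute] .

lemma suffix_a: "\<exists>w. v = w @ a"
  using common_bound.prefix_a[OF dual] by (metis dual_append dual_dual)

lemma suffix_b: "\<exists>w. v = w @ b"
  using common_bound.suffix_a[OF commute] .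

text \<open>At the right end the walk loops until the next \<open>Beta\<close>, which exists because
  \<open>v\<close> ends with one. The waiting time is positive because the letter just read was
  \<open>Beta\<close> as well.\<close>

lemma after_end:
  assumes "v = u @ w" "u \<noteq> []" "last u = Beta" "path b (length b) w (length b)" "w \<noteq> []"
  shows "\<exists>g w'. w = g @ rev b @ w' \<and> g \<noteq> [] \<and> Beta \<notin> set g \<and> path b 0 w' (length b)"
proof -
  define g where "g = takeWhile (\<lambda>c. c \<noteq> Beta) w"
  define z where "z = dropWhile (\<lambda>c. c \<noteq> Beta) w"
  have w: "w = g @ z" by (simp add: g_def z_def)
  have Bg: "Beta \<notin> set g" unfolding g_def by (metis set_takeWhileD)
  have z: "z \<noteq> []"
  proof
    assume "z = []"
    then have "last v \<in> set g" using assms(1,5) w by simp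
    then show False using Bg last_v by simp
  qed
  have hz: "hd z = Beta" using z unfolding z_def by (metis (mono_tags, lifting) hd_dropWhile)
  have "g \<noteq> []"
  proof
    assume "g = []"
    then have "v = u @ z" "hd z = Beta" using w hz assms(1) by simp_all
    then show False using adj assms(2,3) z by (auto simp: distinct_adj_append_iff)
  qed
  moreover have "path b (length b) z (length b)" using path_end_loops[OF vb _ Bg] assms(4) w by blast
  then obtain w' where "z = rev b @ w'" "path b 0 w' (length b)"
    using down_complete[OF vb _ _ hz z] adj assms(1) w by (auto simp: distinct_adj_append_iff)
  ultimately show ?thesis using w Bg by blast
qed

text \<open>A walk cannot turn inside \<open>b\<close>. What follows the first passage is therefore
  a complete descent, and then a complete ascent because \<open>v\<close> has to stop at the right
  end.\<close>

lemma decomposition: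
  assumes "v \<noteq> b"
  shows "\<exists>g\<^sub>1 g\<^sub>2 w. v = b @ g\<^sub>1 @ rev b @ g\<^sub>2 @ b @ w \<and> g\<^sub>1 \<noteq> [] \<and> g\<^sub>2 \<noteq> [] \<and> Beta \<notin> set g\<^sub>1 \<and> Alpha \<notin> set g\<^sub>2 \<and>
    path b 0 (b @ g\<^sub>1) (length b) \<and> path b 0 (b @ g\<^sub>1 @ rev b) 0 \<and> path b 0 (b @ w) (length b)"
proof -
  note d = validD[OF vb]
  obtain w where w: "v = b @ w" "path b (length b) w (length b)" using prefix_b by blast
  then obtain g\<^sub>1 z where g\<^sub>1: "w = g\<^sub>1 @ rev b @ z" "g\<^sub>1 \<noteq> []" "Beta \<notin> set g\<^sub>1" "path b 0 z (length b)"
    using after_end[OF w(1) d(1,4) w(2)] assms by auto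
  define g\<^sub>2 where "g\<^sub>2 = takeWhile (\<lambda>c. c \<noteq> Alpha) z"
  define y where "y = dropWhile (\<lambda>c. c \<noteq> Alpha) z"
  have z: "z = g\<^sub>2 @ y" by (simp add: g\<^sub>2_def y_def)
  have Ag: "Alpha \<notin> set g\<^sub>2" unfolding g\<^sub>2_def by (metis set_takeWhileD)
  have py: "path b 0 y (length b)" using path_start_loops[OF vb _ Ag] g\<^sub>1(4) z by blast
  then have y: "y \<noteq> []" using d(7) by auto
  have hy: "hd y = Alpha" using y unfolding y_def by (metis (mono_tags, lifting) hd_dropWhile)
  have dv: "distinct_adj (b @ g\<^sub>1 @ rev b @ g\<^sub>2 @ y)" using adj w g\<^sub>1 z by simp
  then obtain w' where w': "y = b @ w'"
    using up_complete[OF vb _ py hy y] by (auto simp: distinct_adj_append_iff)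
  have "g\<^sub>2 \<noteq> []" using dv hy y d by (auto simp: distinct_adj_append_iff last_rev)
  have pb0: "path b 0 b (length b)" using path_take[of "length b" b] by simp
  have pg:  "path b (length b) g\<^sub>1 (length b)"
  proof -
    obtain r where r: "path b (length b) g\<^sub>1 r" using w g\<^sub>1 path_append by blast
    then have "path b (length b) [] r" using path_end_loops[OF vb _ g\<^sub>1(3), of "[]" r] by simp
    then show ?thesis using r by simp
  qed
  have pr: "path b (length b) (rev b) 0" using pb0 path_rev by blast
  have "path b 0 (b @ g\<^sub>1) (length b)" "path b 0 (b @ g\<^sub>1 @ rev b) 0"
    using pb0 pg pr unfolding path_append by blast+
  moreover have "path b 0 (b @ w') (length b)" using py w' by simp
  moreover have "v = b @ g\<^sub>1 @ rev b @ g\<^sub>2 @ b @ w'" using w g\<^sub>1 z w' by simp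
  ultimately show ?thesis using g\<^sub>1(2,3) Ag \<open>g\<^sub>2 \<noteq> []\<close> by blast
qed

text \<open>During a gap the state in \<open>b\<close> stands still, so the state in
  \<open>a\<close> must not repeat.\<close>

lemma gap_simple:
  assumes "v = w\<^sub>1 @ g @ w\<^sub>2" "path a 0 w\<^sub>1 s" "path b 0 w\<^sub>1 (length b)" "Beta \<notin> set g"
  shows "simple_walk a s g"
  unfolding simple_walk_def
proof (intro allI impI)
  fix h\<^sub>1 h\<^sub>2 h\<^sub>3 r assume h: "g = h\<^sub>1 @ h\<^sub>2 @ h\<^sub>3" "path a s h\<^sub>1 r" "path a r h\<^sub>2 r"
  have loop: "path b (length b) h (length b)" if "Beta \<notin> set h" for h
    using that by (induction h) (auto simp: edge_def)
  have "path b 0 (w\<^sub>1 @ h\<^sub>1) (length b)" "path b (length b) h\<^sub>2 (length b)"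
    using assms(3,4) h(1) loop unfolding path_append by auto
  moreover have "path a 0 (w\<^sub>1 @ h\<^sub>1) r" using assms(2) h(2) path_append by blast
  moreover have "v = (w\<^sub>1 @ h\<^sub>1) @ h\<^sub>2 @ h\<^sub>3 @ w\<^sub>2" using assms(1) h(1) by simp
  ultimately show "h\<^sub>2 = []" using simple h(3) by blast
qed

end

locale longer_common_bound = common_bound +
  assumes shorter: "length a < length b"
begin

lemma dual_longer: "longer_common_bound (dual a) (dual b) (dual v)"
  using dual shorter by (simp add: longer_common_bound_def longer_common_bound_axioms_def)

lemma proper_suffix: "\<exists>b\<^sub>0. b = b\<^sub>0 @ a \<and> b\<^sub>0 \<noteq> []"
proof -
  obtain w w' where "v = w @ a" "v = w' @ b" using suffix_a suffix_b by blast
  then have "w @ a = w' @ b" by simp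
  then show ?thesis using shorter by (cases rule: suffix_cases) auto
qed

text \<open>Before the gap \<open>v\<close> has read \<open>b\<close>, so the reversed
  \<open>b\<close> can be read from \<open>s\<^sub>1\<close>; after it \<open>v\<close> reads the
  reversed \<open>b\<close> from \<open>s\<^sub>2\<close>. The walk in \<open>a\<close> across the
  gap is monotone, and \<open>mark\<close> applies to its two ends taken in ascending order.\<close>

lemma r_gap:
  assumes v: "v = w\<^sub>1 @ b @ g @ rev b @ w\<^sub>2" and g: "g \<noteq> []" "Beta \<notin> set g"
    and b: "path b 0 (w\<^sub>1 @ b) (length b)"
    and a: "path a 0 (w\<^sub>1 @ b) s\<^sub>1" "path a s\<^sub>1 g s\<^sub>2"
  shows "\<exists>x m y n p. border_pair a x m y n p \<and> (x \<noteq> [] \<longrightarrow> rev n = n) \<and> (m = g \<or> m = rev g) \<and>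
    {s\<^sub>1, s\<^sub>2} = {length x, length (x @ m)}"
proof -
  note d = validD[OF vb]
  have v': "v = (w\<^sub>1 @ b) @ g @ (rev b @ w\<^sub>2)" using v by simp
  have ab: "path a 0 (w\<^sub>1 @ b @ g) s\<^sub>2" using a path_append by (metis append.assoc)
  have bb: "path b 0 (w\<^sub>1 @ b @ g) (length b)"
  proof -
    obtain r where r: "path b 0 (w\<^sub>1 @ b) (length b)" "path b (length b) g r"
      using pb v' b path_append path_det[OF vb] by metis
    then have "path b (length b) [] r" using path_end_loops[OF vb _ g(2), of "[]" r] by simp
    then show ?thesis using r path_append by (metis append.assoc path.simps(1))
  qed
  \<comment> \<open>At both moments \<open>b\<close> is at its right end; \<open>a\<close> can be at
    its right end too only when \<open>v\<close> stops.\<close>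
  have ne: "s\<^sub>1 \<noteq> length a" "s\<^sub>2 \<noteq> length a"
    using end_only[of "w\<^sub>1 @ b"] end_only[of "w\<^sub>1 @ b @ g"] a(1) b ab bb v d(1) by auto
  have walk\<^sub>1: "\<exists>z. path a s\<^sub>1 (rev b) z"
    using a(1) path_rev[of a s\<^sub>1 "w\<^sub>1 @ b" 0] by (metis path_append rev_append)
  have walk\<^sub>2: "\<exists>z. path a s\<^sub>2 (rev b) z"
  proof -
    have "path a 0 ((w\<^sub>1 @ b @ g) @ rev b @ w\<^sub>2) (length a)" using pa v by simp
    then show ?thesis using path_det[OF va ab] path_append by metis
  qed
  obtain b\<^sub>0 where b\<^sub>0: "b = b\<^sub>0 @ a" "b\<^sub>0 \<noteq> []" using proper_suffix by blast
  have mono: "(\<exists>x y. a = x @ g @ y \<and> s\<^sub>1 = length x \<and> s\<^sub>2 = length (x @ g)) \<or>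
    (\<exists>x y. a = x @ rev g @ y \<and> s\<^sub>2 = length x \<and> s\<^sub>1 = length (x @ g))"
    using simple_walk_monotone[OF a(2) gap_simple[OF v' a(1) b g(2)] g(1)] .
  have "\<exists>x m y. a = x @ m @ y \<and> (m = g \<or> m = rev g) \<and> {s\<^sub>1, s\<^sub>2} = {length x, length (x @ m)}"
    using mono
  proof (elim disjE exE)
    fix x y assume "a = x @ g @ y \<and> s\<^sub>1 = length x \<and> s\<^sub>2 = length (x @ g)"
    then show ?thesis by (intro exI[of _ x] exI[of _ g] exI[of _ y]) simp
  next
    fix x y assume "a = x @ rev g @ y \<and> s\<^sub>2 = length x \<and> s\<^sub>1 = length (x @ g)"
    then show ?thesis by (intro exI[of _ x] exI[of _ "rev g"] exI[of _ y]) (simp add: insert_commute)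
  qed
  then obtain x m y where s: "a = x @ m @ y" "m = g \<or> m = rev g" "{s\<^sub>1, s\<^sub>2} = {length x, length (x @ m)}"
    by blast
  have y: "y \<noteq> []" using ne s(1,3) by (auto simp: doubleton_eq_iff)
  have m: "Beta \<notin> set m" "m \<noteq> []" using g s(2) by auto
  obtain z\<^sub>1 z\<^sub>2 where "path a (length x) (rev b) z\<^sub>1" "path a (length (x @ m)) (rev b) z\<^sub>2"
    using walk\<^sub>1 walk\<^sub>2 s(3) by (metis doubleton_eq_iff)
  then have "\<exists>p n. border_pair a x m y n p \<and> (x \<noteq> [] \<longrightarrow> rev n = n)"
    using mark[OF va d(2,3) b\<^sub>0 s(1) m y] by blast
  then show ?thesis using s(2,3) by blast
qed

text \<open>In the dual the left end of \<open>b\<close> becomes the right end, and the gap is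
  crossed in the opposite direction.\<close>

lemma inf_gap:
  assumes v: "v = w\<^sub>1 @ rev b @ g @ b @ w\<^sub>2" and g: "g \<noteq> []" "Alpha \<notin> set g"
    and b: "path b 0 (b @ w\<^sub>2) (length b)"
    and a: "path a 0 (w\<^sub>1 @ rev b) s\<^sub>1" "path a s\<^sub>1 g s\<^sub>2"
  shows "\<exists>x m y n p. border_pair a x m y n p \<and> (x \<noteq> [] \<longrightarrow> rev m = m) \<and>
    {s\<^sub>1, s\<^sub>2} = {length p, length (p @ n)}"
proof -
  let ?l = "length a"
  interpret D: longer_common_bound "dual a" "dual b" "dual v" by (rule dual_longer)
  have le: "s\<^sub>1 \<le> ?l" "s\<^sub>2 \<le> ?l" using path_le[OF a(1)] path_le[OF a(2)] by auto
  have 1: "dual v = dual w\<^sub>2 @ dual b @ dual g @ rev (dual b) @ dual w\<^sub>1"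
    using v by (simp add: dual_rev)
  have 2: "path (dual b) 0 (dual w\<^sub>2 @ dual b) (length (dual b))"
    using path_dual_rev[OF b] by simp
  have "path a 0 ((w\<^sub>1 @ rev b) @ g @ b @ w\<^sub>2) ?l" using pa v by simp
  then have "path a s\<^sub>2 (b @ w\<^sub>2) ?l" using a path_det[OF va] path_append by metis
  then have "path (dual a) (?l - s\<^sub>2) (map swap (b @ w\<^sub>2)) (?l - ?l)" by (rule path_dual)
  then have 3: "path (dual a) 0 (dual w\<^sub>2 @ dual b) (?l - s\<^sub>2)"
    using path_rev[of "dual a" 0 "map swap (b @ w\<^sub>2)" "?l - s\<^sub>2"] by (simp add: dual_def rev_map)
  have 4: "path (dual a) (?l - s\<^sub>2) (dual g) (?l - s\<^sub>1)"
    using path_dual[OF a(2)] path_rev[of "dual a" "?l - s\<^sub>2" "map swap g"] by (simp add: dual_def rev_map)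
  obtain x m y n p where *: "border_pair (dual a) x m y n p" "x \<noteq> [] \<longrightarrow> rev n = n"
    "{?l - s\<^sub>2, ?l - s\<^sub>1} = {length x, length (x @ m)}"
    using D.r_gap[OF 1 _ _ 2 3 4] g by (metis Beta_in_dual dual_eq_Nil_iff)
  have border_pair: "border_pair a (dual x) (dual n) (dual p) (dual m) (dual y)"
    using border_pair_dual[OF _ *(1)] va by simp
  have "dual a = x @ m @ y" using *(1) by (simp add: border_pair_def)
  then have l: "?l = length x + length m + length y" by (metis length_append length_dual add.assoc)
  have "{s\<^sub>1, s\<^sub>2} = {length (dual y), length (dual y @ dual m)}"
    using *(3) l le by (auto simp: doubleton_eq_iff)
  moreover have "dual x \<noteq> [] \<longrightarrow> rev (dual n) = dual n" using *(2) by (metis dual_eq_Nil_iff dual_rev)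
  ultimately show ?thesis using border_pair by blast
qed

text \<open>\<open>Gamma\<close> loops in both graphs, so it is read neither just before nor just
  after this moment. One of the two letters is then \<open>Beta\<close>: either \<open>b\<close> has
  just arrived and a gap begins, or \<open>b\<close> is about to leave and a gap ends. State 0 of
  \<open>a\<close> is an end of that gap, so the border of its factorization is empty.\<close>

lemma opposite_start_end:
  assumes v: "v = v\<^sub>1 @ v\<^sub>2" and a: "path a 0 v\<^sub>1 0" and b: "path b 0 v\<^sub>1 (length b)"
  shows "v\<^sub>1 \<noteq> [] \<and> v\<^sub>2 \<noteq> [] \<and> last v\<^sub>1 \<noteq> Gamma \<and> hd v\<^sub>2 \<noteq> Gamma \<and> last v\<^sub>1 \<noteq> hd v\<^sub>2 \<and> (\<exists>m y n p. border_pair a [] m y n p)"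
proof -
  note d = validD[OF vb] and da = validD[OF va]
  have ne: "v\<^sub>1 \<noteq> []" using b d(7) by auto
  have "path a 0 v\<^sub>2 (length a)" using pa v a path_append path_det[OF va] by metis
  then have ne2: "v\<^sub>2 \<noteq> []" using da(7) by auto
  have pb2: "path b (length b) v\<^sub>2 (length b)" using pb v b path_append path_det[OF vb] by metis
  have G: "path a 0 [Gamma] 0" "path b (length b) [Gamma] (length b)" by (auto simp: edge_def)
  have h: "hd v\<^sub>2 \<noteq> Gamma"
  proof
    assume "hd v\<^sub>2 = Gamma"
    then have "v = v\<^sub>1 @ [Gamma] @ tl v\<^sub>2" using v ne2 by (metis append_Cons append_Nil list.collapse)
    then show False using simple a b G by blast
  qed
  have l: "last v\<^sub>1 \<noteq> Gamma"
  proof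
    assume l: "last v\<^sub>1 = Gamma"
    then have e: "v\<^sub>1 = butlast v\<^sub>1 @ [Gamma]" using ne by (metis append_butlast_last_id)
    obtain s t where st: "path a 0 (butlast v\<^sub>1) s" "path a s [Gamma] 0"
      "path b 0 (butlast v\<^sub>1) t" "path b t [Gamma] (length b)"
      using a b e path_append by metis
    have "s = 0" using st(2) G(1) edge_sym edge_det[OF va] by (metis path.simps)
    moreover have "t = length b" using st(4) G(2) edge_sym edge_det[OF vb] by (metis path.simps)
    moreover have "v = butlast v\<^sub>1 @ [Gamma] @ v\<^sub>2" using e v by (metis append.assoc)
    ultimately show False using simple st by blast
  qed
  have lh: "last v\<^sub>1 \<noteq> hd v\<^sub>2" using adj v ne ne2 by (auto simp: distinct_adj_append_iff)
  have r: "path b (length b) (rev v\<^sub>1) 0" using b path_rev by blast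
  have dr: "distinct_adj (rev v\<^sub>1)" "distinct_adj v\<^sub>2" using adj v by (auto simp: distinct_adj_append_iff)
  have "\<exists>m y n p. border_pair a [] m y n p"
  proof (cases "hd v\<^sub>2 = Beta")
    case False
    then have "last v\<^sub>1 = Beta" using h l lh by (metis colour.exhaust)
    then have "hd (rev v\<^sub>1) = Beta" by (simp add: hd_rev ne)
    then obtain w where w: "rev v\<^sub>1 = rev b @ w"
      using down_complete[OF vb dr(1) r] ne by auto
    then have v\<^sub>1: "v\<^sub>1 = rev w @ b" by (metis rev_append rev_rev_ident)
    obtain g w' where g: "v\<^sub>2 = g @ rev b @ w'" "g \<noteq> []" "Beta \<notin> set g"
      using after_end[OF v ne \<open>last v\<^sub>1 = Beta\<close> pb2 ne2] by blast
    obtain s where "path a 0 g s" using \<open>path a 0 v\<^sub>2 (length a)\<close> g(1) path_append by blast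
    from r_gap[OF _ g(2,3) _ _ this] v v\<^sub>1 g(1) a b
    obtain x m y n p where *: "border_pair a x m y n p" "m = g \<or> m = rev g" "{0, s} = {length x, length (x @ m)}"
      by (metis append.assoc)
    have "m \<noteq> []" using * g(2) by auto
    then have "x = []" using *(3) by (auto simp: doubleton_eq_iff)
    then show ?thesis using * by blast
  next
    case True
    then obtain w where w: "v\<^sub>2 = rev b @ w" using down_complete[OF vb dr(2) pb2] ne2 by auto
    define g where "g = takeWhile (\<lambda>c. c \<noteq> Beta) (rev v\<^sub>1)"
    define z where "z = dropWhile (\<lambda>c. c \<noteq> Beta) (rev v\<^sub>1)"
    have gz: "rev v\<^sub>1 = g @ z" by (simp add: g_def z_def)
    have Bg: "Beta \<notin> set g" unfolding g_def by (metis set_takeWhileD)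
    have pz: "path b (length b) z 0" using path_end_loops[OF vb _ Bg] r gz by metis
    then have z: "z \<noteq> []" using d(7) by auto
    have hz: "hd z = Beta" using z unfolding z_def by (metis (mono_tags, lifting) hd_dropWhile)
    have "hd (rev v\<^sub>1) \<noteq> Beta" using True lh ne by (simp add: hd_rev)
    then have gne: "g \<noteq> []" using gz hz by auto
    have "distinct_adj z" using dr(1) gz by (auto simp: distinct_adj_append_iff)
    then obtain w' where "z = rev b @ w'" using down_complete[OF vb _ pz hz z] by blast
    then have v\<^sub>1: "v\<^sub>1 = rev w' @ b @ rev g" using gz by (metis append.assoc rev_append rev_rev_ident)
    obtain s where s: "path a 0 (rev w' @ b) s" "path a s (rev g) 0"
      using a v\<^sub>1 path_append by (metis append.assoc)
    have "path b 0 (rev w' @ b) (length b)"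
    proof -
      obtain t where t: "path b 0 (rev w' @ b) t" "path b t (rev g) (length b)"
        using b v\<^sub>1 path_append by (metis append.assoc)
      then have "path b (length b) (g @ []) t" using path_rev by simp
      then have "t = length b" using path_end_loops[OF vb _ Bg] by fastforce
      then show ?thesis using t by simp
    qed
    from r_gap[OF _ _ _ this s] v v\<^sub>1 w gne Bg
    obtain x m y n p where *: "border_pair a x m y n p" "m = rev g \<or> m = g" "{s, 0} = {length x, length (x @ m)}"
      by (metis append.assoc rev_is_Nil_conv rev_rev_ident set_rev)
    have "m \<noteq> []" using * gne by auto
    then have "x = []" using *(3) by (auto simp: doubleton_eq_iff)
    then show ?thesis using * by blast
  qed
  then show ?thesis using ne ne2 h l lh by blast
qed

lemma opposite_end_start:
  assumes v: "v = v\<^sub>1 @ v\<^sub>2" and a: "path a 0 v\<^sub>1 (length a)" and b: "path b 0 v\<^sub>1 0"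
  shows "v\<^sub>1 \<noteq> [] \<and> v\<^sub>2 \<noteq> [] \<and> last v\<^sub>1 \<noteq> Gamma \<and> hd v\<^sub>2 \<noteq> Gamma \<and> last v\<^sub>1 \<noteq> hd v\<^sub>2 \<and> (\<exists>m y n p. border_pair a [] m y n p)"
proof -
  interpret D: longer_common_bound "dual a" "dual b" "dual v" by (rule dual_longer)
  have "path a (length a) v\<^sub>2 (length a)" using pa v a path_append path_det[OF va] by metis
  then have 1: "path (dual a) 0 (dual v\<^sub>2) 0"
    using path_dual[of a "length a" v\<^sub>2 "length a"] path_rev[of "dual a" 0 "map swap v\<^sub>2" 0]
    by (simp add: dual_def rev_map)
  have "path b 0 v\<^sub>2 (length b)" using pb v b path_append path_det[OF vb] by metis
  then have 2: "path (dual b) 0 (dual v\<^sub>2) (length (dual b))" by (rule path_dual_rev)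
  have 3: "dual v = dual v\<^sub>2 @ dual v\<^sub>1" using v by simp
  note * = D.opposite_start_end[OF 3 1 2]
  have "hd (dual v\<^sub>1) = swap (last v\<^sub>1)" "last (dual v\<^sub>2) = swap (hd v\<^sub>2)"
    using * by (auto simp: dual_def hd_map hd_rev last_map last_rev)
  moreover have "swap c = Gamma \<longleftrightarrow> c = Gamma" for c by (cases c) auto
  moreover obtain m y n p where "border_pair (dual a) [] m y n p" using * by blast
  then have "border_pair a [] (dual n) (dual p) (dual m) (dual y)" using border_pair_dual[of "dual a" "[]"] va by fastforce
  ultimately show ?thesis using * by (metis dual_eq_Nil_iff)
qed

end

section \<open>Walks along a bouncing word\<close>

lemma bounce_path:
  assumes "a \<noteq> []" "Beta \<notin> set m" "Alpha \<notin> set n" "seg (bounce a m n) i w"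
  shows "path a (bounce_state a m n i) w (bounce_state a m n (i + int (length w)))"
  using assms(4)
proof (induction w arbitrary: i)
  case (Cons c w)
  have "c = bounce a m n i" using segD[OF Cons.prems, of 0] by simp
  moreover have "seg (bounce a m n) (i + 1) w"
    using Cons.prems seg_append[of _ i "[c]" w] by simp
  ultimately show ?case
    using Cons.IH[of "i + 1"] bounce_state_step[OF assms(1-3), of i] by (auto simp: algebra_simps)
qed simp

lemma bounce_seg_parts:
  "seg (bounce a m n) 0 a" "seg (bounce a m n) (int (length a)) m"
  "seg (bounce a m n) (int (length a + length m)) (rev a)"
  "seg (bounce a m n) (int (2 * length a + length m)) n"
  using seg_bounce[of a m n] by (simp_all add: seg_append algebra_simps)

text \<open>As \<open>m\<close> avoids \<open>Beta\<close>, a preceding \<open>Beta\<close>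
  distinguishes the arrival at the right end from waiting there.\<close>

lemma bounce_at_end:
  assumes "a \<noteq> []" "Beta \<notin> set m" "bounce_state a m n i = length a" "bounce a m n (i - 1) = Beta"
  shows "i mod bounce_period a m n = int (length a)"
proof -
  let ?p = "bounce_period a m n" and ?k = "nat (i mod bounce_period a m n)"
  have la: "0 < length a" using assms(1) by simp
  have p: "0 < ?p" using bounce_period_pos[OF assms(1)] .
  then have k: "int ?k = i mod ?p" by simp
  have s: "length a \<le> ?k" "?k \<le> length a + length m"
    using assms(3) la by (auto simp: bounce_state_def Let_def split: if_splits)
  have "?k = length a"
  proof (rule ccontr)
    assume "?k \<noteq> length a"
    then have j: "?k - 1 - length a < length m" "length a + (?k - 1 - length a) + 1 = ?k" using s by auto
    have "bounce a m n (i - 1) = bounce a m n ((i - 1) mod ?p)" using period_mod[OF period_bounce] by metis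
    also have "(i - 1) mod ?p = (int ?k - 1) mod ?p" unfolding k by (simp add: mod_diff_left_eq)
    also have "bounce a m n \<dots> = bounce a m n (int ?k - 1)" using period_mod[OF period_bounce] by metis
    also have "int ?k - 1 = int (length a) + int (?k - 1 - length a)" using j(2) by linarith
    also have "bounce a m n \<dots> = m ! (?k - 1 - length a)" by (rule segD[OF bounce_seg_parts(2) j(1)])
    finally show False using assms(2,4) j(1) by (metis nth_mem)
  qed
  then show ?thesis using k by simp
qed

lemma bounce_at_start:
  assumes "a \<noteq> []" "Alpha \<notin> set n" "n \<noteq> []" "bounce_state a m n i = 0" "bounce a m n (i - 1) = Alpha"
  shows "i mod bounce_period a m n = int (2 * length a + length m)"
proof -
  let ?p = "bounce_period a m n" and ?k = "nat (i mod bounce_period a m n)"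
  have la: "0 < length a" using assms(1) by simp
  have p: "0 < ?p" using bounce_period_pos[OF assms(1)] .
  then have k: "int ?k = i mod ?p" "int ?k < ?p" by simp_all
  have *: "bounce a m n (i - 1) = bounce a m n (int ?k - 1)"
  proof -
    have "bounce a m n (i - 1) = bounce a m n ((i - 1) mod ?p)" using period_mod[OF period_bounce] by metis
    also have "(i - 1) mod ?p = (int ?k - 1) mod ?p" unfolding k(1) by (simp add: mod_diff_left_eq)
    also have "bounce a m n \<dots> = bounce a m n (int ?k - 1)" using period_mod[OF period_bounce] by metis
    finally show ?thesis .
  qed
  have s: "?k = 0 \<or> 2 * length a + length m \<le> ?k"
    using assms(4) la by (auto simp: bounce_state_def Let_def split: if_splits)
  have "?k = 2 * length a + length m"
  proof (rule ccontr)
    assume ne: "?k \<noteq> 2 * length a + length m"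
    \<comment> \<open>For \<open>?k = 0\<close> the preceding letter is the last letter of
      \<open>n\<close> in the round before.\<close>
    define j where "j = (if ?k = 0 then length n - 1 else ?k - 1 - (2 * length a + length m))"
    have j: "j < length n"
      using s ne k(2) assms(3) by (auto simp: j_def bounce_period_def)
    have "bounce a m n (int ?k - 1) = bounce a m n (int (2 * length a + length m) + int j)"
    proof (cases "?k = 0")
      case True
      have "int (length n - 1) = int (length n) - 1" using assms(3) by (simp add: of_nat_diff Suc_le_eq)
      then have "int (2 * length a + length m) + int j = int ?k - 1 + ?p"
        using True by (simp add: j_def bounce_period_def)
      then show ?thesis using periodD[OF period_bounce, of a m n "int ?k - 1"] by metis
    next
      case False
      then have "int (2 * length a + length m) + int j = int ?k - 1"
        using s ne by (simp add: j_def of_nat_diff)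
      then show ?thesis by metis
    qed
    also have "\<dots> = n ! j" by (rule segD[OF bounce_seg_parts(4) j])
    finally show False using assms(2,5) * j by (metis nth_mem)
  qed
  then show ?thesis using k by simp
qed

lemma bounce_after_end:
  assumes "a \<noteq> []" "Beta \<notin> set m" "m \<noteq> []" "bounce_state a m n i = length a" "bounce a m n (i - 1) = Beta"
  shows "bounce a m n i = hd m"
proof -
  have "bounce a m n i = bounce a m n (int (length a) + int 0)"
    using bounce_at_end[OF assms(1,2,4,5)] period_mod[OF period_bounce] by (metis add.right_neutral of_nat_0)
  also have "\<dots> = m ! 0" by (rule segD[OF bounce_seg_parts(2)]) (use assms(3) in simp)
  finally show ?thesis using assms(3) by (simp add: hd_conv_nth)
qed

lemma bounce_after_start:
  assumes "a \<noteq> []" "Alpha \<notin> set n" "n \<noteq> []" "bounce_state a m n i = 0" "bounce a m n (i - 1) = Alpha"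
  shows "bounce a m n i = hd n"
proof -
  have "bounce a m n i = bounce a m n (int (2 * length a + length m) + int 0)"
    using bounce_at_start[OF assms] period_mod[OF period_bounce] by (metis add.right_neutral of_nat_0)
  also have "\<dots> = n ! 0" by (rule segD[OF bounce_seg_parts(4)]) (use assms(3) in simp)
  finally show ?thesis using assms(3) by (simp add: hd_conv_nth)
qed

lemma torus_hd:
  assumes "valid a" "border_pair a [] m' y' n' p'" "last (takeWhile (\<lambda>c. c \<noteq> Beta) a) = Alpha" "border_pair a x m y n p"
  shows "hd m = Alpha \<and> hd n = Beta"
proof -
  have *: "a = m' @ y'" "Beta \<notin> set m'" "y' \<noteq> []" "hd y' = Beta" "m' \<noteq> []"
    using assms(2) by (auto simp: border_pair_def)
  then have "takeWhile (\<lambda>c. c \<noteq> Beta) a = m'" by (cases y') (auto simp: takeWhile_append)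
  then have l: "last m' = Alpha" using assms(3) by simp
  from torus_border_pair[OF assms(1,2) l assms(4)] have "m = m'" "n = n'" "rev m' = m'" "hd n' = Beta" by auto
  then show ?thesis using l *(5) by (metis hd_rev)
qed

context longer_common_bound
begin

text \<open>The initial factors \<open>b\<close>, \<open>rev b\<close> and \<open>b\<close> of
  \<open>v\<close> supply three moments at which \<open>b\<close> is in state \<open>d\<close>.
  Equal states of \<open>a\<close> at two of them would repeat a pair. The reader starting from
  \<open>s\<^sub>1\<close> runs through the middle factor backwards.\<close>

lemma three_times:
  assumes v: "v = b @ g\<^sub>1 @ rev b @ g\<^sub>2 @ b @ w" and b: "path b 0 (b @ g\<^sub>1) (length b)"
    and g: "Alpha \<notin> set g\<^sub>2" and a: "path a 0 (b @ g\<^sub>1 @ rev b) s\<^sub>1" "path a s\<^sub>1 g\<^sub>2 s\<^sub>2"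
    and d: "0 < d" "d < length b"
  shows "path a 0 (take d b) r \<Longrightarrow> \<not> path a s\<^sub>1 (take d b) r"
    and "path a 0 (take d b) r \<Longrightarrow> \<not> path a s\<^sub>2 (take d b) r"
    and "path a s\<^sub>1 (take d b) r \<Longrightarrow> \<not> path a s\<^sub>2 (take d b) r"
proof -
  let ?T0 = "take d b" and ?T1 = "b @ g\<^sub>1 @ rev (drop d b)" and ?T2 = "b @ g\<^sub>1 @ rev b @ g\<^sub>2 @ take d b"
  have dl: "d \<le> length b" using d(2) by simp
  have rb: "rev b = rev (drop d b) @ rev (take d b)" by (metis append_take_drop_id rev_append)
  have B0: "path b 0 ?T0 d" using path_take[OF dl] .
  have "path b 0 b (length b)" using path_take[of "length b" b] by simp
  then have bb: "path b (length b) (rev b) 0" using path_rev by blast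
  then obtain t where t: "path b (length b) (rev (drop d b)) t" "path b t (rev (take d b)) 0"
    unfolding rb path_append by blast
  have "t = d" using path_det[OF vb _ B0] t(2) path_rev by metis
  then have B1: "path b 0 ?T1 d" using b t(1) unfolding path_append by blast
  have "path b 0 g\<^sub>2 0"
    using g by (induction g\<^sub>2) (auto simp: edge_def)
  then have B2: "path b 0 ?T2 d" using b bb B0 unfolding path_append by blast
  have V0: "v = ?T0 @ drop d b @ g\<^sub>1 @ rev b @ g\<^sub>2 @ b @ w" using v by (metis append.assoc append_take_drop_id)
  have V1: "v = ?T1 @ rev (take d b) @ g\<^sub>2 @ b @ w" using v rb by simp
  have V2: "v = ?T2 @ drop d b @ w" using v by simp
  have A1: "path a 0 ?T1 r" if "path a s\<^sub>1 (take d b) r" for r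
  proof -
    obtain r' where r': "path a 0 ?T1 r'" "path a r' (rev (take d b)) s\<^sub>1"
      using a(1) unfolding rb path_append by blast
    then have "path a s\<^sub>1 (take d b) r'" using path_rev by blast
    then show ?thesis using path_det[OF va that] r'(1) by blast
  qed
  have A2: "path a 0 ?T2 r" if "path a s\<^sub>2 (take d b) r" for r
    using a that unfolding path_append by blast
  have l: "length ?T0 \<noteq> length ?T1" "length ?T0 \<noteq> length ?T2" "length ?T1 \<noteq> length ?T2"
    using d by auto
  show "path a 0 (take d b) r \<Longrightarrow> \<not> path a s\<^sub>1 (take d b) r"
    using same_time[OF V0 V1 _ A1 B0 B1] l(1) by metis
  show "path a 0 (take d b) r \<Longrightarrow> \<not> path a s\<^sub>2 (take d b) r"
    using same_time[OF V0 V2 _ A2 B0 B2] l(2) by metis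
  show "path a s\<^sub>1 (take d b) r \<Longrightarrow> \<not> path a s\<^sub>2 (take d b) r"
    using same_time[OF V1 V2 A1 A2 B1 B2] l(3) by metis
qed

text \<open>The right gap and the left gap may mark different factorizations, but by
  \<open>border_pair_run_unique\<close> they have the same runs. One bouncing word can therefore
  guide all three readers.\<close>

lemma bounce_prefix:
  assumes "v \<noteq> b" "last (takeWhile (\<lambda>c. c \<noteq> Beta) a) = Alpha"
  shows "\<exists>x m y n p. border_pair a x m y n p \<and> rev m = m \<and> rev n = n \<and> seg (bounce a m n) 0 b"
proof -
  note da = validD[OF va] and d = validD[OF vb]
  obtain g\<^sub>1 g\<^sub>2 w where v: "v = b @ g\<^sub>1 @ rev b @ g\<^sub>2 @ b @ w" and g: "g\<^sub>1 \<noteq> []" "g\<^sub>2 \<noteq> []" "Beta \<notin> set g\<^sub>1" "Alpha \<notin> set g\<^sub>2"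
    and pb': "path b 0 (b @ g\<^sub>1) (length b)" "path b 0 (b @ g\<^sub>1 @ rev b) 0" "path b 0 (b @ w) (length b)"
    using decomposition[OF assms(1)] by blast
  obtain r\<^sub>1 r\<^sub>2 s\<^sub>1 s\<^sub>2 t where r: "path a 0 b r\<^sub>1" "path a r\<^sub>1 g\<^sub>1 r\<^sub>2" "path a r\<^sub>2 (rev b) s\<^sub>1" "path a s\<^sub>1 g\<^sub>2 s\<^sub>2"
    "path a s\<^sub>2 b t"
    using pa unfolding v path_append by blast
  have s\<^sub>1: "path a 0 (b @ g\<^sub>1 @ rev b) s\<^sub>1" using r unfolding path_append by blast
  have bb: "path b 0 ([] @ b) (length b)" using path_take[of "length b" b] by simp
  have v0: "v = [] @ b @ g\<^sub>1 @ rev b @ (g\<^sub>2 @ b @ w)" and r0: "path a 0 ([] @ b) r\<^sub>1" using v r(1) by simp_all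
  obtain x m y n p where R: "border_pair a x m y n p" "x \<noteq> [] \<Longrightarrow> rev n = n"
    using r_gap[OF v0 g(1,3) bb r0 r(2)] by blast
  have v1: "v = (b @ g\<^sub>1) @ rev b @ g\<^sub>2 @ b @ w" and s1: "path a 0 ((b @ g\<^sub>1) @ rev b) s\<^sub>1" using v s\<^sub>1 by simp_all
  obtain x' m' y' n' p' where I: "border_pair a x' m' y' n' p'" "x' \<noteq> [] \<Longrightarrow> rev m' = m'"
    "{s\<^sub>1, s\<^sub>2} = {length p', length (p' @ n')}"
    using inf_gap[OF v1 g(2,4) pb'(3) s1 r(4)] by blast
  have eq: "m = m'" "n = n'" "rev m = m" "rev n = n"
    using border_pair_run_unique[OF va assms(2) R(1) I(1) R(2) I(2)] by blast+
  note I = I[folded eq(1,2)]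
  let ?f = "bounce a m n"
  let ?\<pi> = "int (length (p' @ n))"
  have border_pair: "a = x' @ m @ y'" "a = p' @ n @ x'" "m \<noteq> []" "n \<noteq> []" "Beta \<notin> set m" "Alpha \<notin> set n"
    using I(1) by (auto simp: border_pair_def)
  have adj: "distinct_adj m" "distinct_adj n"
    using da(2) border_pair(1,2) by (metis distinct_adj_appendD1 distinct_adj_appendD2)+
  have per: "period ?f ?\<pi>" using period_bounce_border[OF I(1) eq(3,4)] .
  \<comment> \<open>The reflection about the centre of the palindrome \<open>p'\<close> with which
    \<open>a\<close> begins.\<close>
  have mir: "mirror ?f (int (length p') - 1)"
    using mirror_period[OF mirror_bounce[OF eq(3,4) da(1)] per] by simp
  note step = bounce_state_step[OF da(1) border_pair(5,6)]
  \<comment> \<open>The first guide follows the word, the second is its translate by the period, and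
    the third runs backwards from the end of \<open>p'\<close>. They start at state 0 and at the two
    ends of the left gap.\<close>
  define \<gamma> where "\<gamma> j i = (if j = 0 then bounce_state a m n (int i)
    else if j = 1 then bounce_state a m n (?\<pi> + int i) else bounce_state a m n (int (length p') - int i))" for j i :: nat
  have guide: "edge a (\<gamma> j i) (?f (int i)) (\<gamma> j (Suc i))" if "j < 3" for j i
  proof -
    have "j = 0 \<or> j = 1 \<or> j = 2" using that by linarith
    then consider "j = 0" | "j = 1" | "j = 2" by blast
    then show ?thesis
    proof cases
      case 1
      then show ?thesis using step[of "int i"] by (simp add: \<gamma>_def add.commute)
    next
      case 2
      have "?f (?\<pi> + int i) = ?f (int i)" using periodD[OF per, of "int i"] by (simp only: add.commute)
      moreover have "?\<pi> + int i + 1 = ?\<pi> + int (Suc i)" by simp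
      ultimately show ?thesis using step[of "?\<pi> + int i"] 2 by (metis \<gamma>_def zero_neq_one)
    next
      case 3
      have "?f (int (length p') - int (Suc i)) = ?f (int i)"
        using mirrorD[OF mir, of "int i"] by (simp add: algebra_simps)
      moreover have "int (length p') - int (Suc i) + 1 = int (length p') - int i" by simp
      moreover have "\<gamma> j k = bounce_state a m n (int (length p') - int k)" for k using 3 by (simp add: \<gamma>_def)
      ultimately show ?thesis using step[of "int (length p') - int (Suc i)"] edge_sym by metis
    qed
  qed
  have le: "length (p' @ n) \<le> length a" using arg_cong[OF border_pair(2), of length] by simp
  have \<gamma>0: "\<gamma> 0 0 = 0" "\<gamma> 1 0 = length (p' @ n)" "\<gamma> 2 0 = length p'"
    using bounce_state_start[OF _ _ da(1), of 0 m n] bounce_state_start[OF _ _ da(1), of ?\<pi> m n]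
      bounce_state_start[OF _ _ da(1), of "int (length p')" m n] le by (simp_all add: \<gamma>_def)
  have s12: "(\<gamma> 1 0 = s\<^sub>1 \<and> \<gamma> 2 0 = s\<^sub>2) \<or> (\<gamma> 1 0 = s\<^sub>2 \<and> \<gamma> 2 0 = s\<^sub>1)"
    using I(3) \<gamma>0 by (auto simp: doubleton_eq_iff)
  have walk: "\<exists>z. path a (\<gamma> j 0) b z" if "j < 3" for j
  proof -
    have "path a s\<^sub>1 b r\<^sub>2" using r(3) path_rev by blast
    moreover have "j = 0 \<or> j = 1 \<or> j = 2" using that by linarith
    ultimately show ?thesis using r(1,5) s12 \<gamma>0(1) by metis
  qed
  note T = three_times[OF v pb'(1) g(4) s\<^sub>1 r(4)]
  have dist: "\<not> path a (\<gamma> j 0) (take k b) z" if "i < 3" "j < 3" "i \<noteq> j" "0 < k" "k < length b" "path a (\<gamma> i 0) (take k b) z" for i j k z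
  proof -
    have "(i = 0 \<or> i = 1 \<or> i = 2) \<and> (j = 0 \<or> j = 1 \<or> j = 2)" using that by linarith
    then show ?thesis using T[OF that(4,5), of z] s12 \<gamma>0(1) that(3,6) by metis
  qed
  have hd: "b ! 0 = ?f 0" using segD[OF bounce_seg_parts(1), of 0 a m n] d(5) da(5,7) by simp
  have "seg ?f 0 b"
    by (rule three_walkers[OF va d(2,1) hd bounce_adjacent[OF va border_pair(5,6) adj border_pair(3,4)] walk guide dist])
  then show ?thesis using I(1) eq by blast
qed

end

text \<open>\<open>a\<close> occurs at 0 and, as the tail of \<open>b\<close>, at
  \<open>length b\<^sub>0\<close>. It is at least as long as the period \<open>|p n|\<close>, so
  this shift is a period. Shift and reflection then put all parts of a round through
  \<open>b\<close> into the bouncing word of \<open>a\<close>.\<close>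

lemma bounce_longer:
  assumes va: "valid a" and border_pair: "border_pair a x m y n p" "rev m = m" "rev n = n"
    and b: "b = b\<^sub>0 @ a" "seg (bounce a m n) 0 b"
  shows "period (bounce a m n) (int (length b\<^sub>0)) \<and> bounce b m n = bounce a m n"
proof -
  note da = validD[OF va]
  let ?f = "bounce a m n" and ?r = "int (length b\<^sub>0)" and ?p = "bounce_period a m n"
  have *: "a = p @ n @ x" "p \<noteq> []" using border_pair(1) by (auto simp: border_pair_def)
  have per: "period ?f (int (length (p @ n)))" using period_bounce_border[OF border_pair] .
  have "seg ?f (0 + ?r) a" using b by (simp add: seg_append)
  moreover have "seg ?f 0 a" by (rule bounce_seg_parts)
  ultimately have r: "period ?f ?r"
    using period_from_window[OF per] * by (metis append.assoc append_is_Nil_conv le_add1 length_append length_greater_0_conv of_nat_0_less_iff of_nat_mono)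
  have q: "bounce_period b m n = ?p + 2 * ?r" using b(1) by (simp add: bounce_period_def)
  have pq: "period ?f (bounce_period b m n)"
    unfolding q by (rule period_add[OF period_bounce period_mult[OF r]])
  have bne: "b \<noteq> []" using b(1) da(1) by simp
  have l: "int (length b) = int (length a) + ?r" using b(1) by simp
  have m: "seg ?f (int (length b)) m" unfolding l seg_period[OF r] by (rule bounce_seg_parts)
  have "mirror ?f (- int (length n) - 1 + bounce_period b m n)"
    by (rule mirror_period[OF mirror_bounce[OF border_pair(2,3) da(1)] pq])
  from seg_mirror[OF this b(2)] have rb: "seg ?f (int (length b) + int (length m)) (rev b)"
    by (simp add: bounce_period_def algebra_simps)
  have n: "seg ?f (int (2 * length b + length m)) n"
  proof -
    have "int (2 * length b + length m) = int (2 * length a + length m) + 2 * ?r" using l by simp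
    then show ?thesis using seg_period[OF period_mult[OF r]] bounce_seg_parts(4) by metis
  qed
  have "seg ?f 0 (b @ m @ rev b @ n)" using b(2) m rb n by (simp add: seg_append algebra_simps)
  then have "bounce b m n = ?f"
    by (intro fun_eq_from_window[OF period_bounce pq bounce_period_pos[OF bne] _ seg_bounce])
      (simp_all add: bounce_period_def)
  then show ?thesis using r by blast
qed

context longer_common_bound
begin

text \<open>Only end states leave a choice of the next letter. Both walks at the left end, or both
  at the right end, happens only when \<open>v\<close> starts or stops. At opposite ends the border
  of some factorization is empty, so \<open>m\<close> starts with \<open>Alpha\<close> and
  \<open>n\<close> with \<open>Beta\<close>; the next letter differs from its predecessor and from
  \<open>Gamma\<close>, and is the one the bouncing word has.\<close>

lemma bounce_both:
  assumes border_pair: "border_pair a x m y n p" "rev m = m" "rev n = n" and J0: "last (takeWhile (\<lambda>c. c \<noteq> Beta) a) = Alpha"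
    and eq: "bounce b m n = bounce a m n"
  shows "seg (bounce a m n) 0 v"
proof -
  note da = validD[OF va] and d = validD[OF vb]
  let ?f = "bounce a m n"
  have mn: "m \<noteq> []" "n \<noteq> []" "Beta \<notin> set m" "Alpha \<notin> set n" using border_pair(1) by (auto simp: border_pair_def)
  have sp: "seg ?f 0 (take k v)" if "k \<le> length v" for k
    using that
  proof (induction k)
    case (Suc k)
    then have IH: "seg ?f 0 (take k v)" by simp
    have k: "k < length v" using Suc.prems by simp
    let ?s = "bounce_state a m n (int k)" and ?t = "bounce_state b m n (int k)"
    let ?u = "take k v" and ?w = "drop k v"
    have uw: "v = ?u @ ?w" by simp
    have pa': "path a 0 ?u ?s"
      using bounce_path[OF da(1) mn(3,4) IH] bounce_state_start[of 0 a m n] da(1) k by simp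
    have pb': "path b 0 ?u ?t"
      using bounce_path[OF d(1) mn(3,4) IH[folded eq]] bounce_state_start[of 0 b m n] d(1) k by simp
    have w: "?w = v ! k # drop (Suc k) v" using k by (simp add: Cons_nth_drop_Suc)
    have "v ! k = ?f (int k)"
    proof (cases "k = 0")
      case True
      then show ?thesis using segD[OF bounce_seg_parts(1), of 0 a m n] da(5,7) hd_v v_nonempty
        by (simp add: hd_conv_nth)
    next
      case False
      then have u: "?u \<noteq> []" using v_nonempty by simp
      have kk: "int (k - 1) = int k - 1" using False by simp
      have lu: "last ?u = ?f (int k - 1)"
      proof -
        have "?f (0 + int (k - 1)) = ?u ! (k - 1)" by (rule segD[OF IH]) (use False k in simp)
        moreover have "last ?u = ?u ! (k - 1)" using last_conv_nth[OF u] k by simp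
        ultimately show ?thesis using kk by simp
      qed
      have ne: "v ! k \<noteq> ?f (int k - 1)"
        using adj uw w lu u by (metis distinct_adj_append_iff list.sel(1) list.distinct(1))
      have inner: "v ! k = ?f (int k)" if cv: "valid c" and pc: "path c 0 v (length c)" and cm: "bounce c m n = ?f"
        and s: "path c 0 ?u s" "s = bounce_state c m n (int k)" "s \<noteq> 0" "s \<noteq> length c" for c s
      proof -
        note dc = validD[OF cv]
        have "path c s ?w (length c)" using pc s(1) uw path_det[OF cv s(1)] path_append by metis
        then obtain s' where s': "edge c s (v ! k) s'" using w by auto
        have st: "edge c s (?f (int k)) (bounce_state c m n (int k + 1))"
          using bounce_state_step[OF dc(1) mn(3,4), of "int k"] cm s(2) by simp
        have pr: "edge c s (?f (int k - 1)) (bounce_state c m n (int k - 1))"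
          using bounce_state_step[OF dc(1) mn(3,4), of "int k - 1"] cm s(2) edge_sym by simp
        have "s \<le> length c" using edge_le[OF s'] by blast
        moreover have "?f (int k) \<noteq> ?f (int k - 1)"
        proof -
          have a': "a = x @ m @ y" "a = p @ n @ x" using border_pair(1) by (auto simp: border_pair_def)
          have "distinct_adj m" "distinct_adj n"
            using da(2) a' by (metis distinct_adj_appendD1 distinct_adj_appendD2)+
          from bounce_adjacent[OF va mn(3,4) this mn(1,2), of "int k - 1"] show ?thesis by simp
        qed
        ultimately show ?thesis using edge_inner[OF _ _ pr s' st ne] s(3,4) by simp
      qed
      consider "?s \<noteq> 0" "?s \<noteq> length a" | "?t \<noteq> 0" "?t \<noteq> length b" | "?s = 0" "?t = 0" | "?s = length a" "?t = length b"
        | (se) "?s = 0" "?t = length b" | (es) "?s = length a" "?t = 0" by blast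
      then show ?thesis
      proof cases
        case 1
        then show ?thesis using inner[OF va pa _ pa'] by blast
      next
        case 2
        then show ?thesis using inner[OF vb pb eq pb'] by blast
      next
        case 3
        then show ?thesis using start_only[OF uw] pa' pb' u by simp
      next
        case 4
        then show ?thesis using end_only[OF uw] pa' pb' w by simp
      next
        case se
        have o: "last ?u \<noteq> Gamma" "hd ?w \<noteq> Gamma" "last ?u \<noteq> hd ?w" "\<exists>m y n p. border_pair a [] m y n p"
          using opposite_start_end[OF uw pa'[unfolded se(1)] pb'[unfolded se(2)]] by blast+
        have t: "hd m = Alpha \<and> hd n = Beta" using o(4) border_pair J0 va torus_hd by blast
        have vk: "hd ?w = v ! k" using w by simp
        show ?thesis
        proof (cases "?f (int k - 1)")
          case Alpha
          then have "?f (int k) = Beta" using bounce_after_start[OF da(1) mn(4,2) se(1)] t by simp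
          moreover have "v ! k = Beta" using o lu vk Alpha by (cases "v ! k") auto
          ultimately show ?thesis by simp
        next
          case Beta
          then have "?f (int k) = Alpha" using bounce_after_end[OF d(1) mn(3,1) se(2)] t eq by simp
          moreover have "v ! k = Alpha" using o lu vk Beta by (cases "v ! k") auto
          ultimately show ?thesis by simp
        qed (use o lu in simp)
      next
        case es
        have o: "last ?u \<noteq> Gamma" "hd ?w \<noteq> Gamma" "last ?u \<noteq> hd ?w" "\<exists>m y n p. border_pair a [] m y n p"
          using opposite_end_start[OF uw pa'[unfolded es(1)] pb'[unfolded es(2)]] by blast+
        have t: "hd m = Alpha \<and> hd n = Beta" using o(4) border_pair J0 va torus_hd by blast
        have vk: "hd ?w = v ! k" using w by simp
        show ?thesis
        proof (cases "?f (int k - 1)")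
          case Alpha
          then have "?f (int k) = Beta" using bounce_after_start[OF d(1) mn(4,2) es(2)] t eq by simp
          moreover have "v ! k = Beta" using o lu vk Alpha by (cases "v ! k") auto
          ultimately show ?thesis by simp
        next
          case Beta
          then have "?f (int k) = Alpha" using bounce_after_end[OF da(1) mn(3,1) es(1)] t by simp
          moreover have "v ! k = Alpha" using o lu vk Beta by (cases "v ! k") auto
          ultimately show ?thesis by simp
        qed (use o lu in simp)
      qed
    qed
    then have "seg ?f 0 (take k v @ [v ! k])"
      using IH k unfolding seg_append by (simp add: seg_def)
    then show ?case using k by (simp add: take_Suc_conv_app_nth)
  qed simp
  then show ?thesis using sp[of "length v"] by simp
qed

text \<open>\<open>v\<close> ends with \<open>Beta\<close> at the right end in both graphs, hence at
  a moment of arrival and not of waiting.\<close>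

lemma bound_length:
  assumes border_pair: "border_pair a x m y n p" "rev m = m" "rev n = n"
    and eq: "bounce b m n = bounce a m n" and v: "seg (bounce a m n) 0 v"
  shows "int (length v) mod bounce_period a m n = int (length a) \<and>
    int (length v) mod bounce_period b m n = int (length b)"
proof -
  note da = validD[OF va] and d = validD[OF vb]
  have mn: "m \<noteq> []" "n \<noteq> []" "Beta \<notin> set m" "Alpha \<notin> set n" using border_pair(1) by (auto simp: border_pair_def)
  have "bounce a m n (0 + int (length v - 1)) = Beta"
    using segD[OF v, of "length v - 1"] v_nonempty last_v by (simp add: last_conv_nth)
  moreover have "0 + int (length v - 1) = int (length v) - 1"
    using v_nonempty by (simp add: of_nat_diff Suc_le_eq)
  ultimately have L: "bounce a m n (int (length v) - 1) = Beta" by metis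
  have "path a 0 v (bounce_state a m n (int (length v)))"
    using bounce_path[OF da(1) mn(3,4) v] bounce_state_start[of 0 a m n] da(1) by simp
  then have 1: "bounce_state a m n (int (length v)) = length a" using path_det[OF va _ pa] by blast
  have "path b 0 v (bounce_state b m n (int (length v)))"
    using bounce_path[OF d(1) mn(3,4) v[folded eq]] bounce_state_start[of 0 b m n] d(1) by simp
  then have 2: "bounce_state b m n (int (length v)) = length b" using path_det[OF vb _ pb] by blast
  show ?thesis using bounce_at_end[OF da(1) mn(3) 1 L] bounce_at_end[OF d(1) mn(3) 2] L eq by simp
qed

end

section \<open>From an odd fraction of the bounce period to powers of a word\<close>

lemma seg_replicate:
  assumes "period f (int (length w))" "seg f i w"
  shows "seg f i (concat (replicate k w))"
proof (induction k)
  case (Suc k)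
  then show ?case using assms by (simp add: seg_append seg_period)
qed simp

lemma length_concat_replicate: "length (concat (replicate k w)) = k * length w"
  by (induction k) auto

lemma int_length_power: "int (length (concat (replicate k w) @ e)) = int k * int (length w) + int (length e)"
  by (simp only: length_append length_concat_replicate of_nat_add of_nat_mult)

text \<open>The two middle letters of a palindrome of even length coincide.\<close>

lemma odd_palindrome:
  assumes "distinct_adj m" "rev m = m" "m \<noteq> []"
  shows "odd (length m)"
proof
  assume "even (length m)"
  then obtain k where k: "length m = 2 * k" by blast
  then have k0: "0 < k" using assms(3) by (cases k) auto
  then have "rev m ! k = m ! (k - 1)" using k by (simp add: rev_nth)
  then show False using distinct_adj_nth[OF assms(1), of "k - 1"] k k0 assms(2) by simp
qed

text \<open>With \<open>c = 2 k + 1\<close> and \<open>G = 2 E + |m| + |n|\<close> the length of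
  \<open>a\<close> is \<open>E + k G\<close>. Shifting by \<open>k G\<close> moves the
  \<open>m\<close> that follows \<open>a\<close> back to position \<open>E\<close>, and the
  reflection about its centre gives one period the form \<open>e m e^-1 n\<close> with
  \<open>|e| = E\<close>. The delicate point is that \<open>E\<close> is not negative.\<close>

lemma bounce_factor:
  assumes va: "valid a" and border_pair: "border_pair a x m y n p" "rev m = m" "rev n = n"
    and J0: "last (takeWhile (\<lambda>c. c \<noteq> Beta) a) = Alpha"
    and G: "period (bounce a m n) G" "0 < G" "G * c = bounce_period a m n" "odd c"
  shows "\<exists>e k. let w = e @ m @ rev e @ n in a = concat (replicate k w) @ e \<and> int (length w) = G \<and>
    (e = [] \<or> valid e) \<and> seg (bounce a m n) 0 w"
proof -
  note da = validD[OF va]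
  let ?f = "bounce a m n" and ?p = "bounce_period a m n"
  have *: "a = x @ m @ y" "a = p @ n @ x" "m \<noteq> []" "n \<noteq> []" "Beta \<notin> set m" "Alpha \<notin> set n"
    using border_pair(1) by (auto simp: border_pair_def)
  have adj: "distinct_adj m" "distinct_adj n"
    using da(2) *(1,2) by (metis distinct_adj_appendD1 distinct_adj_appendD2)+
  have "0 < G * c" using G(3) bounce_period_pos[OF da(1)] by simp
  then have "0 < c" using G(2) by (simp add: zero_less_mult_iff)
  then have "c = 2 * int (nat ((c - 1) div 2)) + 1" using G(4) by (auto elim!: oddE)
  then obtain k :: nat where c: "c = 2 * int k + 1" by blast
  \<comment> \<open>Parity makes \<open>E\<close> an integer: the bounce period is even and
    \<open>c\<close> is odd, so \<open>G\<close> is even.\<close>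
  have "odd (length m)" "odd (length n)" using odd_palindrome adj border_pair(2,3) *(3,4) by blast+
  then have "even ?p" by (simp add: bounce_period_def)
  then have "even G" using G(3,4) by (metis even_mult_iff)
  then have "even (G - int (length m) - int (length n))"
    using \<open>odd (length m)\<close> \<open>odd (length n)\<close> by simp
  then obtain E where E: "G - int (length m) - int (length n) = 2 * E" by blast
  have aE: "int (length a) = E + int k * G"
  proof -
    have "2 * int (length a) = 2 * (E + int k * G)"
      using G(3) E unfolding c bounce_period_def by (simp add: algebra_simps)
    then show ?thesis by simp
  qed
  have pk: "period ?f (int k * G)" by (rule period_mult[OF G(1)])
  have segm: "seg ?f E m"
    using bounce_seg_parts(2)[of a m n] seg_period[OF pk, of E m] aE by simp
  have sn: "mirror ?f (- int (length n) - 1)" by (rule mirror_bounce[OF border_pair(2,3) da(1)])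
  have sm: "mirror ?f (2 * E + int (length m) - 1)"
    using mirror_period[OF sn G(1)] E by (simp add: algebra_simps)
  have segn: "seg ?f (- int (length n)) n"
    using bounce_seg_parts(4)[of a m n] seg_period[OF period_bounce, of a m n "- int (length n)" n]
    by (simp add: bounce_period_def algebra_simps)
  have A0: "?f 0 = Alpha" using segD[OF bounce_seg_parts(1), of 0 a m n] da by simp
  have A1: "?f (- int (length n) - 1) = Alpha" using mirrorD[OF sn, of 0] A0 by simp
  have B1: "?f (E - 1) = Beta"
  proof -
    have "?f (E - 1) = ?f (E - 1 + int k * G)" using periodD[OF pk] by metis
    also have "E - 1 + int k * G = 0 + int (length a - 1)" using aE da(7) by (simp add: of_nat_diff Suc_le_eq)
    also have "?f \<dots> = a ! (length a - 1)" by (rule segD[OF bounce_seg_parts(1)]) (use da in simp)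
    finally show ?thesis using da(6) by simp
  qed
  have B2: "?f (E + int (length m)) = Beta"
    using mirrorD[OF sm, of "E - 1"] B1 by (simp add: algebra_simps)
  have inm: "?f j \<noteq> Beta" if "E \<le> j" "j < E + int (length m)" for j
  proof -
    have j: "nat (j - E) < length m" "E + int (nat (j - E)) = j" using that by auto
    then have "?f j = m ! nat (j - E)" using segD[OF segm j(1)] by simp
    then show ?thesis using *(5) j(1) by (metis nth_mem)
  qed
  have inn: "?f j \<noteq> Alpha" if "- int (length n) \<le> j" "j < 0" for j
  proof -
    have j: "nat (j + int (length n)) < length n" "- int (length n) + int (nat (j + int (length n))) = j"
      using that by auto
    then have "?f j = n ! nat (j + int (length n))" using segD[OF segn j(1)] by simp
    then show ?thesis using *(6) j(1) by (metis nth_mem)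
  qed
  \<comment> \<open>For negative \<open>E\<close> the \<open>m\<close> at \<open>E\<close> and the
    \<open>n\<close> before 0 would collide. In the first two cases a reflection carries a
    \<open>Beta\<close> into \<open>m\<close> or an \<open>Alpha\<close> into \<open>n\<close>. In
    the third, the letters from \<open>E\<close> to \<open>- 1\<close> lie in both and must be
    \<open>Gamma\<close>, so \<open>E = - 1\<close>; reflected, this \<open>Gamma\<close> stands
    just before the first \<open>Beta\<close> of \<open>a\<close>, contrary to
    \<open>J0\<close>.\<close>
  have E0: "0 \<le> E"
  proof (rule ccontr)
    assume neg: "\<not> 0 \<le> E"
    consider "2 * E \<le> - int (length n)" | "2 * E + int (length m) \<le> 0"
      | "- int (length n) < 2 * E" "0 < 2 * E + int (length m)" by linarith
    then show False
    proof cases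
      case 1
      have "?f (- int (length n) - E) = Beta"
        using mirrorD[OF sn, of "E - 1"] B1 by (simp add: algebra_simps)
      then show False using inm[of "- int (length n) - E"] 1 E G(2) by simp
    next
      case 2
      have "?f (2 * E + int (length m) - 1) = Alpha" using mirrorD[OF sm, of 0] A0 by simp
      then show False using inn[of "2 * E + int (length m) - 1"] 2 E G(2) by simp
    next
      case 3
      have gam: "?f j = Gamma" if "E \<le> j" "j < 0" for j
        using inm[of j] inn[of j] that 3 neg by (cases "?f j") auto
      have "E = - 1"
      proof (rule ccontr)
        assume "E \<noteq> - 1"
        then have "?f (- 2) = ?f (- 2 + 1)" using gam[of "- 2"] gam[of "- 1"] neg by simp
        then show False using bounce_adjacent[OF va *(5,6) adj *(3,4), of "- 2"] by simp
      qed
      then have m2: "2 < length m" using 3 by simp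
      have nm: "?f (int i) \<noteq> Beta" if "i < length m - 1" for i
        by (rule inm) (use that \<open>E = - 1\<close> in auto)
      have al: "?f (int i) = a ! i" if "i < length a" for i
        using segD[OF bounce_seg_parts(1) that, of m n] by simp
      have long: "length m - 1 < length a"
      proof (rule ccontr)
        assume "\<not> ?thesis"
        then have "length a - 1 < length m - 1" using da(7) by linarith
        then show False using nm al[of "length a - 1"] da(6,7) by (metis diff_less zero_less_one)
      qed
      have e1: "E + int (length m) = int (length m - 1)" using \<open>E = - 1\<close> m2 by simp
      have "takeWhile (\<lambda>c. c \<noteq> Beta) a = take (length m - 1) a"
      proof (rule takeWhile_eq_take_P_nth)
        show "a ! i \<noteq> Beta" if "i < length m - 1" "i < length a" for i
          using nm[OF that(1)] al[OF that(2)] by simp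
        show "\<not> a ! (length m - 1) \<noteq> Beta" if "length m - 1 < length a"
          using B2 e1 al[OF that] by simp
      qed
      then have "last (take (length m - 1) a) = Alpha" using J0 by simp
      moreover have "last (take (length m - 1) a) = a ! (length m - 2)"
        using m2 long da(1) by (subst last_conv_nth) (auto simp: nth_take numeral_2_eq_2)
      moreover have "a ! (length m - 2) = ?f (int (length m - 2))" using al[of "length m - 2"] long by simp
      moreover have "?f (int (length m - 2)) = ?f (- 1)"
      proof -
        have "2 * E + int (length m) - 1 - (- 1) = int (length m - 2)" using \<open>E = - 1\<close> m2 by simp
        then show ?thesis using mirrorD[OF sm, of "- 1"] by metis
      qed
      moreover have "?f (- 1) = Gamma" using gam[of "- 1"] \<open>E = - 1\<close> by simp
      ultimately show False by simp
    qed
  qed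
  define e where "e = take (nat E) a"
  let ?w = "e @ m @ rev e @ n"
  have "nat E \<le> length a" using aE E0 G(2) by (smt (verit) nat_le_iff zero_le_mult_iff of_nat_0_le_iff)
  then have le: "int (length e) = E" using E0 by (simp add: e_def)
  have "seg ?f 0 (take (nat E) a @ drop (nat E) a)" using bounce_seg_parts(1) by simp
  then have sege: "seg ?f 0 e" unfolding seg_append e_def by blast
  have segr: "seg ?f (E + int (length m)) (rev e)"
    using seg_mirror[OF sm sege] le by (simp add: algebra_simps)
  have "seg ?f (2 * E + int (length m)) n"
    using segn seg_period[OF G(1), of "- int (length n)" n] E by (simp add: algebra_simps)
  then have segw: "seg ?f 0 ?w" using sege segm segr le by (simp add: seg_append algebra_simps)
  have lw: "int (length ?w) = G" using le E by simp
  have "seg ?f 0 (concat (replicate k ?w))" by (rule seg_replicate[OF _ segw]) (use G(1) lw in simp)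
  moreover have "seg ?f (int (length (concat (replicate k ?w)))) e"
  proof -
    have "int (length (concat (replicate k ?w))) = 0 + int k * G"
      unfolding length_concat_replicate of_nat_mult lw by simp
    then show ?thesis using seg_period[OF pk, of 0 e] sege by metis
  qed
  ultimately have "seg ?f 0 (concat (replicate k ?w) @ e)" by (simp add: seg_append)
  moreover have "length (concat (replicate k ?w) @ e) = length a"
  proof -
    have "int (length (concat (replicate k ?w) @ e)) = int k * G + E"
      unfolding int_length_power lw le ..
    then show ?thesis using aE by linarith
  qed
  ultimately have a: "a = concat (replicate k ?w) @ e"
    using seg_unique[OF bounce_seg_parts(1)] by metis
  have "valid e" if "e \<noteq> []"
  proof -
    have "distinct_adj e" using da(2) unfolding e_def by (metis append_take_drop_id distinct_adj_appendD1)
    moreover have "hd e = Alpha" using that da(3) unfolding e_def by (simp add: hd_take)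
    moreover have "last e = Beta"
    proof -
      have "0 + int (length e - 1) = E - 1" using that le by (simp add: of_nat_diff Suc_le_eq)
      then have "?f (E - 1) = e ! (length e - 1)" using segD[OF sege, of "length e - 1"] that by simp
      then show ?thesis using B1 that by (simp add: last_conv_nth)
    qed
    ultimately show ?thesis using that by (simp add: valid_def)
  qed
  then show ?thesis using a lw segw by (metis (no_types, lifting))
qed

theorem (in longer_common_bound) core:
  assumes J0: "last (takeWhile (\<lambda>c. c \<noteq> Beta) a) = Alpha" and "\<not> path a 0 b (length a)"
  shows "\<exists>e m n P Q. let w = e @ m @ rev e @ n in a = concat (replicate P w) @ e \<and> b = concat (replicate Q w) @ e \<and>
    (e = [] \<or> valid e) \<and> rev m = m \<and> rev n = n \<and> m \<noteq> [] \<and> n \<noteq> [] \<and> Beta \<notin> set m \<and> Alpha \<notin> set n"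
proof -
  note da = validD[OF va] and d = validD[OF vb]
  have "v \<noteq> b" using assms(2) pa by blast
  then obtain x m y n p where border_pair: "border_pair a x m y n p" "rev m = m" "rev n = n" and sb: "seg (bounce a m n) 0 b"
    using bounce_prefix[OF _ J0] by blast
  let ?f = "bounce a m n" and ?p = "bounce_period a m n"
  obtain b\<^sub>0 where b\<^sub>0: "b = b\<^sub>0 @ a" "b\<^sub>0 \<noteq> []" using proper_suffix by blast
  let ?r = "int (length b\<^sub>0)"
  have r: "period ?f ?r" and eq: "bounce b m n = ?f" using bounce_longer[OF va border_pair b\<^sub>0(1) sb] by auto
  have sv: "seg ?f 0 v" using bounce_both[OF border_pair J0 eq] .
  have L: "int (length v) mod ?p = int (length a)" "int (length v) mod bounce_period b m n = int (length b)"
    using bound_length[OF border_pair eq sv] by auto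
  have lb: "int (length b) = int (length a) + ?r" using b\<^sub>0(1) by simp
  have q: "bounce_period b m n = ?p + 2 * ?r" using b\<^sub>0(1) by (simp add: bounce_period_def)
  define G where "G = gcd ?p ?r"
  have pp: "0 < ?p" using bounce_period_pos[OF da(1)] .
  have G0: "0 < G" using pp by (simp add: G_def)
  have G: "period ?f G" unfolding G_def by (rule period_gcd[OF period_bounce r])
  obtain c d' where cd: "?p = G * c" "?r = G * d'" "coprime c d'"
    using gcd_coprime_exists[of ?p ?r] G0 unfolding G_def[symmetric] by (metis less_irrefl mult.commute)
  \<comment> \<open>Comparing the length of \<open>v\<close> modulo the two bounce periods and
    cancelling \<open>G\<close> gives \<open>(2 l' + 1) d' = c (l - l')\<close>. As \<open>c\<close>
    and \<open>d'\<close> are coprime, \<open>c\<close> divides an odd number.\<close>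
  have "odd c"
  proof -
    define l where "l = int (length v) div ?p"
    define l' where "l' = int (length v) div (?p + 2 * ?r)"
    have "int (length v) = l * ?p + int (length a)" using L(1) by (metis div_mult_mod_eq l_def)
    moreover have "int (length v) = l' * (?p + 2 * ?r) + int (length b)" using L(2) q by (metis div_mult_mod_eq l'_def)
    ultimately have "l * ?p = l' * (?p + 2 * ?r) + ?r" using lb by linarith
    then have "G * (l * c) = G * (l' * (c + 2 * d') + d')" unfolding cd(1,2) by (simp add: algebra_simps)
    then have "l * c = l' * (c + 2 * d') + d'" using G0 by simp
    then have "(2 * l' + 1) * d' = c * (l - l')" by (simp add: algebra_simps)
    then have "c dvd (2 * l' + 1) * d'" by simp
    then have "c dvd 2 * l' + 1" using cd(3) by (simp add: coprime_dvd_mult_left_iff)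
    then show ?thesis by (metis dvd_trans odd_two_times_div_two_succ even_plus_one_iff dvd_triv_left)
  qed
  obtain e k where e: "a = concat (replicate k (e @ m @ rev e @ n)) @ e" "int (length (e @ m @ rev e @ n)) = G"
    "e = [] \<or> valid e" "seg ?f 0 (e @ m @ rev e @ n)"
    using bounce_factor[OF va border_pair J0 G G0 cd(1)[symmetric] \<open>odd c\<close>] unfolding Let_def by blast
  let ?w = "e @ m @ rev e @ n"
  have "0 < ?r" using b\<^sub>0(2) by simp
  then have "0 < d'" using cd(2) G0 by (simp add: zero_less_mult_iff)
  \<comment> \<open>\<open>b\<close> is longer than \<open>a\<close> by \<open>G * d'\<close>, that
    is, by \<open>d'\<close> copies of \<open>?w\<close>.\<close>
  define Q where "Q = nat d' + k"
  have "seg ?f 0 (concat (replicate Q ?w))" by (rule seg_replicate[OF _ e(4)]) (use G e(2) in simp)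
  moreover have "seg ?f (int (length (concat (replicate Q ?w)))) e"
  proof -
    have "int (length (concat (replicate Q ?w))) = 0 + int Q * G"
      unfolding length_concat_replicate of_nat_mult e(2) by simp
    moreover have "seg ?f 0 e" using e(4) by (simp add: seg_append)
    ultimately show ?thesis using seg_period[OF period_mult[OF G, of "int Q"], of 0 e] by metis
  qed
  ultimately have "seg ?f 0 (concat (replicate Q ?w) @ e)" by (simp add: seg_append)
  moreover have "length (concat (replicate Q ?w) @ e) = length b"
  proof -
    have "int (length (concat (replicate Q ?w) @ e)) = int Q * G + int (length e)"
      unfolding int_length_power e(2) ..
    also have "\<dots> = ?r + (int k * G + int (length e))" using \<open>0 < d'\<close> cd(2) by (simp add: Q_def algebra_simps)
    also have "int k * G + int (length e) = int (length (concat (replicate k ?w) @ e))"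
      unfolding int_length_power e(2) ..
    also have "\<dots> = int (length a)" using e(1) by simp
    finally show ?thesis using lb by linarith
  qed
  ultimately have b: "b = concat (replicate Q ?w) @ e" using seg_unique[OF sb] by metis
  have "m \<noteq> []" "n \<noteq> []" "Beta \<notin> set m" "Alpha \<notin> set n" using border_pair(1) by (auto simp: border_pair_def)
  then show ?thesis using b e(1,3) border_pair(2,3) by (metis (no_types, lifting))
qed

lemma replicate_shift: "concat (replicate k (u @ w)) @ u = u @ concat (replicate k (w @ u))"
  by (induction k) simp_all

lemma rev_concat_replicate: "rev (concat (replicate k w)) = concat (replicate k (rev w))"
  by (simp add: rev_concat)

text \<open>One round consists of \<open>P\<close> factors on the way up, one factor
  \<open>e m e^-1 n\<close> around the turn, and \<open>P\<close> on the way down, where regrouping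
  the reversed factors gives copies of \<open>w\<close> again.\<close>

lemma unfold_power:
  fixes e m n :: "'x list"
  assumes "rev m = m" "rev n = n" "w = e @ m @ rev e @ n" "a = concat (replicate P w) @ e"
  shows "a @ m @ rev a @ n = concat (replicate (2 * P + 1) w)"
proof -
  have rw: "rev w = n @ (e @ m @ rev e)" using assms(1-3) by simp
  have "rev a @ n = rev e @ concat (replicate P (n @ (e @ m @ rev e))) @ n"
    unfolding assms(4) by (simp add: rev_concat_replicate rw)
  also have "concat (replicate P (n @ (e @ m @ rev e))) @ n = n @ concat (replicate P ((e @ m @ rev e) @ n))"
    by (rule replicate_shift)
  also have "(e @ m @ rev e) @ n = w" using assms(3) by simp
  finally have "a @ m @ rev a @ n = concat (replicate P w) @ w @ concat (replicate P w)"
    using assms(3,4) by simp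
  also have "\<dots> = concat (replicate (P + Suc P) w)" by (simp only: concat_replicate_add replicate_Suc concat.simps)
  finally show ?thesis by (simp add: mult_2)
qed

text \<open>The bouncing word of \<open>a\<close> has period \<open>w\<close>, but the walk along it
  needs a full round of \<open>2 P + 1\<close> copies of \<open>w\<close> to repeat. Arriving at the
  right end with a \<open>Beta\<close> fixes the time modulo a round, so \<open>2 P + 1\<close>
  divides \<open>Q - P\<close> and hence \<open>2 (Q - P) + (2 P + 1)\<close>.\<close>

lemma path_power_dvd:
  assumes "valid a" "rev m = m" "rev n = n" "m \<noteq> []" "n \<noteq> []" "Beta \<notin> set m" "Alpha \<notin> set n"
    and w: "w = e @ m @ rev e @ n" and a: "a = concat (replicate P w) @ e" and b: "b = concat (replicate Q w) @ e"
    and path: "path a 0 b (length a)"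
  shows "(2 * P + 1) dvd (2 * Q + 1)"
proof -
  note da = validD[OF assms(1)]
  let ?f = "bounce a m n" and ?p = "bounce_period a m n" and ?l = "int (length w)"
  have lw: "0 < length w" using w assms(4) by simp
  have ww: "a @ m @ rev a @ n = concat (replicate (2 * P + 1) w)" using unfold_power[OF assms(2,3) w a] .
  have p: "?p = int (2 * P + 1) * ?l"
    using arg_cong[OF ww, of length] unfolding length_concat_replicate bounce_period_eq[symmetric] by (metis of_nat_mult)
  define g where "g i = w ! nat (i mod ?l)" for i
  have g: "period g ?l" by (simp add: period_def g_def)
  have sg: "seg g 0 w" using lw by (simp add: seg_def g_def)
  have gp: "period g ?p" unfolding p by (rule period_mult[OF g])
  have sgp: "seg g 0 (a @ m @ rev a @ n)" unfolding ww by (rule seg_replicate[OF g sg])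
  have "?f = g"
    by (rule fun_eq_from_window[OF period_bounce gp bounce_period_pos[OF da(1)] _ seg_bounce sgp])
      (simp add: bounce_period_def)
  then have f: "period ?f ?l" "seg ?f 0 w" using g sg by simp_all
  have "seg ?f 0 (concat (replicate Q w))" by (rule seg_replicate[OF f])
  moreover have "seg ?f (0 + int Q * ?l) e"
    unfolding seg_period[OF period_mult[OF f(1)]] using f(2) w by (simp add: seg_append)
  ultimately have sb: "seg ?f 0 b" unfolding b seg_append length_concat_replicate by simp
  have "path a 0 b (bounce_state a m n (int (length b)))"
    using bounce_path[OF da(1) assms(6,7) sb] bounce_state_start[of 0 a m n] da(1) by simp
  then have st: "bounce_state a m n (int (length b)) = length a" using path_det[OF assms(1) _ path] by blast
  have bne: "b \<noteq> []" using path da(7) by auto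
  have lb: "last b = Beta"
  proof (cases "e = []")
    case True
    then have "P \<noteq> 0" "Q \<noteq> 0" using a b da(1) bne by (auto intro: gr0I)
    then obtain i j where ij: "P = Suc i" "Q = Suc j" by (metis not0_implies_Suc)
    have "u = concat (replicate k w) @ w \<Longrightarrow> last u = last n" for u k using w assms(5) by simp
    moreover have "a = concat (replicate i w) @ w" "b = concat (replicate j w) @ w"
      using a b ij True concat_replicate_add[of _ 1 w] by (simp_all add: replicate_append_same[symmetric] flip: Suc_eq_plus1)
    ultimately show ?thesis using da(4) by metis
  next
    case False
    then show ?thesis using a b da(4) by simp
  qed
  have "?f (0 + int (length b - 1)) = Beta"
    using segD[OF sb, of "length b - 1"] bne lb by (simp add: last_conv_nth)
  moreover have "0 + int (length b - 1) = int (length b) - 1" using bne by (simp add: of_nat_diff Suc_le_eq)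
  ultimately have "?f (int (length b) - 1) = Beta" by metis
  then have "int (length b) mod ?p = int (length a)" using bounce_at_end[OF da(1) assms(6) st] by blast
  then have "?p dvd int (length b) - int (length a)" by (metis minus_mod_eq_mult_div dvd_triv_left)
  moreover have "int (length b) - int (length a) = (int Q - int P) * ?l"
    unfolding a b length_append length_concat_replicate by (simp add: algebra_simps)
  ultimately have "int (2 * P + 1) dvd int Q - int P" using p lw by simp
  then have "int (2 * P + 1) dvd 2 * (int Q - int P) + int (2 * P + 1)" by (meson dvd_add dvd_mult dvd_refl)
  also have "2 * (int Q - int P) + int (2 * P + 1) = int (2 * Q + 1)" by simp
  finally show ?thesis by presburger
qed

section \<open>Vectors and words\<close>

text \<open>The nonempty members of \<open>S\<close> (\<open>S_iff\<close>), built from the left so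
  that structural induction is available.\<close>

inductive expanded :: "int list \<Rightarrow> bool" where
  single: "x \<in> {-2, 2} \<Longrightarrow> expanded [x]"
| zero: "expanded (x # r) \<Longrightarrow> expanded (x # 0 # x # r)"
| step: "x \<in> {-2, 2} \<Longrightarrow> expanded (y # r) \<Longrightarrow> expanded (x # y # r)"

lemma expanded_hd: "expanded u \<Longrightarrow> u \<noteq> [] \<and> hd u \<in> {-2, 2}"
  by (induction rule: expanded.induct) auto

lemma expanded_last: "expanded u \<Longrightarrow> last u \<in> {-2, 2}"
  by (induction rule: expanded.induct) auto

lemma expanded_ConsD: "expanded (x # r) \<Longrightarrow> x \<in> {-2, 2}"
  using expanded_hd by fastforce

lemma expanded_set: "expanded u \<Longrightarrow> set u \<subseteq> {-2, 0, 2}"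
  by (induction rule: expanded.induct) auto

lemma expanded_zeros: "expanded u \<Longrightarrow> Suc (Suc i) < length u \<Longrightarrow> u ! Suc i = 0 \<Longrightarrow> u ! i = u ! Suc (Suc i) \<and> u ! i \<in> {-2, 2}"
proof (induction arbitrary: i rule: expanded.induct)
  case (zero x r)
  then show ?case using expanded_ConsD[OF zero(1)] by (cases i; cases "i - 1") auto
next
  case (step x y r)
  show ?case
  proof (cases i)
    case 0
    then show ?thesis using step.prems expanded_ConsD[OF step(2)] by auto
  next
    case (Suc j)
    have "(y # r) ! j = (y # r) ! Suc (Suc j) \<and> (y # r) ! j \<in> {-2, 2}"
      by (rule step.IH) (use step.prems Suc in simp_all)
    then show ?thesis unfolding Suc nth_Cons_Suc .
  qed
qed auto

lemma expanded_of_S: "a \<in> S \<Longrightarrow> a \<noteq> [] \<Longrightarrow> expanded a"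
proof (induction "length a" arbitrary: a rule: less_induct)
  case less
  obtain x r where a: "a = x # r" using less.prems(2) by (cases a) auto
  have x: "x \<in> {-2, 2}" using less.prems(1) a by (auto simp: S_def)
  have set: "set a \<subseteq> {-2, 0, 2}" and last: "last a \<noteq> 0"
    using less.prems by (auto simp: S_def)
  have z: "a ! (i - 1) = a ! Suc i \<and> a ! Suc i \<in> {-2, 2}" if "0 < i" "Suc i < length a" "a ! i = 0" for i
    using less.prems(1) that by (auto simp: S_def)
  have tail: "d \<in> S" if d: "a = u @ d" "d \<noteq> []" "hd d \<noteq> 0" for u d
  proof -
    have "d ! (i - 1) = d ! Suc i \<and> d ! Suc i \<in> {-2, 2}" if i: "0 < i" "Suc i < length d" "d ! i = 0" for i
    proof -
      have n: "a ! (length u + j) = d ! j" for j using d by (simp add: nth_append)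
      have "length u + i - 1 = length u + (i - 1)" "Suc (length u + i) = length u + Suc i" using i by auto
      then show ?thesis using z[of "length u + i"] i d(1) n by (metis add_gr_0 add_less_cancel_left length_append)
    qed
    then show ?thesis using d set last by (auto simp: S_def)
  qed
  show ?case
  proof (cases r)
    case Nil
    then show ?thesis using a x expanded.single by simp
  next
    case (Cons y r')
    show ?thesis
    proof (cases "y = 0")
      case False
      then have "expanded r" using less.hyps[of r] tail[of "[x]" r] a Cons by simp
      then show ?thesis using expanded.step[OF x] a Cons by simp
    next
      case True
      then obtain w r'' where r': "r' = w # r''" using last a Cons by (cases r') auto
      have "w = x" using z[of 1] a Cons True r' by simp
      then have "expanded r'" using less.hyps[of r'] tail[of "[x, 0]" r'] a Cons True r' x by auto
      then show ?thesis using expanded.zero a Cons True r' \<open>w = x\<close> by simp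
    qed
  qed
qed

lemma S_of_expanded: "expanded a \<Longrightarrow> a \<in> S"
  unfolding S_def
proof (intro CollectI conjI allI impI)
  assume a: "expanded a"
  fix i assume i: "0 < i \<and> Suc i < length a \<and> a ! i = 0"
  then have "Suc (Suc (i - 1)) < length a" "a ! Suc (i - 1) = 0" by auto
  from expanded_zeros[OF a this] i show "a ! (i - 1) = a ! Suc i" "a ! Suc i \<in> {-2, 2}" by auto
qed (use expanded_set expanded_hd expanded_last in fastforce)+

lemma S_iff: "a \<in> S \<longleftrightarrow> a = [] \<or> expanded a"
proof -
  have "[] \<in> S" by (simp add: S_def)
  then show ?thesis using expanded_of_S S_of_expanded by metis
qed

lemma scale_simps [simp]: "scale e [] = []" "scale e (x # u) = e * x # scale e u"
  "scale e (u @ w) = scale e u @ scale e w" "length (scale e u) = length u" "scale 1 u = u"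
  "scale e u = [] \<longleftrightarrow> u = []" "scale e (rev u) = rev (scale e u)"
  by (simp_all add: scale_def rev_map map_idI)

lemma scale_scale [simp]: "scale e (scale e' u) = scale (e * e') u"
  by (simp add: scale_def)

lemma hd_scale: "u \<noteq> [] \<Longrightarrow> hd (scale e u) = e * hd u"
  by (cases u) auto

lemma last_scale: "u \<noteq> [] \<Longrightarrow> last (scale e u) = e * last u"
  by (simp add: scale_def last_map)

lemma expanded_scale: "expanded u \<Longrightarrow> e \<in> {-1, 1} \<Longrightarrow> expanded (scale e u)"
proof (induction rule: expanded.induct)
  case (zero x r)
  then show ?case using expanded.zero[of "e * x" "scale e r"] by simp
next
  case (step x y r)
  then show ?case using expanded.step[of "e * x" "e * y" "scale e r"] by auto
qed (auto intro: expanded.single)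

lemma expanded_append: "expanded u \<Longrightarrow> expanded w \<Longrightarrow> expanded (u @ w)"
proof (induction rule: expanded.induct)
  case (single x)
  then show ?case using expanded.step[OF single(1)] expanded_hd by (cases w) auto
qed (auto intro: expanded.zero expanded.step)

lemma expanded_append_zero: "expanded u \<Longrightarrow> expanded w \<Longrightarrow> last u = hd w \<Longrightarrow> expanded (u @ 0 # w)"
proof (induction rule: expanded.induct)
  case (single x)
  then show ?case using expanded.zero expanded_hd by (cases w) auto
qed (auto intro: expanded.zero expanded.step)

lemma expanded_rev: "expanded u \<Longrightarrow> expanded (rev u)"
proof (induction rule: expanded.induct)
  case (single x)
  then show ?case by (simp add: expanded.single)
next
  case (zero x r)
  then show ?case using expanded_append_zero[of "rev (x # r)" "[x]"] expanded.single expanded_ConsD[OF zero(1)] by simp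
next
  case (step x y r)
  then show ?case using expanded_append[of "rev (y # r)" "[x]"] expanded.single by simp
qed

lemma expanded_suffix: "expanded c \<Longrightarrow> c = u @ w \<Longrightarrow> w \<noteq> [] \<Longrightarrow> hd w \<noteq> 0 \<Longrightarrow> expanded w"
proof (induction arbitrary: u rule: expanded.induct)
  case (single x)
  then show ?case by (cases u) (auto intro: expanded.single)
next
  case (zero x r)
  show ?case
  proof (cases u)
    case Nil
    then show ?thesis using zero.prems(1) expanded.zero[OF zero.hyps] by (metis append_Nil)
  next
    case (Cons y u')
    then show ?thesis using zero by (cases u') auto
  qed
next
  case (step x y r)
  then show ?case using expanded.step by (cases u) auto
qed

lemma expanded_zero_suffix: "expanded (u @ 0 # w) \<Longrightarrow> expanded u \<Longrightarrow> expanded w \<and> hd w = last u"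
proof -
  assume *: "expanded (u @ 0 # w)" "expanded u"
  have u: "u \<noteq> []" using expanded_hd[OF *(2)] by blast
  have w: "w \<noteq> []" using expanded_last[OF *(1)] by auto
  define i where "i = length u - 1"
  have i: "Suc i = length u" using u by (simp add: i_def)
  have "(u @ 0 # w) ! Suc i = 0" "(u @ 0 # w) ! i = last u" "(u @ 0 # w) ! Suc (Suc i) = hd w"
    using i u w by (simp_all add: nth_append last_conv_nth i_def hd_conv_nth Suc_diff_le)
  moreover have "Suc (Suc i) < length (u @ 0 # w)" using i w by simp
  ultimately have e: "hd w = last u" "hd w \<in> {-2, 2}" using expanded_zeros[OF *(1), of i] by auto
  then have "expanded w" using expanded_suffix[OF *(1), of "u @ [0]" w] w by auto
  then show ?thesis using e by simp
qed

section \<open>Coding vectors by words\<close>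

fun letter :: "bool \<Rightarrow> int \<Rightarrow> colour" where
  "letter T x = (if x = 0 then Gamma else if T then Alpha else Beta)"

abbreviation end_letter :: "bool \<Rightarrow> colour" where
  "end_letter T \<equiv> if T then Alpha else Beta"

text \<open>
  Adjacent entries of equal sign and of opposite sign must get different codes; the parameter \<open>f\<close>
  says for which of the two the letter \<open>Gamma\<close> is inserted. Both choices are needed: the word
  argument requires that the first change of parity in the shorter vector inserts nothing.
\<close>

definition junction :: "bool \<Rightarrow> int \<Rightarrow> int \<Rightarrow> colour list" where
  "junction f x y = (if x \<noteq> 0 \<and> y \<noteq> 0 \<and> (x = y) \<noteq> f then [Gamma] else [])"

fun code :: "bool \<Rightarrow> bool \<Rightarrow> int list \<Rightarrow> colour list" where
  "code f T [] = []"
| "code f T [x] = [letter T x]"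
| "code f T (x # y # r) = letter T x # junction f x y @ code f (\<not> T) (y # r)"

lemma code_eq_Nil [simp]: "code f T u = [] \<longleftrightarrow> u = []"
  by (cases "(f, T, u)" rule: code.cases) auto

lemma junction_commute: "junction f x y = junction f y x"
  by (auto simp: junction_def)

lemma set_junction: "set (junction f x y) \<subseteq> {Gamma}"
  by (auto simp: junction_def)

lemma rev_junction [simp]: "rev (junction f x y) = junction f x y"
  by (auto simp: junction_def)

lemma junction_0 [simp]: "junction f 0 y = []" "junction f x 0 = []"
  by (auto simp: junction_def)

text \<open>The flag \<open>T = even (length u)\<close> is the parity of the position after
  \<open>u\<close>: it is kept exactly if an even number of entries has been passed.\<close>

lemma code_append:
  "u \<noteq> [] \<Longrightarrow> w \<noteq> [] \<Longrightarrow> code f T (u @ w) = code f T u @ junction f (last u) (hd w) @ code f (T = even (length u)) w"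
proof (induction f T u rule: code.induct)
  case (2 f T x)
  then show ?case by (cases w) auto
qed auto

lemma code_rev: "rev (code f T u) = code f (T = odd (length u)) (rev u)"
proof (induction f T u rule: code.induct)
  case (3 f T x y r)
  have "code f (T = odd (length (x # y # r))) (rev (x # y # r)) =
    code f ((\<not> T) = odd (length (y # r))) (rev (y # r)) @ junction f y x @ [letter T x]"
    using code_append[of "rev (y # r)" "[x]" f "(\<not> T) = odd (length (y # r))"] by auto
  then show ?case using 3 by (simp add: junction_commute)
qed auto

lemma code_scale: "e \<in> {-1, 1} \<Longrightarrow> code f T (scale e u) = code f T u"
  by (induction f T u rule: code.induct) (auto simp: junction_def)

lemma code_flip: "code f (\<not> T) u = map swap (code f T u)"
proof (induction f T u rule: code.induct)
  case (3 f T x y r)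
  have "map swap (junction f x y) = junction f x y" by (simp add: junction_def)
  then show ?case using 3 by simp
qed auto

lemma code_rev_even: "even (length u) \<Longrightarrow> code f T (rev u) = dual (code f T u)"
  using code_rev[of f "\<not> T" u] code_flip[of f T u] by (simp add: dual_def rev_map)

lemma code_hd: "expanded u \<Longrightarrow> hd (code f T u) = end_letter T"
proof (induction rule: expanded.induct)
  case (zero x r)
  then show ?case using expanded_ConsD[OF zero(1)] by auto
qed auto

lemma code_Cons_ex: "expanded (x # r) \<Longrightarrow> \<exists>z. code f T (x # r) = end_letter T # z"
  using code_hd[of "x # r" f T] by (metis code_eq_Nil list.collapse list.distinct(1))

lemma code_distinct_adj: "expanded u \<Longrightarrow> distinct_adj (code f T u)"
proof (induction arbitrary: T rule: expanded.induct)
  case (zero x r)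
  obtain z where "code f T (x # r) = end_letter T # z" using code_Cons_ex[OF zero(1)] by blast
  then show ?case using zero.IH[of T] expanded_ConsD[OF zero(1)] by auto
next
  case (step x y r)
  obtain z where "code f (\<not> T) (y # r) = end_letter (\<not> T) # z" using code_Cons_ex[OF step(2)] by blast
  then show ?case using step.IH[of "\<not> T"] step(1) by (auto simp: junction_def)
qed auto

lemma code_last: "expanded u \<Longrightarrow> last (code f T u) = end_letter (T = odd (length u))"
proof -
  assume u: "expanded u"
  then have "code f T u \<noteq> []" using expanded_hd by auto
  then have "last (code f T u) = hd (rev (code f T u))" by (simp add: hd_rev)
  also have "\<dots> = end_letter (T = odd (length u))" unfolding code_rev using code_hd[OF expanded_rev[OF u]] .
  finally show ?thesis .
qed

lemma code_valid: "expanded u \<Longrightarrow> valid (code f True u) \<longleftrightarrow> even (length u)"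
  using code_distinct_adj code_hd code_last expanded_hd by (auto simp: valid_def)

text \<open>The letter after a \<open>Gamma\<close> tells what the \<open>Gamma\<close> is: a zero
  entry is followed by the same letter that precedes it, a junction by the other one. Presence or
  absence of a junction fixes the sign of the next entry relative to the last one.\<close>

lemma code_prefix:
  "expanded u \<Longrightarrow> expanded c \<Longrightarrow> hd c = hd u \<Longrightarrow> code f T c = code f T u @ z \<Longrightarrow> \<exists>r. c = u @ r"
proof (induction arbitrary: c T rule: expanded.induct)
  case (single x)
  then show ?case using expanded_hd by (cases c) auto
next
  case (zero x r)
  obtain z' where z': "code f T (x # r) = end_letter T # z'" using code_Cons_ex[OF zero(1)] by blast
  have x: "x \<noteq> 0" using expanded_ConsD[OF zero(1)] by auto
  from zero(3) show ?case
  proof (cases rule: expanded.cases)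
    case (zero y r')
    then show ?thesis using zero.prems zero.IH[of "x # r'" T] x by auto
  next
    case (step x' y r')
    obtain w where "code f (\<not> T) (y # r') = end_letter (\<not> T) # w" using code_Cons_ex[OF step(3)] by blast
    then show ?thesis using zero.prems step z' x by (auto simp: junction_def split: if_splits)
  qed (use zero.prems in auto)
next
  case (step x y r)
  obtain z' where z': "code f (\<not> T) (y # r) = end_letter (\<not> T) # z'" using code_Cons_ex[OF step(2)] by blast
  from step(4) show ?case
  proof (cases rule: expanded.cases)
    case (zero x' r')
    obtain w where "code f T (x' # r') = end_letter T # w" using code_Cons_ex[OF zero(2)] by blast
    then show ?thesis using step.prems zero z' by (auto simp: junction_def split: if_splits)
  next
    case (step x' y' r')
    obtain w where w: "code f (\<not> T) (y' # r') = end_letter (\<not> T) # w" using code_Cons_ex[OF step(3)] by blast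
    have "x' = x" using step.prems step(1) by simp
    then have j: "junction f x y' @ code f (\<not> T) (y' # r') = junction f x y @ code f (\<not> T) (y # r) @ z"
      using step.prems step(1) by simp
    then have jj: "junction f x y' = junction f x y" unfolding w z' by (auto simp: junction_def split: if_splits)
    have "y \<in> {-2, 2}" "y' \<in> {-2, 2}" "x \<in> {-2, 2}" using expanded_ConsD step.hyps step(3) by blast+
    then have "y' = y" using jj by (auto simp: junction_def split: if_splits)
    moreover obtain t where "y' # r' = (y # r) @ t" using step.IH[OF step(3)] j jj \<open>y' = y\<close> by auto
    ultimately show ?thesis using step(1) \<open>x' = x\<close> by auto
  qed (use step.prems in auto)
qed

lemma sign_exists: "x \<in> {-2, 2} \<Longrightarrow> y \<in> {-2, 2} \<Longrightarrow> \<exists>e\<in>{-1, 1}. (x::int) = e * y"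
  by auto

lemma code_injective:
  assumes "expanded u" "expanded c" "code f T c = code f T u"
  shows "\<exists>e\<in>{-1, 1}. c = scale e u"
proof -
  obtain e where e: "e \<in> {-1, 1}" "hd c = e * hd u" using sign_exists expanded_hd assms(1,2) by metis
  have "expanded (scale e u)" using expanded_scale assms(1) e by blast
  moreover have "hd c = hd (scale e u)" using hd_scale e expanded_hd[OF assms(1)] by simp
  moreover have "code f T c = code f T (scale e u) @ []" using code_scale[OF e(1)] assms(3) by simp
  ultimately obtain r where r: "c = scale e u @ r" using code_prefix[OF _ assms(2)] by blast
  have "r = []"
  proof (rule ccontr)
    assume "r \<noteq> []"
    then have "code f T c = code f T (scale e u) @ junction f (last (scale e u)) (hd r) @ code f (T = even (length (scale e u))) r"
      using code_append[of "scale e u" r f T] r expanded_hd[OF assms(1)] by simp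
    then show False using assms(3) code_scale[OF e(1)] \<open>r \<noteq> []\<close> by simp
  qed
  then show ?thesis using r e(1) by auto
qed

text \<open>The next two letters show whether an entry of the other parity or a zero follows. The
  sign of a new nonzero entry is chosen so that its junction is present or absent as the word
  demands.\<close>

lemma decode:
  "distinct_adj w \<Longrightarrow> w \<noteq> [] \<Longrightarrow> hd w = end_letter T \<Longrightarrow> last w \<noteq> Gamma \<Longrightarrow> x \<in> {-2, 2} \<Longrightarrow>
    \<exists>u. expanded u \<and> hd u = x \<and> code f T u = w"
proof (induction "length w" arbitrary: w T x rule: less_induct)
  case less
  obtain w' where w: "w = end_letter T # w'" using less.prems(2,3) by (metis list.collapse)
  have x0: "x \<noteq> 0" "- x \<in> {-2, 2}" using less.prems(5) by auto
  show ?case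
  proof (cases w')
    case Nil
    then show ?thesis using w x0 expanded.single[OF less.prems(5)] by (intro exI[of _ "[x]"]) auto
  next
    case (Cons d w'')
    have w'p: "distinct_adj w'" "last w' = last w" using less.prems(1) w Cons by auto
    have "d \<noteq> end_letter T" using less.prems(1) w Cons by auto
    then have "d = end_letter (\<not> T) \<or> d = Gamma" by (cases d; cases T) auto
    then show ?thesis
    proof
      assume d: "d = end_letter (\<not> T)"
      define y where "y = (if f then x else - x)"
      have "y \<in> {-2, 2}" using less.prems(5) x0 by (auto simp: y_def)
      moreover have "hd w' = end_letter (\<not> T)" using d Cons by simp
      ultimately obtain u where u: "expanded u" "hd u = y" "code f (\<not> T) u = w'"
        using less.hyps[of w' "\<not> T" y] w Cons less.prems(4) w'p by fastforce
      obtain r where r: "u = y # r" using u expanded_hd by (metis list.collapse)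
      have "junction f x y = []" using x0 by (auto simp: junction_def y_def)
      then have "code f T (x # u) = w" using r u w x0 by auto
      then show ?thesis using expanded.step[OF less.prems(5)] u r by (intro exI[of _ "x # u"]) auto
    next
      assume d: "d = Gamma"
      then obtain g w3 where g: "w'' = g # w3" using Cons less.prems(4) w by (cases w'') auto
      have w''p: "distinct_adj w''" "last w'' = last w" using w'p Cons g by auto
      have "g \<noteq> Gamma" using w'p(1) Cons d g by auto
      then have "g = end_letter T \<or> g = end_letter (\<not> T)" by (cases g; cases T) auto
      then show ?thesis
      proof
        assume gT: "g = end_letter T"
        then have "hd w'' = end_letter T" using g by simp
        then obtain u where u: "expanded u" "hd u = x" "code f T u = w''"
          using less.hyps[of w'' T x] w Cons less.prems(4,5) w''p g by fastforce
        obtain r where r: "u = x # r" using u expanded_hd by (metis list.collapse)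
        have "code f T (x # 0 # u) = w" using r u w x0 Cons d by auto
        then show ?thesis using expanded.zero u r by (intro exI[of _ "x # 0 # u"]) auto
      next
        assume gT: "g = end_letter (\<not> T)"
        define y where "y = (if f then - x else x)"
        have "y \<in> {-2, 2}" using less.prems(5) x0 by (auto simp: y_def)
        moreover have "hd w'' = end_letter (\<not> T)" using gT g by simp
        ultimately obtain u where u: "expanded u" "hd u = y" "code f (\<not> T) u = w''"
          using less.hyps[of w'' "\<not> T" y] w Cons less.prems(4) w''p g by fastforce
        obtain r where r: "u = y # r" using u expanded_hd by (metis list.collapse)
        have "junction f x y = [Gamma]" using x0 less.prems(5) by (auto simp: junction_def y_def)
        then have "code f T (x # u) = w" using r u w x0 Cons d by auto
        then show ?thesis using expanded.step[OF less.prems(5)] u r by (intro exI[of _ "x # u"]) auto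
      qed
    qed
  qed
qed

section \<open>Boldface vectors as runs\<close>

definition run :: "int \<Rightarrow> nat \<Rightarrow> int list" where
  "run x j = x # concat (replicate j [0, x])"

lemma run_0: "run x 0 = [x]" and run_Suc: "run x (Suc j) = x # 0 # run x j"
  by (simp_all add: run_def)

lemma run_ne [simp]: "run x j \<noteq> []" and hd_run [simp]: "hd (run x j) = x"
  by (simp_all add: run_def)

lemma last_run [simp]: "last (run x j) = x"
  by (induction j) (auto simp: run_0 run_Suc)

lemma odd_run [simp]: "odd (length (run x j))"
  by (induction j) (auto simp: run_0 run_Suc)

lemma rev_run: "rev (run x j) = run x j"
proof -
  have "run x j = concat (replicate j ([x] @ [0])) @ [x]"
    using replicate_shift[of j "[x]" "[0]"] by (simp add: run_def)
  then show ?thesis by (simp add: run_def rev_concat)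
qed

lemma expanded_run: "x \<in> {-2, 2} \<Longrightarrow> expanded (run x j)"
proof (induction j)
  case (Suc j)
  then show ?case using expanded.zero by (auto simp: run_Suc run_def)
qed (auto simp: run_0 intro: expanded.single)

lemma bold_run: "k \<noteq> 0 \<Longrightarrow> bold (2 * k) = run (2 * sgn k) (nat \<bar>k\<bar> - 1)"
  by (simp add: bold_def run_def abs_mult sgn_mult)

lemma bold_0: "bold 0 = [0]"
  by (simp add: bold_def)

lemma bold_cases: "bold (2 * k) = [0] \<and> k = 0 \<or> (\<exists>x j. x \<in> {-2, 2} \<and> bold (2 * k) = run x j \<and> k \<noteq> 0)"
proof (cases "k = 0")
  case False
  then have "2 * sgn k \<in> {-2, 2}" by (auto simp: sgn_if)
  then show ?thesis using bold_run[OF False] False by blast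
qed (simp add: bold_0)

lemma run_bold: "x \<in> {-2, 2} \<Longrightarrow> \<exists>k. k \<noteq> 0 \<and> bold (2 * k) = run x j"
proof -
  assume x: "x \<in> {-2, 2}"
  define k where "k = sgn x * int (Suc j)"
  have "k \<noteq> 0" "2 * sgn k = x" "nat \<bar>k\<bar> - 1 = j"
    using x by (auto simp: k_def sgn_mult abs_mult)
  then show ?thesis using bold_run[of k] by metis
qed

lemma bold_ne [simp]: "bold m \<noteq> []"
  by (simp add: bold_def)

lemma odd_bold: "odd (length (bold (2 * k)))"
  using bold_cases[of k] by auto

lemma rev_bold: "rev (bold (2 * k)) = bold (2 * k)"
  using bold_cases[of k] rev_run by auto

lemma code_run: "x \<noteq> 0 \<Longrightarrow> code f T (run x j) = end_letter T # concat (replicate j [Gamma, end_letter T])"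
proof (induction j)
  case (Suc j)
  have "code f T (run x (Suc j)) = end_letter T # Gamma # code f T (run x j)" using Suc.prems by (simp add: run_Suc run_def)
  then show ?case using Suc by simp
qed (simp add: run_0)

lemma code_bold: "end_letter (\<not> T) \<notin> set (code f T (bold (2 * k)))"
proof -
  have "set (code f T (run x j)) \<subseteq> {Gamma, end_letter T}" if "x \<noteq> 0" for x j
    using code_run[OF that, of f T j] by (cases j) auto
  then have r: "end_letter (\<not> T) \<notin> set (code f T (run x j))" if "x \<noteq> 0" for x j using that by (cases T) fastforce+
  from bold_cases[of k] show ?thesis
  proof (elim disjE exE conjE)
    fix x j assume "x \<in> {-2, 2::int}" "bold (2 * k) = run x j"
    then show ?thesis using r[of x j] by auto
  qed simp
qed

section \<open>Parsings as walks\<close>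

definition orient :: "int list \<Rightarrow> bool \<Rightarrow> int list" where
  "orient a T = (if T then a else rev a)"

text \<open>A recursive form of parsing. With the sign \<open>e\<close> of the next block as a
  parameter, the condition at a zero gap relates two consecutive stages only.\<close>

inductive blocks :: "int list \<Rightarrow> bool \<Rightarrow> int \<Rightarrow> int list \<Rightarrow> bool" for a where
  final: "e \<in> {-1, 1} \<Longrightarrow> blocks a T e (scale e (orient a T))"
| more: "e \<in> {-1, 1} \<Longrightarrow> (k = 0 \<Longrightarrow> e = e') \<Longrightarrow> blocks a (\<not> T) e' c \<Longrightarrow>
    blocks a T e (scale e (orient a T) @ bold (2 * k) @ c)"

definition blocks_list :: "int list \<Rightarrow> bool \<Rightarrow> nat \<Rightarrow> (nat \<Rightarrow> int) \<Rightarrow> (nat \<Rightarrow> int) \<Rightarrow> int list" where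
  "blocks_list a T n \<epsilon> k = scale (\<epsilon> 1) (orient a T) @
    concat (map (\<lambda>i. bold (2 * k i) @ scale (\<epsilon> (i + 1)) (orient a (odd (i + 1) = T))) [1..<n])"

lemma blocks_list_Suc:
  assumes "n \<ge> 1"
  shows "blocks_list a T (Suc n) \<epsilon> k = scale (\<epsilon> 1) (orient a T) @ bold (2 * k 1) @
    blocks_list a (\<not> T) n (\<lambda>i. \<epsilon> (Suc i)) (\<lambda>i. k (Suc i))"
proof -
  have u: "[1..<Suc n] = 1 # map Suc [1..<n]" using assms by (simp add: map_Suc_upt upt_conv_Cons)
  show ?thesis unfolding blocks_list_def u
    by (simp add: comp_def) (rule arg_cong[where f = concat], rule map_cong[OF refl], cases T, auto)
qed

lemma blocks_imp_list:
  "blocks a T e c \<Longrightarrow> \<exists>n \<epsilon> k. n \<ge> 1 \<and> \<epsilon> 1 = e \<and> (\<forall>i\<in>{1..n}. \<epsilon> i \<in> {-1, 1}) \<and>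
    (\<forall>i\<in>{1..<n}. k i = 0 \<longrightarrow> \<epsilon> i = \<epsilon> (i + 1)) \<and> c = blocks_list a T n \<epsilon> k"
proof (induction rule: blocks.induct)
  case (final e T)
  have "scale e (orient a T) = blocks_list a T 1 (\<lambda>_. e) (\<lambda>_. 0)" by (simp add: blocks_list_def)
  then show ?case using final
    by (intro exI[of _ 1] exI[of _ "\<lambda>_. e"] exI[of _ "\<lambda>_. 0"]) auto
next
  case (more e k e' T c)
  obtain n \<epsilon> k' where *: "n \<ge> 1" "\<epsilon> 1 = e'" "\<forall>i\<in>{1..n}. \<epsilon> i \<in> {-1, 1}"
    "\<forall>i\<in>{1..<n}. k' i = 0 \<longrightarrow> \<epsilon> i = \<epsilon> (i + 1)" "c = blocks_list a (\<not> T) n \<epsilon> k'"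
    using more.IH by blast
  define \<epsilon>' where "\<epsilon>' i = (if i = 1 then e else \<epsilon> (i - 1))" for i
  define k'' where "k'' i = (if i = 1 then k else k' (i - 1))" for i
  have bl: "blocks_list a (\<not> T) n (\<lambda>i. \<epsilon>' (Suc i)) (\<lambda>i. k'' (Suc i)) = blocks_list a (\<not> T) n \<epsilon> k'"
    unfolding blocks_list_def using *(1) by (auto simp: \<epsilon>'_def k''_def intro!: arg_cong[where f = concat])
  have "scale e (orient a T) @ bold (2 * k) @ c = blocks_list a T (Suc n) \<epsilon>' k''"
    unfolding blocks_list_Suc[OF *(1)] bl *(5) by (simp add: \<epsilon>'_def k''_def)
  moreover have "\<epsilon>' i \<in> {-1, 1}" if "i \<in> {1..Suc n}" for i
  proof (cases "i = 1")
    case True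
    then show ?thesis using more(1) by (simp add: \<epsilon>'_def)
  next
    case False
    then have "i - 1 \<in> {1..n}" using that by auto
    then show ?thesis using *(3) False by (simp add: \<epsilon>'_def)
  qed
  moreover have "k'' i = 0 \<longrightarrow> \<epsilon>' i = \<epsilon>' (i + 1)" if "i \<in> {1..<Suc n}" for i
  proof (cases "i = 1")
    case True
    then show ?thesis using more(2) *(1,2) by (simp add: \<epsilon>'_def k''_def)
  next
    case False
    then have "i - 1 \<in> {1..<n}" "i - 1 + 1 = i" using that by auto
    then show ?thesis using *(4) False by (auto simp: \<epsilon>'_def k''_def)
  qed
  moreover have "\<epsilon>' 1 = e" by (simp add: \<epsilon>'_def)
  ultimately show ?case by (intro exI[of _ "Suc n"] exI[of _ \<epsilon>'] exI[of _ k'']) auto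
qed

lemma list_imp_blocks:
  "n \<ge> 1 \<Longrightarrow> (\<forall>i\<in>{1..n}. \<epsilon> i \<in> {-1, 1}) \<Longrightarrow> (\<forall>i\<in>{1..<n}. k i = 0 \<longrightarrow> \<epsilon> i = \<epsilon> (i + 1)) \<Longrightarrow>
    blocks a T (\<epsilon> 1) (blocks_list a T n \<epsilon> k)"
proof (induction n arbitrary: T \<epsilon> k rule: dec_induct)
  case base
  then have "\<epsilon> 1 \<in> {-1, 1}" by simp
  then show ?case using blocks.final by (simp add: blocks_list_def)
next
  case (step n)
  have "\<epsilon> (Suc i) \<in> {-1, 1}" if "i \<in> {1..n}" for i using step.prems(1) that by auto
  moreover have "k (Suc i) = 0 \<longrightarrow> \<epsilon> (Suc i) = \<epsilon> (Suc (i + 1))" if "i \<in> {1..<n}" for i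
    using step.prems(2) that by force
  ultimately have "blocks a (\<not> T) (\<epsilon> (Suc 1)) (blocks_list a (\<not> T) n (\<lambda>i. \<epsilon> (Suc i)) (\<lambda>i. k (Suc i)))"
    using step.IH[of "\<lambda>i. \<epsilon> (Suc i)" "\<lambda>i. k (Suc i)"] by blast
  moreover have "\<epsilon> 1 \<in> {-1, 1}" using step.prems(1) by auto
  moreover have "k 1 = 0 \<Longrightarrow> \<epsilon> 1 = \<epsilon> (Suc 1)" using step.prems(2) step.hyps by force
  ultimately show ?case unfolding blocks_list_Suc[OF step.hyps(1)] by (rule blocks.more[rotated 2])
qed

lemma parses_iff: "parses c a \<longleftrightarrow> a \<in> S \<and> c \<in> S \<and> blocks a True 1 c"
proof -
  have pb: "blocks_list a True n \<epsilon> k = parse_block a \<epsilon> 1 @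
      concat (map (\<lambda>i. bold (2 * k i) @ parse_block a \<epsilon> (i + 1)) [1..<n])" for n \<epsilon> k
    by (simp add: blocks_list_def parse_block_def orient_def)
  show ?thesis unfolding parses_def pb[symmetric]
    using blocks_imp_list[of a True 1 c] list_imp_blocks[of _ _ _ a True] by metis
qed

text \<open>Blocks have even and gaps odd length. The parity of the position therefore tells whether
  the next block runs forwards, from state 0, or backwards, from the right end, and one flag
  \<open>T\<close> serves for the letters and for the direction.\<close>

definition source :: "colour list \<Rightarrow> bool \<Rightarrow> nat" where
  "source A T = (if T then 0 else length A)"

lemma source_complete:
  assumes "valid A" "distinct_adj w" "path A (source A T) w (length A)" "hd w = end_letter T" "w \<noteq> []"
  shows "\<exists>w'. w = (if T then A else rev A) @ w' \<and> path A (source A (\<not> T)) w' (length A)"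
  using up_complete[OF assms(1,2)] down_complete[OF assms(1,2)] assms(3-5)
  by (cases T) (simp_all add: source_def)

lemma source_block: "path A (source A T) (if T then A else rev A) (source A (\<not> T))"
  using path_take[of "length A" A] path_rev[of A "length A" A 0] by (simp add: source_def)

lemma source_loops: "end_letter (\<not> T) \<notin> set g \<Longrightarrow> path A (source A (\<not> T)) g (source A (\<not> T))"
  by (induction g) (auto simp: source_def edge_def)

lemma source_skip:
  "valid A \<Longrightarrow> path A (source A (\<not> T)) (g @ w) t \<Longrightarrow> end_letter (\<not> T) \<notin> set g \<Longrightarrow> path A (source A (\<not> T)) w t"
  using path_start_loops[of A g w t] path_end_loops[of A g w t] by (cases T) (simp_all add: source_def)

lemma length_orient [simp]: "length (orient a T) = length a"
  by (simp add: orient_def)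

lemma expanded_orient: "expanded a \<Longrightarrow> expanded (orient a T)"
  by (simp add: orient_def expanded_rev)

lemma last_orient: "a \<noteq> [] \<Longrightarrow> hd (orient a (\<not> T)) = last (orient a T)"
  by (simp add: orient_def hd_rev last_rev)

lemma code_orient:
  "even (length a) \<Longrightarrow> code f T (orient a T) = (if T then code f True a else rev (code f True a))"
  using code_rev[of f True a] by (simp add: orient_def)

lemma blocks_sign: "blocks a T e c \<Longrightarrow> e \<in> {-1, 1}"
  by (induction rule: blocks.induct) auto

lemma blocks_hd: "blocks a T e c \<Longrightarrow> a \<noteq> [] \<Longrightarrow> c \<noteq> [] \<and> hd c = e * hd (orient a T)"
proof -
  assume *: "blocks a T e c" "a \<noteq> []"
  then have "orient a T \<noteq> []" by (simp add: orient_def)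
  with *(1) show ?thesis by (cases rule: blocks.cases) (simp_all add: hd_scale)
qed

lemma code_append_bold:
  assumes "u \<noteq> []" "even (length u)" "c \<noteq> []"
  shows "code f T (u @ bold (2 * k) @ c) = code f T u @
    (junction f (last u) (hd (bold (2 * k))) @ code f T (bold (2 * k)) @ junction f (last (bold (2 * k))) (hd c)) @
    code f (\<not> T) c"
proof -
  have "code f T (u @ bold (2 * k) @ c) = code f T u @ junction f (last u) (hd (bold (2 * k))) @ code f T (bold (2 * k) @ c)"
    using code_append[of u "bold (2 * k) @ c" f T] assms by simp
  moreover have "code f T (bold (2 * k) @ c) = code f T (bold (2 * k)) @ junction f (last (bold (2 * k))) (hd c) @ code f (\<not> T) c"
    using code_append[of "bold (2 * k)" c f T] assms odd_bold by simp
  ultimately show ?thesis by simp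
qed

lemma gap_letters: "end_letter (\<not> T) \<notin> set (junction f x y @ code f T (bold (2 * k)) @ junction f x' y')"
proof -
  have "end_letter (\<not> T) \<noteq> Gamma" by simp
  then show ?thesis using code_bold[of T f k] set_junction[of f x y] set_junction[of f x' y'] by auto
qed

text \<open>A block carries the walk from one end to the other. A gap with the junctions on both its
  sides avoids the one letter that leaves this end, so it is spent on loops.\<close>

lemma blocks_path:
  assumes "expanded a" "even (length a)"
  shows "blocks a T e c \<Longrightarrow> expanded c \<Longrightarrow> even (length c) = T \<Longrightarrow>
    path (code f True a) (source (code f True a) T) (code f T c) (length (code f True a))"
proof (induction rule: blocks.induct)
  case (final e T)
  then have "T" using assms(2) by simp
  then show ?case
    using source_block[of "code f True a" True] code_scale[OF final(1), of f T] code_orient[OF assms(2), of f T]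
    by (simp add: source_def orient_def)
next
  case (more e k e' T c)
  let ?A = "code f True a" and ?u = "scale e (orient a T)"
  have a: "a \<noteq> []" using expanded_hd assms(1) by blast
  have c: "c \<noteq> []" "hd c = e' * hd (orient a (\<not> T))" using blocks_hd[OF more.hyps(3) a] by auto
  have "hd (orient a (\<not> T)) \<noteq> 0" using expanded_hd[OF expanded_orient[OF assms(1)], of "\<not> T"] by auto
  then have "hd c \<noteq> 0" using c(2) blocks_sign[OF more.hyps(3)] by auto
  then have vc: "expanded c" using expanded_suffix[OF more.prems(1), of "?u @ bold (2 * k)" c] c by simp
  have "even (length c) = (\<not> T)" using more.prems(2) assms(2) odd_bold[of k] by auto
  then have IH: "path ?A (source ?A (\<not> T)) (code f (\<not> T) c) (length ?A)" using more.IH vc by blast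
  have u: "?u \<noteq> []" "even (length ?u)" using a assms(2) by (simp_all add: orient_def)
  have "code f T ?u = (if T then ?A else rev ?A)" using code_scale[OF more.hyps(1)] code_orient[OF assms(2)] by simp
  then have 1: "path ?A (source ?A T) (code f T ?u) (source ?A (\<not> T))" using source_block[of ?A T] by simp
  let ?g = "junction f (last ?u) (hd (bold (2 * k))) @ code f T (bold (2 * k)) @ junction f (last (bold (2 * k))) (hd c)"
  have 2: "path ?A (source ?A (\<not> T)) ?g (source ?A (\<not> T))" by (rule source_loops[OF gap_letters])
  have "path ?A (source ?A T) (code f T ?u @ ?g @ code f (\<not> T) c) (length ?A)"
    using 1 2 IH path_append by blast
  then show ?case unfolding code_append_bold[OF u c(1)] .
qed

lemma expanded_split_run:
  "expanded r \<Longrightarrow> end_letter (\<not> T) \<in> set (code f T r) \<Longrightarrow> \<exists>x j r'. x \<in> {-2, 2} \<and> r = run x j @ r' \<and> expanded r'"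
proof (induction rule: expanded.induct)
  case (zero x r)
  have x: "x \<noteq> 0" using expanded_ConsD[OF zero(1)] by auto
  have "set (code f T (x # 0 # x # r)) = {end_letter T, Gamma} \<union> set (code f T (x # r))" using x by auto
  then have "end_letter (\<not> T) \<in> set (code f T (x # r))" using zero.prems by auto
  then obtain x' j r' where r: "x' \<in> {-2, 2}" "x # r = run x' j @ r'" "expanded r'" using zero.IH by blast
  then have "x' = x" by (simp add: run_def)
  then have "x # 0 # x # r = run x (Suc j) @ r'" using r(2) by (simp add: run_Suc)
  then show ?case using r \<open>x' = x\<close> by blast
next
  case (step x y r)
  then show ?case using run_0[of x] by (metis append_Cons append_Nil)
next
  case (single x)
  then show ?case by (cases T) auto
qed

lemma gap_split:
  assumes "expanded u" "expanded (u @ r)" "end_letter (\<not> T) \<in> set (code f T r)"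
  shows "\<exists>k r'. r = bold (2 * k) @ r' \<and> expanded r' \<and> (k = 0 \<longrightarrow> hd r' = last u)"
proof -
  have r: "r \<noteq> []" using assms(3) by auto
  show ?thesis
  proof (cases "hd r = 0")
    case True
    then obtain r' where "r = 0 # r'" using r by (metis list.collapse)
    then have "r = bold (2 * 0) @ r'" "expanded r' \<and> hd r' = last u"
      using expanded_zero_suffix[of u r'] assms by (simp_all add: bold_0)
    then show ?thesis by blast
  next
    case False
    then have "expanded r" using expanded_suffix[OF assms(2) refl r] by blast
    then obtain x j r' where x: "x \<in> {-2, 2}" "r = run x j @ r'" "expanded r'" using expanded_split_run[OF _ assms(3)] by blast
    then show ?thesis using run_bold[OF x(1), of j] by metis
  qed
qed

text \<open>The walk has to read a whole block before it can turn, and by \<open>code_prefix\<close>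
  the vector then starts with that block up to sign. The sign rule at a zero gap is the rule that a
  zero entry has equal neighbours.\<close>

lemma path_blocks:
  assumes a: "expanded a" "even (length a)"
  shows "expanded c \<Longrightarrow> even (length c) = T \<Longrightarrow>
    path (code f True a) (source (code f True a) T) (code f T c) (length (code f True a)) \<Longrightarrow>
    \<exists>e\<in>{-1, 1}. hd c = e * hd (orient a T) \<and> blocks a T e c"
proof (induction "length c" arbitrary: c T rule: less_induct)
  case less
  let ?A = "code f True a"
  have vA: "valid ?A" using code_valid a by blast
  have ane: "a \<noteq> []" using expanded_hd a(1) by blast
  note vo = expanded_orient[OF a(1), of T]
  obtain e where e: "e \<in> {-1, 1}" "hd c = e * hd (orient a T)"
    using sign_exists expanded_hd less.prems(1) vo by metis
  let ?u = "scale e (orient a T)"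
  have u: "expanded ?u" using expanded_scale[OF vo e(1)] .
  have une: "?u \<noteq> []" using expanded_hd[OF u] by blast
  have cu: "code f T ?u = (if T then ?A else rev ?A)" using code_scale[OF e(1)] code_orient[OF a(2)] by simp
  have "code f T c \<noteq> []" using expanded_hd[OF less.prems(1)] by simp
  then obtain w' where w': "code f T c = code f T ?u @ w'" "path ?A (source ?A (\<not> T)) w' (length ?A)"
    using source_complete[OF vA code_distinct_adj[OF less.prems(1)] less.prems(3) code_hd[OF less.prems(1)]] cu by metis
  have "hd c = hd ?u" using e(2) hd_scale[of "orient a T" e] expanded_hd[OF vo] by simp
  then obtain r where r: "c = ?u @ r" using code_prefix[OF u less.prems(1) _ w'(1)] by blast
  show ?case
  proof (cases "r = []")
    case True
    then show ?thesis using r e blocks.final[OF e(1)] by auto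
  next
    case False
    have ev: "even (length ?u)" using a(2) by simp
    have wr: "w' = junction f (last ?u) (hd r) @ code f T r"
      using code_append[OF une False, of f T] r w'(1) ev by simp
    \<comment> \<open>The walk has to leave the end it has reached: on loops alone,
      \<open>w'\<close> could not end with \<open>Beta\<close> at the right end, and could not get
      away from state 0 at the left end.\<close>
    have "end_letter (\<not> T) \<in> set w'"
    proof (rule ccontr)
      assume *: "end_letter (\<not> T) \<notin> set w'"
      show False
      proof (cases T)
        case True
        have "last w' = last (code f T c)" using wr False w'(1) by simp
        also have "\<dots> = Beta" using code_last[OF less.prems(1), of f T] less.prems(2) True by simp
        finally show False using * wr False True by (metis code_eq_Nil append_is_Nil_conv last_in_set)
      next
        case F: False
        have "path ?A (source ?A (\<not> T)) w' (source ?A (\<not> T))" using source_loops[OF *] .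
        then have "length ?A = source ?A (\<not> T)" using path_det[OF vA w'(2)] by blast
        then show False using F validD(7)[OF vA] by (simp add: source_def)
      qed
    qed
    then have "end_letter (\<not> T) \<in> set (code f T r)" using wr set_junction[of f "last ?u" "hd r"] by (auto split: if_splits)
    then obtain k r' where k: "r = bold (2 * k) @ r'" "expanded r'" "k = 0 \<longrightarrow> hd r' = last ?u"
      using gap_split[OF u] less.prems(1) r by metis
    have r'ne: "r' \<noteq> []" using expanded_hd k(2) by blast
    let ?g = "junction f (last ?u) (hd (bold (2 * k))) @ code f T (bold (2 * k)) @ junction f (last (bold (2 * k))) (hd r')"
    have "w' = ?g @ code f (\<not> T) r'" using code_append_bold[OF une ev r'ne, of f T k] r k(1) w'(1) by simp
    then have "path ?A (source ?A (\<not> T)) (code f (\<not> T) r') (length ?A)"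
      using source_skip[OF vA _ gap_letters] w'(2) by metis
    moreover have "length r' < length c" using r une by (simp add: k(1))
    moreover have "even (length r') = (\<not> T)" using less.prems(2) r k(1) a(2) odd_bold[of k] by auto
    ultimately obtain e' where e': "e' \<in> {-1, 1}" "hd r' = e' * hd (orient a (\<not> T))" "blocks a (\<not> T) e' r'"
      using less.hyps[of r' "\<not> T"] k(2) by blast
    have "e = e'" if "k = 0"
    proof -
      have "e' * hd (orient a (\<not> T)) = e * hd (orient a (\<not> T))"
        using k(3) that e'(2) last_orient[OF ane] last_scale[of "orient a T" e] expanded_hd[OF vo] by simp
      moreover have "hd (orient a (\<not> T)) \<noteq> 0" using expanded_hd[OF expanded_orient[OF a(1)], of "\<not> T"] by auto
      ultimately show ?thesis by simp
    qed
    then have "blocks a T e (?u @ bold (2 * k) @ r')" using blocks.more[OF e(1) _ e'(3)] by blast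
    then show ?thesis using e r k(1) by auto
  qed
qed

section \<open>Equivalence classes of vectors\<close>

lemma S_scale: "a \<in> S \<Longrightarrow> e \<in> {-1, 1} \<Longrightarrow> scale e a \<in> S"
  and S_rev: "a \<in> S \<Longrightarrow> rev a \<in> S"
  unfolding S_iff using expanded_scale expanded_rev by auto

lemma scale_flip:
  "e \<in> {-1, 1} \<Longrightarrow> b = scale e a \<or> b = scale e (rev a) \<Longrightarrow> a = scale e b \<or> a = scale e (rev b)"
proof -
  assume e: "e \<in> {-1, 1}" and b: "b = scale e a \<or> b = scale e (rev a)"
  have "scale e (scale e u) = u" for u using e by auto
  then show ?thesis using b by (metis rev_rev_ident scale_simps(7))
qed

lemma mem_vec_class:
  assumes "a \<in> S"
  shows "b \<in> vec_class a \<longleftrightarrow> (\<exists>e\<in>{-1, 1}. b = scale e a \<or> b = scale e (rev a))"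
proof
  assume "b \<in> vec_class a"
  then have "\<exists>e\<in>{-1, 1}. a = scale e b \<or> a = scale e (rev b)"
    by (simp only: vec_class_def vec_equiv_def Image_singleton_iff mem_Collect_eq prod.case)
  then obtain e where e: "e \<in> {-1, 1}" "a = scale e b \<or> a = scale e (rev b)" by blast
  then have "b = scale e a \<or> b = scale e (rev a)" using scale_flip by blast
  then show "\<exists>e\<in>{-1, 1}. b = scale e a \<or> b = scale e (rev a)" using e(1) by blast
next
  assume "\<exists>e\<in>{-1, 1}. b = scale e a \<or> b = scale e (rev a)"
  then obtain e where e: "e \<in> {-1, 1}" "b = scale e a \<or> b = scale e (rev a)" by blast
  then have "a = scale e b \<or> a = scale e (rev b)" using scale_flip by blast
  moreover have "b \<in> S" using e S_scale S_rev assms by metis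
  ultimately show "b \<in> vec_class a" using assms e(1) by (auto simp: vec_class_def vec_equiv_def)
qed

lemma self_vec_class: "a \<in> S \<Longrightarrow> a \<in> vec_class a"
  using mem_vec_class[of a a] by (metis insertI1 insertI2 scale_simps(5))

lemma vec_class_eq: "a \<in> S \<Longrightarrow> b \<in> vec_class a \<Longrightarrow> vec_class b = vec_class a"
proof -
  assume a: "a \<in> S" "b \<in> vec_class a"
  then obtain e where e: "e \<in> {-1, 1}" "b = scale e a \<or> b = scale e (rev a)" using mem_vec_class by blast
  have b: "b \<in> S" using e S_scale S_rev a(1) by metis
  have ee: "e * d \<in> {-1, 1}" if "d \<in> {-1, 1}" for d using e(1) that by auto
  have aa: "a = scale e b \<or> a = scale e (rev b)" using scale_flip[OF e] .
  show ?thesis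
  proof (rule set_eqI)
    fix c
    show "c \<in> vec_class b \<longleftrightarrow> c \<in> vec_class a"
    proof
      assume "c \<in> vec_class b"
      then obtain d where d: "d \<in> {-1, 1}" "c = scale d b \<or> c = scale d (rev b)" using mem_vec_class[OF b] by blast
      then have "c = scale (e * d) a \<or> c = scale (e * d) (rev a)" using e(2) by (auto simp: mult.commute)
      then show "c \<in> vec_class a" using mem_vec_class[OF a(1)] ee[OF d(1)] by blast
    next
      assume "c \<in> vec_class a"
      then obtain d where d: "d \<in> {-1, 1}" "c = scale d a \<or> c = scale d (rev a)" using mem_vec_class[OF a(1)] by blast
      have "c = scale (d * e) b \<or> c = scale (d * e) (rev b)" using d(2) aa by auto
      then show "c \<in> vec_class b" using mem_vec_class[OF b] ee[OF d(1)] by (metis mult.commute)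
    qed
  qed
qed

lemma S_even_vec_class: "a \<in> S_even \<Longrightarrow> b \<in> vec_class a \<Longrightarrow> b \<in> S_even"
  using mem_vec_class[of a b] S_scale S_rev by (auto simp: S_even_def)

lemma S_even_classes_eq: "S_even_classes = vec_class ` S_even"
  by (auto simp: S_even_classes_def quotient_def vec_class_def)

text \<open>A sign leaves the code unchanged and a reversal dualizes it. Dualizing both words
  preserves paths between the ends, so the choice of representatives leaves only the word of
  \<open>a\<close> and its dual to consider.\<close>

lemma class_parses_iff:
  assumes a: "expanded a" "even (length a)" and c: "expanded c" "even (length c)"
  shows "class_parses (vec_class c) (vec_class a) \<longleftrightarrow>
    path (code f True a) 0 (code f True c) (length (code f True a)) \<or>
    path (dual (code f True a)) 0 (code f True c) (length (code f True a))"
proof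
  let ?A = "code f True a" and ?C = "code f True c"
  have S: "a \<in> S" "c \<in> S" using a c S_of_expanded by auto
  {
    assume "class_parses (vec_class c) (vec_class a)"
    then obtain c' a' where *: "c' \<in> vec_class c" "a' \<in> vec_class a" "parses c' a'" by (auto simp: class_parses_def)
    have codes: "expanded u' \<and> even (length u') \<and> (code f True u' = code f True u \<or> code f True u' = dual (code f True u))"
      if h: "u' \<in> vec_class u" "expanded u" "even (length u)" for u u'
    proof -
      obtain e where e: "e \<in> {-1, 1}" "u' = scale e u \<or> u' = scale e (rev u)"
        using mem_vec_class[OF S_of_expanded[OF h(2)]] h(1) by blast
      from e(2) show ?thesis
      proof
        assume u': "u' = scale e u"
        show ?thesis unfolding u' code_scale[OF e(1)] using expanded_scale[OF h(2) e(1)] h(3) by simp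
      next
        assume u': "u' = scale e (rev u)"
        show ?thesis unfolding u' code_scale[OF e(1)] code_rev_even[OF h(3)]
          using expanded_scale[OF expanded_rev[OF h(2)] e(1)] h(3) by simp
      qed
    qed
    note ca = codes[OF *(2) a] and cc = codes[OF *(1) c]
    have "path (code f True a') 0 (code f True c') (length (code f True a'))"
      using blocks_path[of a' True 1 c' f] *(3) ca cc by (simp add: parses_iff source_def)
    moreover have "path (dual X) 0 (dual Y) (length X)" if "path X 0 Y (length X)" for X Y
      using path_dual_rev[OF that] by simp
    ultimately show "path ?A 0 ?C (length ?A) \<or> path (dual ?A) 0 ?C (length ?A)"
      using ca cc by (metis dual_dual length_dual)
  }
  have parse: "\<exists>e\<in>{-1, 1}. parses c (scale e b)"
    if b: "expanded b" "even (length b)" "path (code f True b) 0 ?C (length (code f True b))" for b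
  proof -
    \<comment> \<open>The representative \<open>scale e b\<close> begins with the first entry of
      \<open>c\<close>, which makes the first sign of the parsing 1.\<close>
    obtain e where e: "e \<in> {-1, 1}" "hd c = e * hd b" using sign_exists expanded_hd c(1) b(1) by metis
    let ?b = "scale e b"
    have vb: "expanded ?b" using expanded_scale b(1) e(1) by blast
    have o: "orient ?b True = ?b" by (simp add: orient_def)
    have p: "path (code f True ?b) (source (code f True ?b) True) ?C (length (code f True ?b))"
      unfolding code_scale[OF e(1)] using b(3) by (simp add: source_def)
    have "\<exists>d\<in>{-1, 1}. hd c = d * hd (orient ?b True) \<and> blocks ?b True d c"
      by (rule path_blocks[OF vb _ c(1) _ p]) (use b c in simp_all)
    then obtain d where d: "d \<in> {-1, 1}" "hd c = d * hd ?b" "blocks ?b True d c" unfolding o by blast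
    have "hd c = hd ?b" using e(2) hd_scale expanded_hd[OF b(1)] by simp
    then have "d = 1" using d(1,2) expanded_hd[OF vb] by auto
    then show ?thesis using d(3) e(1) S(2) S_of_expanded[OF vb] parses_iff by blast
  qed
  assume "path ?A 0 ?C (length ?A) \<or> path (dual ?A) 0 ?C (length ?A)"
  then show "class_parses (vec_class c) (vec_class a)"
  proof
    assume "path ?A 0 ?C (length ?A)"
    then show ?thesis using parse[OF a] mem_vec_class[OF S(1)] self_vec_class[OF S(2)] unfolding class_parses_def by blast
  next
    assume "path (dual ?A) 0 ?C (length ?A)"
    then have "path (code f True (rev a)) 0 ?C (length (code f True (rev a)))" using code_rev_even[OF a(2)] by simp
    then show ?thesis using parse[OF expanded_rev[OF a(1)]] a(2) mem_vec_class[OF S(1)] self_vec_class[OF S(2)]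
      unfolding class_parses_def by (metis length_rev)
  qed
qed

section \<open>Codes of powers\<close>

lemma expanded_gap: "expanded u \<Longrightarrow> expanded w \<Longrightarrow> (k = 0 \<Longrightarrow> last u = hd w) \<Longrightarrow> expanded (u @ bold (2 * k) @ w)"
  using bold_cases[of k] expanded_append_zero[of u w] expanded_append[of u] expanded_append[of _ w] expanded_run by fastforce

text \<open>The word of a gap together with its two junctions. One \<open>x\<close> suffices because
  neighbouring blocks of equal sign meet the gap with equal entries.\<close>

definition gap_word :: "bool \<Rightarrow> bool \<Rightarrow> int \<Rightarrow> int \<Rightarrow> colour list" where
  "gap_word f T x k = junction f x (hd (bold (2 * k))) @ code f T (bold (2 * k)) @ junction f (last (bold (2 * k))) x"

lemma rev_gap_word: "rev (gap_word f T x k) = gap_word f T x k"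
proof -
  have "rev (code f T (bold (2 * k))) = code f T (bold (2 * k))"
    using code_rev[of f T "bold (2 * k)"] odd_bold[of k] rev_bold[of k] by simp
  moreover have "hd (bold (2 * k)) = last (bold (2 * k))" using rev_bold[of k] by (metis hd_rev)
  ultimately show ?thesis by (simp add: gap_word_def junction_commute)
qed

lemma gap_word_props: "gap_word f T x k \<noteq> []" "end_letter (\<not> T) \<notin> set (gap_word f T x k)"
  using gap_letters by (simp_all add: gap_word_def)

lemma code_power_step:
  assumes "expanded e" "even (length e)" "expanded c" "hd c = hd e" and w: "w = e @ bold (2 * k) @ rev e @ bold (2 * l)"
    and E: "E = code f True e"
  shows "expanded (w @ c) \<and> hd (w @ c) = hd e \<and>
    code f True (w @ c) = (E @ gap_word f True (last e) k @ rev E @ gap_word f False (hd e) l) @ code f True c"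
proof -
  have e: "e \<noteq> []" and c: "c \<noteq> []" using expanded_hd assms(1,3) by auto
  have v1: "expanded (rev e @ bold (2 * l) @ c)" using expanded_gap[OF expanded_rev[OF assms(1)] assms(3)] assms(4) by (simp add: last_rev)
  have v2: "expanded (e @ bold (2 * k) @ rev e @ bold (2 * l) @ c)"
    using expanded_gap[OF assms(1) v1] e by (simp add: hd_rev)
  have "code f False (rev e @ bold (2 * l) @ c) = rev E @ gap_word f False (hd e) l @ code f True c"
    using code_append_bold[of "rev e" c f False l] e c assms(2,4) code_rev[of f True e] E
    by (simp add: gap_word_def last_rev)
  then have "code f True (e @ bold (2 * k) @ rev e @ bold (2 * l) @ c) =
    E @ gap_word f True (last e) k @ rev E @ gap_word f False (hd e) l @ code f True c"
    using code_append_bold[of e "rev e @ bold (2 * l) @ c" f True k] e assms(2) E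
    by (simp add: gap_word_def hd_rev)
  then show ?thesis using v2 w e by simp
qed

lemma code_power:
  assumes "expanded e" "even (length e)" and w: "w = e @ bold (2 * k) @ rev e @ bold (2 * l)"
    and E: "E = code f True e"
  shows "expanded (concat (replicate p w) @ e) \<and> hd (concat (replicate p w) @ e) = hd e \<and> code f True (concat (replicate p w) @ e) =
    concat (replicate p (E @ gap_word f True (last e) k @ rev E @ gap_word f False (hd e) l)) @ E"
proof (induction p)
  case (Suc p)
  then show ?case
    using code_power_step[OF assms(1,2) _ _ w E, of "concat (replicate p w) @ e"] by simp
qed (use assms in simp)

text \<open>Without \<open>e\<close> the two gaps meet directly. The empty junction ensures that
  nothing is inserted between them, so that the code is a power of the joined codes.\<close>

lemma code_power_empty:
  assumes "x \<in> {-2, 2}" "y \<in> {-2, 2}" "junction f x y = []" and w: "w = run x i @ run y j"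
  shows "expanded (concat (replicate (Suc p) w)) \<and> hd (concat (replicate (Suc p) w)) = x \<and>
    code f True (concat (replicate (Suc p) w)) = concat (replicate (Suc p) (code f True (run x i) @ code f False (run y j)))"
proof -
  have w1: "expanded w" using expanded_append expanded_run assms(1,2) w by simp
  have w2: "code f True w = code f True (run x i) @ code f False (run y j)"
    using code_append[of "run x i" "run y j" f True] assms(3) w by simp
  have ev: "even (length w)" "w \<noteq> []" "last w = y" "hd w = x" using w by simp_all
  show ?thesis
  proof (induction p)
    case 0
    then show ?case using w1 w2 ev by simp
  next
    case (Suc p)
    let ?c = "concat (replicate (Suc p) w)"
    have "?c \<noteq> []" using Suc expanded_hd by blast
    then have "code f True (w @ ?c) = code f True w @ code f True ?c"
      using code_append[of w ?c f True] Suc ev assms(3) junction_commute[of f x y] by simp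
    moreover have "expanded (w @ ?c)" using expanded_append w1 Suc by blast
    moreover have "concat (replicate (Suc (Suc p)) z) = z @ concat (replicate (Suc p) z)" for z :: "'z list" by simp
    ultimately show ?case using Suc w2 ev by (metis hd_append2)
  qed
qed

lemma end_letter_notin_run: "x \<in> {-2, 2} \<Longrightarrow> end_letter (\<not> T) \<notin> set (code f T (run x j))"
  using run_bold[of x j] code_bold by metis

lemma length_code_run: "x \<noteq> 0 \<Longrightarrow> length (code f T (run x j)) = 2 * j + 1"
  using length_concat_replicate[of j "[Gamma, end_letter T]"] by (simp add: code_run)

lemma decode_run:
  assumes "distinct_adj m" "odd (length m)" "end_letter (\<not> T) \<notin> set m" "hd m = end_letter T" "x \<in> {-2, 2}"
  shows "\<exists>j. m = code f T (run x j)"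
proof -
  obtain j where j: "length m = 2 * j + 1" using assms(2) oddE by blast
  have x: "x \<noteq> 0" using assms(5) by auto
  have "m = code f T (run x j)"
    by (rule alternating_unique[of m _ "end_letter (\<not> T)"])
      (use assms j length_code_run[OF x, of f T j] code_distinct_adj[OF expanded_run[OF assms(5)]] end_letter_notin_run[OF assms(5)]
        code_hd[OF expanded_run[OF assms(5)]] in simp_all)
  then show ?thesis by blast
qed

text \<open>If the gap starts with the end letter, it is a run that meets its neighbours without
  junctions. Otherwise it starts and ends with \<open>Gamma\<close>: a lone \<open>Gamma\<close> is
  a zero entry, and two outer ones are junctions around a run of the opposite sign choice.\<close>

lemma decode_gap:
  assumes "distinct_adj m" "rev m = m" "m \<noteq> []" "end_letter (\<not> T) \<notin> set m" "x \<in> {-2, 2}"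
  shows "\<exists>k. m = gap_word f T x k"
proof -
  have odd: "odd (length m)" using odd_palindrome assms(1-3) by blast
  have "hd m \<noteq> end_letter (\<not> T)" using assms(3,4) by (metis list.set_sel(1))
  then consider "hd m = end_letter T" | "hd m = Gamma" by (cases "hd m"; cases T) auto
  then show ?thesis
  proof cases
    case 1
    define y where "y = (if f then x else - x)"
    have y: "y \<in> {-2, 2}" "junction f x y = []" using assms(5) by (auto simp: y_def junction_def)
    obtain j where j: "m = code f T (run y j)" using decode_run[OF assms(1) odd assms(4) 1 y(1)] by blast
    obtain k where "bold (2 * k) = run y j" using run_bold[OF y(1)] by blast
    then have "m = gap_word f T x k" using j y(2) junction_commute[of f x y] by (simp add: gap_word_def)
    then show ?thesis by blast
  next
    case 2
    then obtain m' where m': "m = Gamma # m'" using assms(3) by (metis list.collapse)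
    show ?thesis
    proof (cases "m' = []")
      case True
      then have "m = gap_word f T x 0" using m' by (simp add: gap_word_def bold_0)
      then show ?thesis by blast
    next
      case False
      have l: "last m = Gamma" using assms(2) 2 assms(3) by (metis hd_rev)
      then obtain m'' where m'': "m' = m'' @ [Gamma]" using m' False by (metis append_butlast_last_id last.simps)
      have "m'' \<noteq> []" using assms(1) m' m'' by auto
      then have h: "hd m'' \<noteq> Gamma" using assms(1) m' m'' by (auto simp: distinct_adj_Cons)
      have "hd m'' \<noteq> end_letter (\<not> T)" using hd_in_set[OF \<open>m'' \<noteq> []\<close>] assms(4) m' m'' by (metis Un_iff list.set_intros(2) set_append)
      then have hT: "hd m'' = end_letter T" using h by (cases "hd m''"; cases T) auto
      define y where "y = (if f then - x else x)"
      have y: "y \<in> {-2, 2}" "junction f x y = [Gamma]" using assms(5) by (auto simp: y_def junction_def)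
      have "distinct_adj m''" using assms(1) m' m'' by (auto simp: distinct_adj_Cons distinct_adj_append_iff)
      moreover have "odd (length m'')" using odd m' m'' by simp
      ultimately obtain j where j: "m'' = code f T (run y j)"
        using decode_run[of m'' T y f] assms(4) hT y(1) m' m'' by auto
      obtain k where "bold (2 * k) = run y j" using run_bold[OF y(1)] by blast
      then have "m = gap_word f T x k" using m' m'' j y(2) junction_commute[of f x y] by (simp add: gap_word_def)
      then show ?thesis by blast
    qed
  qed
qed

section \<open>Continued fractions\<close>

type_synonym mat2 = "int \<times> int \<times> int \<times> int"

fun mmul :: "mat2 \<Rightarrow> mat2 \<Rightarrow> mat2" where
  "mmul (a, b, c, d) (e, f, g, h) = (a * e + b * g, a * f + b * h, c * e + d * g, c * f + d * h)"

fun mtrans :: "mat2 \<Rightarrow> mat2" where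
  "mtrans (a, b, c, d) = (a, c, b, d)"

fun mdet :: "mat2 \<Rightarrow> int" where
  "mdet (a, b, c, d) = a * d - b * c"

text \<open>The product of continuant matrices, with the denominator and numerator of the fraction
  in its first column. Reversal of a vector is transposition, and the determinant links the
  numerators of a vector and its reversal.\<close>

fun cmat :: "int list \<Rightarrow> mat2" where
  "cmat [] = (1, 0, 0, 1)"
| "cmat (x # r) = mmul (x, 1, 1, 0) (cmat r)"

lemma mmul_assoc: "mmul (mmul A B) C = mmul A (mmul B C)"
  by (cases A; cases B; cases C) (simp add: algebra_simps)

lemma mmul_one: "mmul (1, 0, 0, 1) A = A" "mmul A (1, 0, 0, 1) = A"
  by (cases A; simp)+

lemma mtrans_mmul: "mtrans (mmul A B) = mmul (mtrans B) (mtrans A)"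
  by (cases A; cases B) (simp add: algebra_simps)

lemma mdet_mmul: "mdet (mmul A B) = mdet A * mdet B"
  by (cases A; cases B) (simp add: algebra_simps)

lemma cmat_append: "cmat (u @ w) = mmul (cmat u) (cmat w)"
  by (induction u) (simp_all add: mmul_one mmul_assoc)

lemma cmat_rev: "cmat (rev u) = mtrans (cmat u)"
  by (induction u) (simp_all add: cmat_append mtrans_mmul mmul_one)

lemma mdet_cmat: "mdet (cmat u) = (- 1) ^ length u"
  by (induction u) (simp_all add: mdet_mmul)

definition cden :: "int list \<Rightarrow> int" where
  "cden u = fst (cmat u)"

definition cnum :: "int list \<Rightarrow> int" where
  "cnum u = fst (snd (snd (cmat u)))"

lemma cden_simps [simp]: "cden [] = 1" "cden (x # r) = x * cden r + cnum r"
  and cnum_simps [simp]: "cnum [] = 0" "cnum (x # r) = cden r"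
  by (cases "cmat r"; simp add: cden_def cnum_def)+

lemma cden_rev: "cden (rev u) = cden u"
  by (cases "cmat u") (simp add: cden_def cmat_rev)

lemma cnum_rev: "cden u dvd cnum u * cnum (rev u) + (- 1) ^ length u"
proof -
  obtain a b c d where m: "cmat u = (a, b, c, d)" by (cases "cmat u") auto
  then have "a * d - b * c = (- 1) ^ length u" using mdet_cmat[of u] by simp
  then have "c * b + (- 1) ^ length u = a * d" by (simp add: algebra_simps)
  then show ?thesis using m by (simp add: cden_def cnum_def cmat_rev)
qed

lemma coprime_cnum_cden: "coprime (cnum u) (cden u)"
  by (induction u) (simp_all add: coprime_iff_gcd_eq_1 gcd_add_mult gcd.commute)

text \<open>With even entries, prepending an entry just exchanges denominator and numerator modulo
  2.\<close>

lemma cden_parity: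
  "set u \<subseteq> {-2, 0, 2} \<Longrightarrow> odd (cden u) = even (length u) \<and> even (cnum u) = even (length u)"
  by (induction u) auto

lemma cfrac_eq: "cfrac r u = of_int r + cfrac 0 u"
  by (cases u) simp_all

lemma cfrac_Cons: "cfrac 0 (x # r) = 1 / (of_int x + cfrac 0 r)"
  by (simp add: cfrac_eq[of x])

text \<open>After an entry of modulus 2 the tail has modulus below 1 or, if a zero follows, the same
  sign as the entry. In neither case can it cancel the entry.\<close>

lemma cfrac_bounds: "expanded u \<Longrightarrow> 0 < of_int (hd u) * cfrac 0 u \<and> \<bar>cfrac 0 u\<bar> < 1"
proof (induction rule: expanded.induct)
  case (single x)
  then show ?case by (auto simp: cfrac_Cons)
next
  case (zero x r)
  let ?g = "cfrac 0 (x # r)"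
  have e: "cfrac 0 (x # 0 # x # r) = 1 / (of_int x + 1 / ?g)" by (simp add: cfrac_Cons)
  have "x \<in> {-2, 2}" using expanded_ConsD[OF zero(1)] .
  then show ?case
  proof (elim insertE)
    assume x: "x = -2"
    then have "?g < 0" "- 1 < ?g" using zero.IH by auto
    then have "1 / ?g < 0" by simp
    then show ?thesis unfolding e using x by (simp add: field_simps abs_if)
  next
    assume x: "x = 2"
    then have "0 < ?g" "?g < 1" using zero.IH by auto
    then have "0 < 1 / ?g" by simp
    then show ?thesis unfolding e using x by (simp add: field_simps abs_if)
  qed simp
next
  case (step x y r)
  let ?g = "cfrac 0 (y # r)"
  have e: "cfrac 0 (x # y # r) = 1 / (of_int x + ?g)" by (rule cfrac_Cons)
  have "?g < 1 \<and> - ?g < 1" using step.IH by (simp only: abs_less_iff)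
  then have g: "?g < 1" "- 1 < ?g" by linarith+
  from step(1) show ?case
  proof (elim insertE)
    assume x: "x = -2"
    show ?thesis unfolding e using x g by (simp add: field_simps abs_if)
  next
    assume x: "x = 2"
    show ?thesis unfolding e using x g by (simp add: field_simps abs_if)
  qed simp
qed

lemma cfrac_nonzero: "expanded u \<Longrightarrow> cfrac 0 u \<noteq> 0"
  using cfrac_bounds by fastforce

lemma cfrac_fraction: "expanded u \<Longrightarrow> cden u \<noteq> 0 \<and> cnum u \<noteq> 0 \<and> cfrac 0 u = of_int (cnum u) / of_int (cden u)"
proof (induction rule: expanded.induct)
  case (single x)
  then show ?case by (auto simp: cfrac_Cons)
next
  case (zero x r)
  let ?u = "x # 0 # x # r" and ?n = "cnum (x # r)" and ?d = "cden (x # r)"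
  have nz: "cfrac 0 ?u \<noteq> 0" using cfrac_nonzero[OF expanded.zero[OF zero(1)]] .
  have IH: "?d \<noteq> 0" "?n \<noteq> 0" "cfrac 0 (x # r) = of_int ?n / of_int ?d" using zero.IH by auto
  have "cfrac 0 ?u = 1 / (of_int x + 1 / cfrac 0 (x # r))" unfolding cfrac_Cons[of x "0 # x # r"] cfrac_Cons[of 0] by simp
  also have "\<dots> = of_int ?n / of_int (x * ?n + ?d)"
    unfolding IH(3) using IH(1,2) by (simp add: divide_simps del: cnum_simps cden_simps)
  finally have f: "cfrac 0 ?u = of_int ?n / of_int (x * ?n + ?d)" .
  have c: "cden ?u = x * ?n + ?d" "cnum ?u = ?n" by simp_all
  have "x * ?n + ?d \<noteq> 0" using nz f by (metis of_int_0 div_by_0)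
  then show ?case unfolding c using f IH by blast
next
  case (step x y r)
  let ?u = "x # y # r" and ?n = "cnum (y # r)" and ?d = "cden (y # r)"
  have nz: "cfrac 0 ?u \<noteq> 0" using cfrac_nonzero[OF expanded.step[OF step(1,2)]] .
  have IH: "?d \<noteq> 0" "?n \<noteq> 0" "cfrac 0 (y # r) = of_int ?n / of_int ?d" using step.IH by auto
  have f: "cfrac 0 ?u = of_int ?d / of_int (x * ?d + ?n)"
    unfolding cfrac_Cons[of x] IH(3) using IH(1,2) by (simp add: divide_simps del: cnum_simps cden_simps)
  have c: "cden ?u = x * ?d + ?n" "cnum ?u = ?d" by simp_all
  have "x * ?d + ?n \<noteq> 0" using nz f by (metis of_int_0 div_by_0)
  then show ?case unfolding c using f IH by blast
qed

lemma cfrac_zero_Cons: "expanded s \<Longrightarrow> 1 < \<bar>cfrac 0 (0 # s)\<bar>"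
  using cfrac_bounds[of s] cfrac_nonzero[of s] by (simp add: cfrac_Cons)

lemma expanded_tail: "expanded (x # r) \<Longrightarrow> r = [] \<or> expanded r \<or> (\<exists>s. r = 0 # s \<and> expanded s)"
  by (erule expanded.cases) auto

text \<open>The sign of the value gives the first entry. The modulus of the tail tells how the
  vector goes on: it is 0 if nothing follows, strictly between 0 and 1 before a nonzero entry, and
  above 1 before a zero.\<close>

lemma cfrac_inject: "expanded u \<Longrightarrow> expanded w \<Longrightarrow> cfrac 0 u = cfrac 0 w \<Longrightarrow> u = w"
proof (induction "length u" arbitrary: u w rule: less_induct)
  case less
  obtain x r where u: "u = x # r" using expanded_hd less.prems(1) by (metis list.collapse)
  obtain y t where w: "w = y # t" using expanded_hd less.prems(2) by (metis list.collapse)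
  have "x \<in> {-2, 2}" "y \<in> {-2, 2}" using expanded_ConsD less.prems(1,2) u w by blast+
  moreover have "0 < of_int x * cfrac 0 u" "0 < of_int y * cfrac 0 u"
    using cfrac_bounds less.prems u w by (metis list.sel(1))+
  ultimately have xy: "x = y" by auto
  have "inverse (of_int x + cfrac 0 r) = inverse (of_int x + cfrac 0 t)"
    using less.prems(3) unfolding u w xy cfrac_Cons by (simp add: inverse_eq_divide)
  then have eq: "cfrac 0 r = cfrac 0 t" by simp
  have IH: "r' = t'" if "expanded r'" "expanded t'" "cfrac 0 r' = cfrac 0 t'" "length r' < length u" for r' t'
    using less.hyps[OF that(4) that(1-3)] .
  have small: "cfrac 0 z \<noteq> 0 \<and> \<bar>cfrac 0 z\<bar> < 1" if "expanded z" for z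
    using cfrac_bounds[OF that] cfrac_nonzero[OF that] by blast
  consider "r = []" | "expanded r" | s where "r = 0 # s" "expanded s" using expanded_tail less.prems(1) u by blast
  then have "r = t"
  proof cases
    case 1
    consider "t = []" | "expanded t" | s where "t = 0 # s" "expanded s" using expanded_tail less.prems(2) w by blast
    then show ?thesis
    proof cases
      case 2
      then show ?thesis using small[of t] eq 1 by simp
    next
      case (3 s)
      then show ?thesis using cfrac_zero_Cons[of s] eq 1 by (simp del: cfrac.simps(2))
    qed (use 1 in simp)
  next
    case 2
    consider "t = []" | "expanded t" | s where "t = 0 # s" "expanded s" using expanded_tail less.prems(2) w by blast
    then show ?thesis
    proof cases
      case 1
      then show ?thesis using small[OF 2] eq by simp
    next
      case 2
      then show ?thesis using IH[OF \<open>expanded r\<close> _ eq] u by simp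
    next
      case (3 s)
      then show ?thesis using cfrac_zero_Cons[of s] small[OF 2] eq by (metis less_asym)
    qed
  next
    case (3 s)
    note r = 3
    consider "t = []" | "expanded t" | s' where "t = 0 # s'" "expanded s'" using expanded_tail less.prems(2) w by blast
    then show ?thesis
    proof cases
      case 1
      then have "cfrac 0 r = 0" using eq by simp
      then show ?thesis using cfrac_zero_Cons[OF r(2)] r(1) by (metis abs_zero not_one_less_zero)
    next
      case 2
      then show ?thesis using cfrac_zero_Cons[OF r(2)] r(1) small[OF 2] eq by (metis less_asym)
    next
      case (3 s')
      then have "inverse (cfrac 0 s) = inverse (cfrac 0 s')"
        using eq r unfolding \<open>t = 0 # s'\<close> r(1) cfrac_Cons by (simp add: inverse_eq_divide)
      then have "cfrac 0 s = cfrac 0 s'" by simp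
      then show ?thesis using IH[OF r(2) 3(2)] u r(1) 3(1) by simp
    qed
  qed
  then show ?case using u w xy by simp
qed

lemma cfrac_inject_S: "a \<in> S \<Longrightarrow> b \<in> S \<Longrightarrow> cfrac 0 a = cfrac 0 b \<Longrightarrow> a = b"
  using cfrac_inject[of a b] cfrac_nonzero[of a] cfrac_nonzero[of b] unfolding S_iff by auto

section \<open>From fractions of vectors to knots\<close>

definition value_of :: "int list \<Rightarrow> int \<times> int" where
  "value_of a = quotient_of (cfrac 0 a)"

lemma value_of_inject: "a \<in> S \<Longrightarrow> b \<in> S \<Longrightarrow> value_of a = value_of b \<Longrightarrow> a = b"
  using cfrac_inject_S quotient_of_inject by (metis value_of_def)

lemma quotient_of_fraction:
  assumes "d \<noteq> 0" "coprime n d"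
  shows "quotient_of (of_int n / of_int d) = (n * sgn d, \<bar>d\<bar>)"
proof -
  obtain p q where pq: "quotient_of (of_int n / of_int d) = (p, q)" by (cases "quotient_of (of_int n / of_int d)")
  have q: "q > 0" "coprime p q" using quotient_of_denom_pos[OF pq] quotient_of_coprime[OF pq] .
  have "of_int n / of_int d = (of_int p / of_int q :: rat)" using quotient_of_div[OF pq] .
  then have "of_int (n * q) = (of_int (p * d) :: rat)" using q(1) assms(1) by (simp add: field_simps)
  then have e: "n * q = p * d" by (simp only: of_int_eq_iff)
  have "q dvd p * d" using e by (metis dvd_triv_right)
  then have "q dvd d" using q(2) by (metis coprime_commute coprime_dvd_mult_right_iff)
  moreover have "d dvd n * q" using e by simp
  then have "d dvd q" using assms(2) by (metis coprime_commute coprime_dvd_mult_right_iff)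
  ultimately have qd: "q = \<bar>d\<bar>" using q(1) by (metis abs_of_pos zdvd_antisym_abs)
  have "p * d = n * sgn d * d" using e unfolding qd abs_sgn by (simp only: ac_simps)
  then have "p = n * sgn d" using assms(1) by simp
  then show ?thesis using pq qd by simp
qed

lemma cden_cnum_S:
  assumes "a \<in> S"
  shows "cden a \<noteq> 0" "\<bar>cnum a\<bar> < \<bar>cden a\<bar>" "cfrac 0 a = of_int (cnum a) / of_int (cden a)"
proof -
  have "cden a \<noteq> 0 \<and> \<bar>cnum a\<bar> < \<bar>cden a\<bar> \<and> cfrac 0 a = of_int (cnum a) / of_int (cden a)"
  proof (cases "a = []")
    case False
    then have v: "expanded a" using assms S_iff by blast
    have f: "cden a \<noteq> 0" "cfrac 0 a = of_int (cnum a) / of_int (cden a)" using cfrac_fraction[OF v] by auto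
    have "\<bar>of_int (cnum a) / of_int (cden a) :: rat\<bar> < 1" using cfrac_bounds[OF v] f(2) by simp
    then have "\<bar>of_int (cnum a)\<bar> < (\<bar>of_int (cden a)\<bar> :: rat)" using f(1) by (simp add: abs_divide)
    then have "(of_int \<bar>cnum a\<bar> :: rat) < of_int \<bar>cden a\<bar>" by simp
    then have "\<bar>cnum a\<bar> < \<bar>cden a\<bar>" by (simp only: of_int_less_iff)
    then show ?thesis using f by blast
  qed simp
  then show "cden a \<noteq> 0" "\<bar>cnum a\<bar> < \<bar>cden a\<bar>" "cfrac 0 a = of_int (cnum a) / of_int (cden a)" by auto
qed

lemma value_of_S:
  assumes "a \<in> S"
  shows "value_of a = (cnum a * sgn (cden a), \<bar>cden a\<bar>)"
  unfolding value_of_def cden_cnum_S(3)[OF assms]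
  by (rule quotient_of_fraction[OF cden_cnum_S(1)[OF assms] coprime_cnum_cden])

lemma cden_scale: "e \<in> {-1, 1} \<Longrightarrow> cden (scale e u) = e ^ length u * cden u \<and> cnum (scale e u) = e ^ Suc (length u) * cnum u"
  by (induction u) (auto simp: algebra_simps)

text \<open>The four equivalent vectors have numerators \<open>p\<close>, \<open>- p\<close>,
  \<open>r\<close> and \<open>- r\<close> over the same \<open>q\<close>, with \<open>p r\<close>
  congruent to \<open>- 1\<close>. All are even and smaller than \<open>q\<close> in modulus, which
  makes them canonical residues modulo the odd \<open>q\<close>.\<close>

lemma value_of_S_even:
  assumes "a \<in> S_even" "value_of a = (p, q)"
  shows "bridge_fraction (p, q)" "even p" "\<bar>p\<bar> < q" "value_of (scale (- 1) a) = (- p, q)"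
    "\<exists>r. value_of (rev a) = (r, q) \<and> q dvd p * r + 1"
proof -
  have a: "a \<in> S" "even (length a)" using assms(1) by (auto simp: S_even_def)
  note c = cden_cnum_S[OF a(1)]
  have pq: "p = cnum a * sgn (cden a)" "q = \<bar>cden a\<bar>" using value_of_S[OF a(1)] assms(2) by auto
  have s: "sgn (cden a) * sgn (cden a) = 1" using c(1) by (simp add: sgn_if)
  have "set a \<subseteq> {-2, 0, 2}" using a(1) by (simp add: S_def)
  from cden_parity[OF this] have par: "odd (cden a)" "even (cnum a)" using a(2) by auto
  show "even p" using pq par by simp
  show "\<bar>p\<bar> < q" using pq c(1,2) by (simp add: abs_mult)
  have "value_of a = quotient_of (cfrac 0 a)" by (simp add: value_of_def)
  then have "coprime p q" using assms(2) quotient_of_coprime by metis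
  then show "bridge_fraction (p, q)" using pq c(1) par by (simp add: bridge_fraction_def)
  have S': "scale (- 1) a \<in> S" "rev a \<in> S" using a(1) expanded_scale[of a "- 1"] expanded_rev unfolding S_iff by auto
  have "cden (scale (- 1) a) = cden a" "cnum (scale (- 1) a) = - cnum a"
    using cden_scale[of "- 1" a] a(2) by auto
  then show "value_of (scale (- 1) a) = (- p, q)" using value_of_S[OF S'(1)] pq by simp
  define r where "r = cnum (rev a) * sgn (cden a)"
  have "value_of (rev a) = (r, q)" using value_of_S[OF S'(2)] pq by (simp add: cden_rev r_def)
  moreover have "p * r = cnum a * cnum (rev a)" unfolding pq(1) r_def using s by (simp add: algebra_simps)
  then have "q dvd p * r + 1" using cnum_rev[of a] a(2) pq(2) by simp
  ultimately show "\<exists>r. value_of (rev a) = (r, q) \<and> q dvd p * r + 1" by blast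
qed

definition knot_of :: "int list \<Rightarrow> two_bridge_knot" where
  "knot_of a = (case value_of a of (p, q) \<Rightarrow> bridge_knot p q)"

lemma even_residue_unique:
  fixes s t q :: int
  assumes "even s" "even t" "odd q" "\<bar>s\<bar> < q" "\<bar>t\<bar> < q" "q dvd s - t"
  shows "s = t"
proof -
  have "2 dvd s - t" "coprime 2 q" using assms(1-3) by simp_all
  then have "2 * q dvd s - t" using assms(6) by (simp add: divides_mult)
  moreover have "\<bar>s - t\<bar> < 2 * q" using assms(4,5) by linarith
  ultimately have "s - t = 0" by (metis abs_dvd_iff dvd_abs_iff zdvd_imp_le abs_ge_zero abs_eq_0_iff less_le not_less zero_less_abs_iff)
  then show ?thesis by simp
qed

text \<open>The four congruences for equal knots single out the even residues \<open>p\<close>,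
  \<open>- p\<close>, \<open>- r\<close> and \<open>r\<close>. These belong to the four vectors
  equivalent to \<open>a\<close>, and a value determines its vector. Hence \<open>Phi\<close> is
  well defined and injective on classes.\<close>

lemma knot_of_eq_iff:
  assumes a: "a \<in> S_even" and b: "b \<in> S_even"
  shows "knot_of a = knot_of b \<longleftrightarrow> (\<exists>e\<in>{-1, 1}. b = scale e a \<or> b = scale e (rev a))"
proof -
  obtain p q where va: "value_of a = (p, q)" by (cases "value_of a")
  obtain p' q' where vb: "value_of b = (p', q')" by (cases "value_of b")
  note A = value_of_S_even[OF a va] and B = value_of_S_even[OF b vb]
  obtain r where r: "value_of (rev a) = (r, q)" "q dvd p * r + 1" using A(5) by blast
  have S: "a \<in> S" "b \<in> S" using a b by (auto simp: S_even_def)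
  have Sr: "rev a \<in> S_even" "scale (- 1) a \<in> S" "scale (- 1) (rev a) \<in> S" "rev a \<in> S"
    using a expanded_rev[of a] expanded_scale[of a "- 1"] expanded_scale[of "rev a" "- 1"] by (auto simp: S_even_def S_iff)
  note R = value_of_S_even[OF Sr(1) r(1)]
  have q: "odd q" "q > 0" "coprime p q" using A(1) by (auto simp: bridge_fraction_def)
  have "knot_of a = knot_of b \<longleftrightarrow> bridge_eq (p, q) (p', q')"
    using bridge_knot_eq_iff[OF A(1) B(1)] by (simp add: knot_of_def va vb)
  also have "\<dots> \<longleftrightarrow> q' = q \<and> (q dvd p' - p \<or> q dvd p' + p \<or> q dvd p' * p - 1 \<or> q dvd p' * p + 1)"
    using A(1) B(1) by (auto simp: bridge_eq_def cong_iff_dvd_diff)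
  also have "\<dots> \<longleftrightarrow> q' = q \<and> (p' = p \<or> p' = - p \<or> p' = - r \<or> p' = r)"
  proof (rule conj_cong[OF refl])
    assume qq: "q' = q"
    have u: "p' = t \<longleftrightarrow> q dvd p' - t" if "even t" "\<bar>t\<bar> < q" for t
      using even_residue_unique[OF B(2) that(1) q(1) _ that(2)] B(3) qq by auto
    have 1: "q dvd p' - p \<longleftrightarrow> p' = p" using u[OF A(2,3)] by blast
    have 2: "q dvd p' + p \<longleftrightarrow> p' = - p" using u[of "- p"] A(2,3) by simp
    have c: "q dvd p * z \<longleftrightarrow> q dvd z" for z
      using q(3) by (simp add: coprime_commute coprime_dvd_mult_right_iff)
    have 3: "q dvd p' * p - 1 \<longleftrightarrow> p' = - r"
    proof -
      have "p' * p - 1 = p * (p' + r) - (p * r + 1)" by (simp add: algebra_simps)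
      then have "q dvd p' * p - 1 \<longleftrightarrow> q dvd p * (p' + r)" using r(2) by (metis dvd_diff_right_iff dvd_diff_left_iff)
      then show ?thesis using c u[of "- r"] R(2,3) by simp
    qed
    have 4: "q dvd p' * p + 1 \<longleftrightarrow> p' = r"
    proof -
      have "p' * p + 1 = p * (p' - r) + (p * r + 1)" by (simp add: algebra_simps)
      then have "q dvd p' * p + 1 \<longleftrightarrow> q dvd p * (p' - r)" using r(2) by (metis dvd_add_left_iff)
      then show ?thesis using c u[OF R(2,3)] by simp
    qed
    show "(q dvd p' - p \<or> q dvd p' + p \<or> q dvd p' * p - 1 \<or> q dvd p' * p + 1) \<longleftrightarrow>
      (p' = p \<or> p' = - p \<or> p' = - r \<or> p' = r)" unfolding 1 2 3 4 by blast
  qed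
  also have "\<dots> \<longleftrightarrow> value_of b \<in> {value_of a, value_of (scale (- 1) a), value_of (scale (- 1) (rev a)), value_of (rev a)}"
    unfolding va vb r(1) A(4) R(4) by auto
  also have "\<dots> \<longleftrightarrow> b \<in> {a, scale (- 1) a, scale (- 1) (rev a), rev a}"
    using value_of_inject S Sr by auto
  finally show ?thesis by auto
qed

lemma knot_of_eq_vec_class:
  assumes "a \<in> S_even" "b \<in> S_even"
  shows "knot_of a = knot_of b \<longleftrightarrow> vec_class a = vec_class b"
proof -
  have S: "a \<in> S" "b \<in> S" using assms by (auto simp: S_even_def)
  have "knot_of a = knot_of b \<longleftrightarrow> b \<in> vec_class a"
    using knot_of_eq_iff[OF assms] mem_vec_class[OF S(1)] by blast
  also have "\<dots> \<longleftrightarrow> vec_class a = vec_class b"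
    using vec_class_eq[OF S(1)] self_vec_class[OF S(2)] by blast
  finally show ?thesis .
qed

lemma Phi_vec_class:
  assumes "a \<in> S_even"
  shows "Phi (vec_class a) = knot_of a"
proof -
  have S: "a \<in> S" using assms by (simp add: S_even_def)
  have k: "knot_of b = knot_of a" if "b \<in> vec_class a" for b
    using knot_of_eq_vec_class[OF assms S_even_vec_class[OF assms that]] vec_class_eq[OF S that] by simp
  have "Phi (vec_class a) = the_elem (knot_of ` vec_class a)"
    by (simp add: Phi_def knot_of_def value_of_def)
  also have "knot_of ` vec_class a = {knot_of a}" using k self_vec_class[OF S] by blast
  finally show ?thesis by simp
qed

lemma Phi_eq_iff: "a \<in> S_even \<Longrightarrow> b \<in> S_even \<Longrightarrow> Phi (vec_class a) = Phi (vec_class b) \<longleftrightarrow> vec_class a = vec_class b"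
  using Phi_vec_class knot_of_eq_vec_class by simp

section \<open>The partial order in terms of vectors\<close>

lemma ors_ge_iff:
  "c \<in> S_even \<Longrightarrow> a \<in> S_even \<Longrightarrow>
    ors_ge (Phi (vec_class c)) (Phi (vec_class a)) \<longleftrightarrow> class_parses (vec_class c) (vec_class a)"
  unfolding ors_ge_def S_even_classes_eq using Phi_eq_iff by (smt (verit) image_iff)

lemma ors_geD:
  "ors_ge K K' \<Longrightarrow> \<exists>c\<in>S_even. \<exists>a\<in>S_even. K = Phi (vec_class c) \<and> K' = Phi (vec_class a) \<and>
    class_parses (vec_class c) (vec_class a)"
  unfolding ors_ge_def S_even_classes_eq by blast

lemma parses_class: "parses c a \<Longrightarrow> class_parses (vec_class c) (vec_class a)"
  unfolding class_parses_def using self_vec_class parses_iff by blast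

lemma orient_Nil [simp]: "orient [] T = []"
  by (simp add: orient_def)

lemma blocks_empty: "expanded c \<Longrightarrow> \<exists>x j c'. c = run x j @ c' \<and> x \<in> {-2, 2} \<and> (\<forall>T. blocks [] T 1 c')"
proof (induction rule: expanded.induct)
  case (single x)
  have "blocks [] T 1 []" for T using blocks.final[of 1 "[]" T] by simp
  then show ?case using single run_0[of x] by (metis append_Nil2)
next
  case (zero x r)
  then obtain x' j c' where *: "x # r = run x' j @ c'" "x' \<in> {-2, 2}" "\<forall>T. blocks [] T 1 c'" by blast
  then have "x' = x" by (simp add: run_def)
  then have "x # 0 # x # r = run x (Suc j) @ c'" using *(1) by (simp add: run_Suc)
  then show ?case using * \<open>x' = x\<close> by blast
next
  case (step x y r)
  then obtain x' j c' where *: "y # r = run x' j @ c'" "x' \<in> {-2, 2}" "\<forall>T. blocks [] T 1 c'" by blast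
  obtain k where k: "k \<noteq> 0" "bold (2 * k) = run x' j" using run_bold[OF *(2)] by blast
  have "blocks [] T 1 (y # r)" for T
    using blocks.more[of 1 k 1 "[]" T c'] *(1,3) k by simp
  moreover have "x # y # r = run x 0 @ y # r" by (simp add: run_0)
  ultimately show ?case using step(1) by blast
qed

text \<open>Around empty blocks only nonzero gaps remain, and every expanded vector is a
  concatenation of runs. So the unknot lies below every knot, and incomparable knots have nonempty
  vectors.\<close>

lemma parses_empty: "c \<in> S \<Longrightarrow> parses c []"
proof -
  assume c: "c \<in> S"
  have "blocks [] True 1 c"
  proof (cases "c = []")
    case True
    then show ?thesis using blocks.final[of 1 "[]" True] by (simp add: orient_def)
  next
    case False
    then have "expanded c" using c S_iff by blast
    then obtain x j c' where *: "c = run x j @ c'" "x \<in> {-2, 2}" "\<forall>T. blocks [] T 1 c'" using blocks_empty by blast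
    obtain k where k: "k \<noteq> 0" "bold (2 * k) = run x j" using run_bold[OF *(2)] by blast
    show ?thesis using blocks.more[of 1 k 1 "[]" True c'] * k by (simp add: orient_def)
  qed
  moreover have "[] \<in> S" by (simp add: S_iff)
  ultimately show ?thesis using c parses_iff by blast
qed

lemma replicate_mult: "concat (replicate (i * j) w) = concat (replicate j (concat (replicate i w)))"
  by (induction j) (simp_all add: concat_replicate_add)

text \<open>A round through \<open>a\<close> is \<open>2 p + 1\<close> factors \<open>w\<close> by
  \<open>unfold_power\<close>, so \<open>w^r e\<close> consists of \<open>t\<close> rounds and a
  final \<open>a\<close>, all with sign 1.\<close>

lemma power_blocks:
  assumes w: "w = e @ bold (2 * k) @ rev e @ bold (2 * l)" and a: "a = concat (replicate p w) @ e"
    and r: "2 * r + 1 = (2 * p + 1) * (2 * t + 1)"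
  shows "blocks a True 1 (concat (replicate r w) @ e)"
proof -
  let ?W = "a @ bold (2 * k) @ rev a @ bold (2 * l)"
  have W: "?W = concat (replicate (2 * p + 1) w)" using unfold_power[OF rev_bold rev_bold w a] .
  have "r = (2 * p + 1) * t + p" using r by (simp add: algebra_simps)
  then have "concat (replicate r w) @ e = concat (replicate ((2 * p + 1) * t) w) @ a"
    using concat_replicate_add[of "(2 * p + 1) * t" p w] a by simp
  also have "concat (replicate ((2 * p + 1) * t) w) = concat (replicate t ?W)" unfolding W by (rule replicate_mult)
  finally have c: "concat (replicate r w) @ e = concat (replicate t ?W) @ a" .
  have "blocks a True 1 (concat (replicate t ?W) @ a)"
  proof (induction t)
    case 0
    then show ?case using blocks.final[of 1 a True] by (simp add: orient_def)
  next
    case (Suc t)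
    have "blocks a False 1 (rev a @ bold (2 * l) @ concat (replicate t ?W) @ a)"
      using blocks.more[of 1 l 1 a False] Suc by (simp add: orient_def)
    then show ?case using blocks.more[of 1 k 1 a True] by (simp add: orient_def)
  qed
  then show ?thesis using c by simp
qed

section \<open>From common bounds of vectors to powers and back\<close>

text \<open>The first two adjacent nonzero entries decide: \<open>f\<close> is chosen so that no
  junction is inserted between them. Zeros before that only add pairs of \<open>Gamma\<close> and
  \<open>Alpha\<close>.\<close>

lemma exists_junction_convention: "expanded u \<Longrightarrow> \<exists>f. last (takeWhile (\<lambda>c. c \<noteq> Beta) (code f True u)) = Alpha"
proof (induction rule: expanded.induct)
  case (single x)
  then show ?case by auto
next
  case (zero x r)
  then obtain f where f: "last (takeWhile (\<lambda>c. c \<noteq> Beta) (code f True (x # r))) = Alpha" by blast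
  obtain z where "code f True (x # r) = Alpha # z" using code_Cons_ex[OF zero(1), of f True] by auto
  then have "last (takeWhile (\<lambda>c. c \<noteq> Beta) (code f True (x # 0 # x # r))) = Alpha"
    using f expanded_ConsD[OF zero(1)] by auto
  then show ?case by blast
next
  case (step x y r)
  obtain z where "code (x = y) False (y # r) = Beta # z" using code_Cons_ex[OF step(2), of "x = y" False] by auto
  then have "last (takeWhile (\<lambda>c. c \<noteq> Beta) (code (x = y) True (x # y # r))) = Alpha"
    using step(1) by (auto simp: junction_def)
  then show ?case by blast
qed

lemma common_bound_core:
  assumes "valid A" "valid B" "path A 0 V (length A)" "path B 0 V (length B)" "length A < length B"
    and "last (takeWhile (\<lambda>c. c \<noteq> Beta) A) = Alpha" "\<not> path A 0 B (length A)"
  shows "\<exists>e m n P Q. let w = e @ m @ rev e @ n in A = concat (replicate P w) @ e \<and> B = concat (replicate Q w) @ e \<and>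
    (e = [] \<or> valid e) \<and> rev m = m \<and> rev n = n \<and> m \<noteq> [] \<and> n \<noteq> [] \<and> Beta \<notin> set m \<and> Alpha \<notin> set n"
proof -
  obtain v where v: "path A 0 v (length A)" "path B 0 v (length B)"
    "\<And>u. path A 0 u (length A) \<Longrightarrow> path B 0 u (length B) \<Longrightarrow> length v \<le> length u"
    using ex_has_least_nat[of "\<lambda>v. path A 0 v (length A) \<and> path B 0 v (length B)" V length] assms(3,4) by blast
  interpret longer_common_bound A B v
  proof
    fix v\<^sub>1 v\<^sub>2 v\<^sub>3 s t
    assume *: "v = v\<^sub>1 @ v\<^sub>2 @ v\<^sub>3" "path A 0 v\<^sub>1 s" "path A s v\<^sub>2 s" "path B 0 v\<^sub>1 t" "path B t v\<^sub>2 t"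
    have "path A s v\<^sub>3 (length A)" using v(1) *(1-3) path_det[OF assms(1)] path_append by metis
    moreover have "path B t v\<^sub>3 (length B)" using v(2) *(1,4,5) path_det[OF assms(2)] path_append by metis
    ultimately have "path A 0 (v\<^sub>1 @ v\<^sub>3) (length A)" "path B 0 (v\<^sub>1 @ v\<^sub>3) (length B)"
      using *(2,4) path_append by blast+
    then have "length v \<le> length (v\<^sub>1 @ v\<^sub>3)" using v(3) by blast
    then show "v\<^sub>2 = []" using *(1) by simp
  qed (use assms v in simp_all)
  show ?thesis using core assms(6,7) by blast
qed

lemma code_run_palindrome: "rev (code f T (run x j)) = code f T (run x j)"
  using code_rev[of f T "run x j"] by (simp add: rev_run)

lemma decode_power:
  assumes a: "expanded a" "even (length a)" and b: "expanded b" "even (length b)" and f: "length (code f True a) < length (code f True b)"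
    and W: "W = E @ m @ rev E @ n" and A: "code f True a = concat (replicate P W) @ E" and B: "code f True b = concat (replicate Q W) @ E"
    and E: "E = [] \<or> valid E" and mn: "rev m = m" "rev n = n" "m \<noteq> []" "n \<noteq> []" "Beta \<notin> set m" "Alpha \<notin> set n"
  shows "\<exists>e k l. e \<in> S_even \<and> (let w = e @ bold (2 * k) @ rev e @ bold (2 * l) in
    (\<exists>d\<in>{-1, 1}. a = scale d (concat (replicate P w) @ e)) \<and> (\<exists>d\<in>{-1, 1}. b = scale d (concat (replicate Q w) @ e)))"
proof -
  have vA: "valid (code f True a)" and vB: "valid (code f True b)" using code_valid a b by blast+
  note dA = validD[OF vA] and dB = validD[OF vB]
  have "Q \<noteq> 0"
  proof
    assume "Q = 0"
    then have "length (code f True b) = length E" using B by simp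
    then show False using f A by simp
  qed
  then obtain Q' where Q': "Q = Suc Q'" by (cases Q) auto
  have "code f True b = E @ m @ rev E @ n @ concat (replicate Q' W) @ E" using B W Q' by simp
  then have adj: "distinct_adj m" "distinct_adj n"
    using dB(2) by (simp_all add: distinct_adj_append_iff)
  show ?thesis
  proof (cases "E = []")
    case False
    then have vE: "valid E" using E by simp
    note dE = validD[OF vE]
    have hE: "hd E = end_letter True" "last E \<noteq> Gamma" using dE by simp_all
    \<comment> \<open>The first entry 2 is an arbitrary choice of sign;
      \<open>code_injective\<close> recovers \<open>a\<close> and \<open>b\<close> only up to sign
      anyway.\<close>
    obtain e where e: "expanded e" "code f True e = E" using decode[OF dE(2,1) hE, of 2 f] by auto
    have ev: "even (length e)" using code_valid[OF e(1), of f] e(2) vE by blast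
    obtain k where k: "m = gap_word f True (last e) k"
      using decode_gap[OF adj(1) mn(1,3), of True "last e" f] mn(5) expanded_last[OF e(1)] by auto
    obtain l where l: "n = gap_word f False (hd e) l"
      using decode_gap[OF adj(2) mn(2,4), of False "hd e" f] mn(6) expanded_hd[OF e(1)] by auto
    define w where "w = e @ bold (2 * k) @ rev e @ bold (2 * l)"
    note cp = code_power[OF e(1) ev w_def e(2)[symmetric]]
    have "\<exists>d\<in>{-1, 1}. a = scale d (concat (replicate P w) @ e)"
      using code_injective[of "concat (replicate P w) @ e" a f True] cp[of P] a A W k l by simp
    moreover have "\<exists>d\<in>{-1, 1}. b = scale d (concat (replicate Q w) @ e)"
      using code_injective[of "concat (replicate Q w) @ e" b f True] cp[of Q] b B W k l by simp
    moreover have "e \<in> S_even" using e(1) ev S_of_expanded by (simp add: S_even_def)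
    ultimately show ?thesis unfolding w_def Let_def by blast
  next
    case True
    then have "P \<noteq> 0" using A dA(1) by (metis append_Nil2 concat.simps(1) replicate_0)
    then obtain P' where P': "P = Suc P'" by (cases P) auto
    have Wmn: "W = m @ n" using W True by simp
    have "hd m = Alpha" using dA(3) A P' Wmn mn(3) by simp
    then have hm: "hd m = end_letter True" by simp
    have "last n = Beta"
    proof -
      have "code f True b = concat (replicate Q' W) @ m @ n"
        using B True Q' Wmn concat_replicate_add[of Q' 1 W] by simp
      then show ?thesis using dB(4) mn(4) by simp
    qed
    then have hn: "hd n = end_letter False" using mn(2,4) by (metis hd_rev)
    \<comment> \<open>The sign for which convention \<open>f\<close> inserts nothing between 2 and
      \<open>y\<close>.\<close>
    define y where "y = (if f then 2 else - 2 :: int)"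
    have y: "y \<in> {-2, 2}" "junction f 2 y = []" by (auto simp: y_def junction_def)
    obtain i where i: "m = code f True (run 2 i)"
      using decode_run[OF adj(1) odd_palindrome[OF adj(1) mn(1,3)] _ hm, of 2 f] mn(5) by auto
    obtain j where j: "n = code f False (run y j)"
      using decode_run[OF adj(2) odd_palindrome[OF adj(2) mn(2,4)] _ hn y(1), of f] mn(6) by auto
    obtain k where k: "bold (2 * k) = run 2 i" using run_bold[of 2 i] by auto
    obtain l where l: "bold (2 * l) = run y j" using run_bold[OF y(1), of j] by blast
    define w where "w = [] @ bold (2 * k) @ rev [] @ bold (2 * l)"
    have w: "w = run 2 i @ run y j" using k l by (simp add: w_def)
    note cp = code_power_empty[of 2, OF _ y w]
    have "\<exists>d\<in>{-1, 1}. a = scale d (concat (replicate P w) @ [])"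
      using code_injective[of "concat (replicate P w)" a f True] cp[of P'] a A Wmn i j True P' by simp
    moreover have "\<exists>d\<in>{-1, 1}. b = scale d (concat (replicate Q w) @ [])"
      using code_injective[of "concat (replicate Q w)" b f True] cp[of Q'] b B Wmn i j True Q' by simp
    moreover have "[] \<in> S_even" by (simp add: S_even_def S_iff)
    ultimately show ?thesis unfolding w_def Let_def by blast
  qed
qed

text \<open>The paths are assumed for both conventions because the suitable \<open>f\<close> depends
  on the shorter vector \<open>a\<close> and is chosen only inside.\<close>

lemma power_form_of_bound:
  assumes a: "expanded a" "even (length a)" and b: "expanded b" "even (length b)" and c: "expanded c" "even (length c)"
    and pa: "\<And>f. path (code f True a) 0 (code f True c) (length (code f True a))"
    and pb: "\<And>f. path (code f True b) 0 (code f True c) (length (code f True b))"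
    and le: "length a \<le> length b" and "\<not> class_parses (vec_class b) (vec_class a)"
  shows "\<exists>e k l P Q. e \<in> S_even \<and> (let w = e @ bold (2 * k) @ rev e @ bold (2 * l) in
    (\<exists>d\<in>{-1, 1}. a = scale d (concat (replicate P w) @ e)) \<and> (\<exists>d\<in>{-1, 1}. b = scale d (concat (replicate Q w) @ e)))"
proof -
  obtain f where f: "last (takeWhile (\<lambda>c. c \<noteq> Beta) (code f True a)) = Alpha"
    using exists_junction_convention[OF a(1)] by blast
  let ?A = "code f True a" and ?B = "code f True b" and ?C = "code f True c"
  have vA: "valid ?A" and vB: "valid ?B" using code_valid a b by blast+
  have np: "\<not> path ?A 0 ?B (length ?A)" using class_parses_iff[OF a b] assms(10) by blast
  \<comment> \<open>Junctions make the length of a code depend on more than the length of the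
    vector. That the code of \<open>a\<close> is shorter follows because both vectors are, up to
    sign, prefixes of \<open>c\<close>.\<close>
  have prefix: "\<exists>d\<in>{-1, 1}. \<exists>r. c = scale d u @ r"
    if u: "expanded u" "valid (code f True u)" "path (code f True u) 0 ?C (length (code f True u))" for u
  proof -
    obtain d where d: "d \<in> {-1, 1}" "hd c = d * hd u" using sign_exists expanded_hd c(1) u(1) by metis
    have "hd ?C = Alpha" "?C \<noteq> []" using code_hd[OF c(1)] expanded_hd[OF c(1)] by simp_all
    then obtain w where "?C = code f True u @ w"
      using up_complete[OF u(2) code_distinct_adj[OF c(1)] u(3)] by blast
    then have "?C = code f True (scale d u) @ w" using code_scale[OF d(1)] by simp
    then show ?thesis
      using code_prefix[OF expanded_scale[OF u(1) d(1)] c(1)] d hd_scale expanded_hd[OF u(1)] by metis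
  qed
  obtain d r where d: "d \<in> {-1, 1}" "c = scale d a @ r" using prefix[OF a(1) vA pa] by blast
  obtain d' r' where d': "d' \<in> {-1, 1}" "c = scale d' b @ r'" using prefix[OF b(1) vB pb] by blast
  have "scale d a @ r = scale d' b @ r'" using d(2) d'(2) by simp
  then obtain s where s: "scale d' b = scale d a @ s" using le append_eq_prefixE[of "scale d a" r "scale d' b" r'] by auto
  have "s \<noteq> []"
  proof
    assume "s = []"
    then have "code f True (scale d' b) = code f True (scale d a)" using s by simp
    then have "?B = ?A" using code_scale d(1) d'(1) by metis
    then show False using np path_take[of "length ?A" ?A] by simp
  qed
  moreover have "scale d a \<noteq> []" using expanded_hd[OF a(1)] by simp
  ultimately have "length (code f True (scale d a)) < length (code f True (scale d' b))"
    unfolding s using code_append[of "scale d a" s f True] by simp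
  then have lt: "length ?A < length ?B" using code_scale d(1) d'(1) by metis
  obtain E m n P Q where *: "?A = concat (replicate P (E @ m @ rev E @ n)) @ E" "?B = concat (replicate Q (E @ m @ rev E @ n)) @ E"
    "E = [] \<or> valid E" "rev m = m" "rev n = n" "m \<noteq> []" "n \<noteq> []" "Beta \<notin> set m" "Alpha \<notin> set n"
    using common_bound_core[OF vA vB pa pb lt f np] unfolding Let_def by blast
  show ?thesis using decode_power[OF a b lt refl *] by blast
qed

text \<open>For nonempty \<open>e\<close> either convention would do. For empty \<open>e\<close> the
  convention must leave the junction between the two gaps empty, hence \<open>x = y\<close>.\<close>

lemma power_words:
  assumes e: "e \<in> S_even" and w: "w = e @ bold (2 * k) @ rev e @ bold (2 * l)" and ne: "e = [] \<Longrightarrow> k \<noteq> 0 \<and> l \<noteq> 0"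
  shows "\<exists>f E m n. rev m = m \<and> rev n = n \<and> m \<noteq> [] \<and> n \<noteq> [] \<and> Beta \<notin> set m \<and> Alpha \<notin> set n \<and>
    (\<forall>p. e \<noteq> [] \<or> p \<noteq> 0 \<longrightarrow> expanded (concat (replicate p w) @ e) \<and> even (length (concat (replicate p w) @ e)) \<and>
      code f True (concat (replicate p w) @ e) = concat (replicate p (E @ m @ rev E @ n)) @ E)"
proof -
  have "even (length w)" using w odd_bold[of k] odd_bold[of l] by simp
  then have ev: "even (length (concat (replicate p w) @ e))" for p
    using e by (simp add: length_concat_replicate S_even_def)
  show ?thesis
  proof (cases "e = []")
    case False
    then have v: "expanded e" "even (length e)" using e by (auto simp: S_even_def S_iff)
    show ?thesis
      using code_power[OF v w refl, where f = True] ev gap_word_props(1) gap_word_props(2)[where T = True] gap_word_props(2)[where T = False] rev_gap_word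
      by (intro exI[of _ True] exI[of _ "code True True e"] exI[of _ "gap_word True True (last e) k"]
          exI[of _ "gap_word True False (hd e) l"]) simp
  next
    case True
    obtain x i where x: "x \<in> {-2, 2}" "bold (2 * k) = run x i" using bold_cases[of k] ne True by auto
    obtain y j where y: "y \<in> {-2, 2}" "bold (2 * l) = run y j" using bold_cases[of l] ne True by auto
    have J: "junction (x = y) x y = []" by (simp add: junction_def)
    have w': "w = run x i @ run y j" using w x y True by simp
    let ?m = "code (x = y) True (run x i)" and ?n = "code (x = y) False (run y j)"
    have m: "rev ?m = ?m" "rev ?n = ?n" "?m \<noteq> []" "?n \<noteq> []" "Beta \<notin> set ?m" "Alpha \<notin> set ?n"
      using code_run_palindrome end_letter_notin_run[OF x(1), of True] end_letter_notin_run[OF y(1), of False] by simp_all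
    have "expanded (concat (replicate p w) @ e) \<and> code (x = y) True (concat (replicate p w) @ e) = concat (replicate p (?m @ ?n))"
      if "p \<noteq> 0" for p
      using code_power_empty[OF x(1) y(1) J w', of "p - 1"] that True by simp
    then show ?thesis using m ev True
      by (intro exI[of _ "x = y"] exI[of _ "[]"] exI[of _ ?m] exI[of _ ?n]) simp
  qed
qed

lemma power_parses_dvd:
  assumes ab: "a = concat (replicate p w) @ e" "b = concat (replicate q w) @ e"
    and va: "expanded a" "even (length a)" and vb: "expanded b" "even (length b)"
    and mn: "rev m = m" "rev n = n" "m \<noteq> []" "n \<noteq> []" "Beta \<notin> set m" "Alpha \<notin> set n"
    and A: "code f True a = concat (replicate p (E @ m @ rev E @ n)) @ E"
    and B: "code f True b = concat (replicate q (E @ m @ rev E @ n)) @ E"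
    and cp: "class_parses (vec_class b) (vec_class a)"
  shows "(2 * p + 1) dvd (2 * q + 1)"
proof -
  let ?A = "code f True a" and ?B = "code f True b" and ?W = "E @ m @ rev E @ n"
  have vA: "valid ?A" using code_valid va by blast
  have lW: "0 < length ?W" using mn(3) by simp
  from class_parses_iff[OF va vb, of f] cp
  consider "path ?A 0 ?B (length ?A)" | "path (dual ?A) 0 ?B (length ?A)" by blast
  then have "path ?A 0 ?B (length ?A)"
  proof cases
    case 2
    \<comment> \<open>In this case the dual of \<open>?A\<close> is a prefix of \<open>?B\<close>,
      and so is \<open>?A\<close> as a smaller power. Their lengths agree, so \<open>?A\<close> is
      its own dual.\<close>
    have h: "hd ?B = Alpha" "?B \<noteq> []" using code_hd[OF vb(1)] expanded_hd[OF vb(1)] by simp_all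
    obtain z where z: "?B = dual ?A @ z"
      using up_complete[of "dual ?A" ?B "length ?A"] vA code_distinct_adj[OF vb(1)] h 2 by auto
    have "length ?A \<le> length ?B" using z by simp
    then have "p \<le> q" using lW unfolding A B by (simp add: length_concat_replicate)
    then obtain i where i: "q = p + i" using le_Suc_ex by blast
    have "\<exists>z'. ?B = ?A @ z'"
    proof (cases i)
      case 0
      then show ?thesis using A B i by simp
    next
      case (Suc j)
      then have "?B = ?A @ m @ rev E @ n @ concat (replicate j ?W) @ E"
        unfolding A B i Suc concat_replicate_add by simp
      then show ?thesis by blast
    qed
    then obtain z' where "?B = ?A @ z'" by blast
    then have "dual ?A = ?A" using z by (metis append_eq_append_conv length_dual)
    then show ?thesis using 2 by simp
  qed
  then show ?thesis using path_power_dvd[OF vA mn refl A B] by blast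
qed

theorem theorem5:
  fixes K\<^sub>1 K\<^sub>2 :: two_bridge_knot
  shows "incomparable K\<^sub>1 K\<^sub>2 \<and> (\<exists>J. upper_bound J {K\<^sub>1, K\<^sub>2}) \<longleftrightarrow>
    (\<exists>a\<in>S_even. \<exists>b\<in>S_even. K\<^sub>1 = Phi (vec_class a) \<and> K\<^sub>2 = Phi (vec_class b) \<and>
      (\<exists>(p::nat) (q::nat) (e::int list) (w::int list) (m::int) (n::int).
         a = concat (replicate p w) @ e \<and> b = concat (replicate q w) @ e \<and>
         e \<in> S_even \<and> w = e @ bold m @ rev e @ bold n \<and> even m \<and> even n \<and>
         \<not> (2 * q + 1) dvd (2 * p + 1) \<and> \<not> (2 * p + 1) dvd (2 * q + 1)))"
proof (standard, goal_cases)
  case L: 1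
  then obtain J where J: "ors_ge J K\<^sub>1" "ors_ge J K\<^sub>2" by (auto simp: upper_bound_def)
  obtain c a where ca: "c \<in> S_even" "a \<in> S_even" "J = Phi (vec_class c)" "K\<^sub>1 = Phi (vec_class a)"
    "class_parses (vec_class c) (vec_class a)" using ors_geD[OF J(1)] by blast
  obtain c' b where cb: "c' \<in> S_even" "b \<in> S_even" "J = Phi (vec_class c')" "K\<^sub>2 = Phi (vec_class b)"
    "class_parses (vec_class c') (vec_class b)" using ors_geD[OF J(2)] by blast
  have cc: "vec_class c' = vec_class c" using ca(1,3) cb(1,3) Phi_eq_iff by metis
  have inc: "\<not> class_parses (vec_class a) (vec_class b)" "\<not> class_parses (vec_class b) (vec_class a)"
    using L ca cb ors_ge_iff unfolding incomparable_def by blast+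
  obtain c\<^sub>1 a\<^sub>1 where 1: "c\<^sub>1 \<in> vec_class c" "a\<^sub>1 \<in> vec_class a" "parses c\<^sub>1 a\<^sub>1"
    using ca(5) unfolding class_parses_def by blast
  obtain c\<^sub>2 b\<^sub>1 where 2: "c\<^sub>2 \<in> vec_class c" "b\<^sub>1 \<in> vec_class b" "parses c\<^sub>2 b\<^sub>1"
    using cb(5) cc unfolding class_parses_def by blast
  have S: "a \<in> S" "b \<in> S" "c \<in> S" using ca cb by (auto simp: S_even_def)
  have E1: "a\<^sub>1 \<in> S_even" "b\<^sub>1 \<in> S_even" "c\<^sub>1 \<in> S_even" "c\<^sub>2 \<in> S_even"
    using S_even_vec_class ca(1,2) cb(2) 1 2 by blast+
  have cl: "vec_class a\<^sub>1 = vec_class a" "vec_class b\<^sub>1 = vec_class b" "vec_class c\<^sub>1 = vec_class c"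
    using vec_class_eq S 1 2 by blast+
  have ne: "a\<^sub>1 \<noteq> []" "b\<^sub>1 \<noteq> []"
  proof -
    have "class_parses (vec_class u) (vec_class [])" if "u \<in> S" for u using parses_class[OF parses_empty[OF that]] .
    then show "a\<^sub>1 \<noteq> []" "b\<^sub>1 \<noteq> []" using inc cl S by metis+
  qed
  have "c\<^sub>1 \<noteq> []" "c\<^sub>2 \<noteq> []" using 1(3) 2(3) ne blocks_hd parses_iff by blast+
  then have V: "expanded a\<^sub>1" "even (length a\<^sub>1)" "expanded b\<^sub>1" "even (length b\<^sub>1)" "expanded c\<^sub>1" "even (length c\<^sub>1)" "expanded c\<^sub>2" "even (length c\<^sub>2)"
    using E1 ne unfolding S_even_def S_iff by auto
  have pa: "path (code f True a\<^sub>1) 0 (code f True c\<^sub>1) (length (code f True a\<^sub>1))" for f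
    using blocks_path[OF V(1,2), of True 1 c\<^sub>1 f] 1(3) V(5,6) by (simp add: parses_iff source_def)
  have pb: "path (code f True b\<^sub>1) 0 (code f True c\<^sub>2) (length (code f True b\<^sub>1))" for f
    using blocks_path[OF V(3,4), of True 1 c\<^sub>2 f] 2(3) V(7,8) by (simp add: parses_iff source_def)
  have "c\<^sub>1 \<in> S" "c\<^sub>2 \<in> vec_class c\<^sub>1" using 2(1) cl(3) E1(3) by (simp_all add: S_even_def)
  then obtain d where d: "d \<in> {-1, 1}" "c\<^sub>2 = scale d c\<^sub>1 \<or> c\<^sub>2 = scale d (rev c\<^sub>1)"
    using mem_vec_class by blast
  \<comment> \<open>The two parsings may use different representatives of the class of
    \<open>c\<close>. Replacing \<open>b\<^sub>1\<close> by its reversal if necessary makes both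
    paths read the code of \<open>c\<^sub>1\<close>.\<close>
  obtain b\<^sub>2 where b2: "expanded b\<^sub>2" "even (length b\<^sub>2)" "vec_class b\<^sub>2 = vec_class b"
    "\<And>f. path (code f True b\<^sub>2) 0 (code f True c\<^sub>1) (length (code f True b\<^sub>2))"
  proof (cases "c\<^sub>2 = scale d c\<^sub>1")
    case True
    then have "code f True c\<^sub>2 = code f True c\<^sub>1" for f using code_scale[OF d(1)] by simp
    then show ?thesis using that[of b\<^sub>1] V cl pb by simp
  next
    case False
    then have "code f True c\<^sub>2 = dual (code f True c\<^sub>1)" for f
      using d(2) code_scale[OF d(1)] code_rev_even[OF V(6)] by metis
    then have "path (code f True (rev b\<^sub>1)) 0 (code f True c\<^sub>1) (length (code f True (rev b\<^sub>1)))" for f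
      using path_dual_rev[OF pb[of f]] code_rev_even[OF V(4)] by simp
    moreover have "rev b\<^sub>1 \<in> vec_class b\<^sub>1"
    proof -
      have "b\<^sub>1 \<in> S" using E1(2) by (simp add: S_even_def)
      from mem_vec_class[OF this, of "rev b\<^sub>1"] show ?thesis by (metis insertI1 insertI2 scale_simps(5))
    qed
    then have "vec_class (rev b\<^sub>1) = vec_class b" using vec_class_eq cl(2) E1(2) by (auto simp: S_even_def)
    ultimately show ?thesis using that[of "rev b\<^sub>1"] V(3,4) expanded_rev by simp
  qed
  have inc': "\<not> class_parses (vec_class a\<^sub>1) (vec_class b\<^sub>2)" "\<not> class_parses (vec_class b\<^sub>2) (vec_class a\<^sub>1)"
    using inc cl b2(3) by simp_all
  obtain e k l P Q d\<^sub>1 d\<^sub>2 where e: "e \<in> S_even" and d12: "d\<^sub>1 \<in> {-1, 1}" "d\<^sub>2 \<in> {-1, 1}"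
    and sa: "a\<^sub>1 = scale d\<^sub>1 (concat (replicate P (e @ bold (2 * k) @ rev e @ bold (2 * l))) @ e)"
    and sb: "b\<^sub>2 = scale d\<^sub>2 (concat (replicate Q (e @ bold (2 * k) @ rev e @ bold (2 * l))) @ e)"
  proof (cases "length a\<^sub>1 \<le> length b\<^sub>2")
    case True
    from power_form_of_bound[OF V(1,2) b2(1,2) V(5,6) pa b2(4) True inc'(2)]
    show ?thesis unfolding Let_def using that by blast
  next
    case False
    then have "length b\<^sub>2 \<le> length a\<^sub>1" by simp
    from power_form_of_bound[OF b2(1,2) V(1,2,5,6) b2(4) pa this inc'(1)]
    show ?thesis unfolding Let_def using that by blast
  qed
  define w where "w = e @ bold (2 * k) @ rev e @ bold (2 * l)"
  define a' where "a' = concat (replicate P w) @ e"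
  define b' where "b' = concat (replicate Q w) @ e"
  have member: "u' \<in> S_even \<and> vec_class u' = vec_class u" if u: "u = scale d' u'" "d' \<in> {-1, 1}" "expanded u" "even (length u)" for u u' d'
  proof -
    have "u \<in> S_even" using u(3,4) S_of_expanded by (simp add: S_even_def)
    moreover have "u' = scale d' u" using u(1,2) by auto
    then have "u' \<in> vec_class u" using mem_vec_class S_of_expanded[OF u(3)] u(2) by blast
    ultimately show ?thesis using S_even_vec_class vec_class_eq[OF S_of_expanded[OF u(3)]] by blast
  qed
  have A: "a' \<in> S_even" "vec_class a' = vec_class a" using member[OF _ d12(1) V(1,2), of a'] sa cl by (auto simp: a'_def w_def)
  have B: "b' \<in> S_even" "vec_class b' = vec_class b" using member[OF _ d12(2) b2(1,2), of b'] sb b2(3) by (auto simp: b'_def w_def)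
  \<comment> \<open>The quotient of odd numbers is odd, so divisibility would give a parsing by
    \<open>power_blocks\<close> and contradict incomparability.\<close>
  have dvd: "class_parses (vec_class (concat (replicate r w) @ e)) (vec_class (concat (replicate s w) @ e))"
    if "(2 * s + 1) dvd (2 * r + 1)" "concat (replicate r w) @ e \<in> S_even" "concat (replicate s w) @ e \<in> S_even" for r s :: nat
  proof -
    obtain t where t: "2 * r + 1 = (2 * s + 1) * t" using \<open>(2 * s + 1) dvd (2 * r + 1)\<close> by blast
    have "odd ((2 * s + 1) * t)" unfolding t[symmetric] by simp
    then have "odd t" using even_mult_iff by blast
    then obtain i where "t = 2 * i + 1" by (rule oddE)
    then have "blocks (concat (replicate s w) @ e) True 1 (concat (replicate r w) @ e)"
      using power_blocks[OF w_def refl, of r s i] t by simp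
    then show ?thesis using parses_class parses_iff that(2,3) unfolding S_even_def by blast
  qed
  have "\<not> (2 * Q + 1) dvd (2 * P + 1)" using dvd[of Q P] inc A B unfolding a'_def b'_def by metis
  moreover have "\<not> (2 * P + 1) dvd (2 * Q + 1)" using dvd[of P Q] inc A B unfolding a'_def b'_def by metis
  moreover have "K\<^sub>1 = Phi (vec_class a')" "K\<^sub>2 = Phi (vec_class b')" using A B ca cb by simp_all
  moreover have "even (2 * k)" "even (2 * l)" by simp_all
  ultimately show ?case
    using A(1) B(1) e a'_def b'_def w_def by blast
next
  case 2
  then obtain a b p q e w m n where ab: "a \<in> S_even" "b \<in> S_even" "K\<^sub>1 = Phi (vec_class a)" "K\<^sub>2 = Phi (vec_class b)"
    "a = concat (replicate p w) @ e" "b = concat (replicate q w) @ e" "e \<in> S_even"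
    "w = e @ bold m @ rev e @ bold n" "even m" "even n"
    "\<not> (2 * q + 1) dvd (2 * p + 1)" "\<not> (2 * p + 1) dvd (2 * q + 1)" by (elim bexE exE conjE)
  obtain k where k: "m = 2 * k" using ab(9) by blast
  obtain l where l: "n = 2 * l" using ab(10) by blast
  have w: "w = e @ bold (2 * k) @ rev e @ bold (2 * l)" using ab(8) k l by simp
  have pq: "p \<noteq> 0" "q \<noteq> 0" using ab(11,12) by (auto intro: gr0I)
  \<comment> \<open>Otherwise \<open>a\<close> would start or end with a zero entry.\<close>
  have nz: "k \<noteq> 0 \<and> l \<noteq> 0" if e: "e = []"
  proof -
    obtain p' where p': "p = Suc p'" using pq(1) by (cases p) auto
    have a: "a = w @ concat (replicate p' w)" "a = concat (replicate p' w) @ w"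
      using ab(5) e p' concat_replicate_add[of p' 1 w] by simp_all
    have h: "hd a = hd (bold (2 * k))" "a \<noteq> []" using a(1) w e by simp_all
    have h': "last a = last (bold (2 * l))" unfolding a(2) using w e by simp
    have "a \<in> S" using ab(1) by (simp add: S_even_def)
    then have "hd a \<noteq> 0" "last a \<noteq> 0" using h(2) by (simp_all add: S_def)
    then show ?thesis using h(1) h' by (auto simp: bold_0)
  qed
  obtain f E M N where MN: "rev M = M" "rev N = N" "M \<noteq> []" "N \<noteq> []" "Beta \<notin> set M" "Alpha \<notin> set N"
    and pw: "\<And>r. r \<noteq> 0 \<Longrightarrow> expanded (concat (replicate r w) @ e) \<and> even (length (concat (replicate r w) @ e)) \<and>
      code f True (concat (replicate r w) @ e) = concat (replicate r (E @ M @ rev E @ N)) @ E"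
    using power_words[OF ab(7) w nz] by blast
  have va: "expanded a" "even (length a)" "code f True a = concat (replicate p (E @ M @ rev E @ N)) @ E"
    using pw[OF pq(1)] ab(5) by auto
  have vb: "expanded b" "even (length b)" "code f True b = concat (replicate q (E @ M @ rev E @ N)) @ E"
    using pw[OF pq(2)] ab(6) by auto
  have "\<not> class_parses (vec_class b) (vec_class a)"
    using power_parses_dvd[OF ab(5,6) va(1,2) vb(1,2) MN va(3) vb(3)] ab(12) by blast
  moreover have "\<not> class_parses (vec_class a) (vec_class b)"
    using power_parses_dvd[OF ab(6,5) vb(1,2) va(1,2) MN vb(3) va(3)] ab(11) by blast
  ultimately have inc: "incomparable K\<^sub>1 K\<^sub>2" unfolding incomparable_def ab(3,4) using ors_ge_iff ab(1,2) by blast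
  \<comment> \<open>Chosen so that \<open>2 * r + 1\<close> is the product of
    \<open>2 * p + 1\<close> and \<open>2 * q + 1\<close>; then \<open>w^r e\<close> lies above both
    knots.\<close>
  define r where "r = (2 * p + 1) * q + p"
  define c where "c = concat (replicate r w) @ e"
  have r: "2 * r + 1 = (2 * p + 1) * (2 * q + 1)" "2 * r + 1 = (2 * q + 1) * (2 * p + 1)"
    by (simp_all add: r_def algebra_simps)
  have "r \<noteq> 0" using pq by (simp add: r_def)
  then have c: "c \<in> S_even" using pw S_of_expanded by (simp add: S_even_def c_def)
  have "blocks a True 1 c" unfolding c_def by (rule power_blocks[OF w ab(5) r(1)])
  moreover have "blocks b True 1 c" unfolding c_def by (rule power_blocks[OF w ab(6) r(2)])
  ultimately have "parses c a" "parses c b" using c ab(1,2) parses_iff by (auto simp: S_even_def)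
  then have "upper_bound (Phi (vec_class c)) {K\<^sub>1, K\<^sub>2}"
    using parses_class ors_ge_iff c ab(1-4) by (auto simp: upper_bound_def)
  then show ?case using inc by blast
qed

end
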